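(* For every $2\le r\le C\ell$, \[ P_{\mathrm{red},r}\le(1+2^{-C\ell})P^{\mathrm{per}}_{\mathrm{red},r}\quad\text{and}\quad \overline P_{\mathrm{blue},r}\le(1+2^{-C\ell})\overline P^{\mathrm{per}}_{\mathrm{blue},r}. \]
   Context: Parameters: fix $C>1$; $p_C\in(0,1/2)$ is the unique solution of $C=\frac{\log p_C}{\log(1-p_C)}$; $\alpha_C:=\max\{1000,20\sqrt{C\log(10/p_C)}\}$. $D,\ell_0$ are constants with $\ell_0\gg D\gg C$ ($D$ sufficiently large in terms of $C$, $\ell_0$ sufficiently large in terms of $D,C$); $\ell\ge\ell_0$ integer, $k=D^2\ell^2$, $p\in(p_C,1/2)$ fixed. Quantities like $C\ell$ are treated as integers. $S^k$ is the unit sphere in $\mathbb R^{k+1}$ with uniform probability $\mathbb P$. $c_{k,p}\ge0$ is defined by $\mathbb P(\langle\mathbf x,\mathbf e\rangle\le-c_{k,p}/\sqrt k)=p$ for $\mathbf x$ uniform on $S^k$ and $\mathbf e$ a fixed unit vector. For $\mathbf x[r]=(\mathbf x_1,\dots,\mathbf x_r)$, $G_p(\mathbf x[r])$ is the complete graph on these points with edge $\mathbf x_i\mathbf x_j$ red iff $\langle\mathbf x_i,\mathbf x_j\rangle\le -c_{k,p}/\sqrt k$, blue otherwise. $\pi_{[i]}$ denotes orthogonal projection onto $\mathrm{span}(\mathbf x_1,\dots,\mathbf x_i)$. A sequence $\mathbf x[r]$ is perfect if $|\pi_{[i]}(\mathbf x_{i+1})|\le\alpha_C\sqrt\ell/\sqrt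 k$ for all $1\le i\le r-1$. For a random $r$-tuple $\mathbf x[r]$ of independent uniform points of $S^k$: $P_{\mathrm{red},r}$ (resp. $\overline P_{\mathrm{blue},r}$) is the probability that $G_p(\mathbf x[r])$ is a red (resp. blue) clique, and $P^{\mathrm{per}}_{\mathrm{red},r}$ (resp. $\overline P^{\mathrm{per}}_{\mathrm{blue},r}$) is the probability that $G_p(\mathbf x[r])$ is a red (resp. blue) clique and $\mathbf x[r]$ is perfect. *)

theory Defs
  imports "HOL-Probability.Probability"
begin

text \<open>The dimension grows with \<open>l\<close>, so vectors of \<open>\<real>\<^bsup>k+1\<^esup>\<close> are functions
  \<open>nat \<Rightarrow> real\<close> that are extensional on the coordinate set \<open>{..k}\<close> (the carrier of the product
  measure over \<open>{..k}\<close>); the Euclidean norm is \<open>L2_set x {..k}\<close>.\<close>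

definition ip :: "nat \<Rightarrow> (nat \<Rightarrow> real) \<Rightarrow> (nat \<Rightarrow> real) \<Rightarrow> real" where
  "ip k x y = (\<Sum>j\<le>k. x j * y j)"

definition unit_sphere :: "nat \<Rightarrow> (nat \<Rightarrow> real) set" where
  "unit_sphere k = {x \<in> {..k} \<rightarrow>\<^sub>E UNIV. L2_set x {..k} = 1}"

definition unit_ball :: "nat \<Rightarrow> (nat \<Rightarrow> real) set" where
  "unit_ball k = {x \<in> {..k} \<rightarrow>\<^sub>E UNIV. L2_set x {..k} \<le> 1}"

text \<open>Normalised surface measure of \<open>S\<^bsup>k\<^esup>\<close>, as the cone measure: the law of \<open>x / \<bar>x\<bar>\<close> for \<open>x\<close>
  uniform in the unit ball (the origin is a null set). It lives on all of \<open>\<real>\<^bsup>k+1\<^esup>\<close> and is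
  concentrated on \<open>unit_sphere k\<close>.\<close>

definition sphere_unif :: "nat \<Rightarrow> (nat \<Rightarrow> real) measure" where
  "sphere_unif k =
     distr (uniform_measure (\<Pi>\<^sub>M j\<in>{..k}. lborel) (unit_ball k)) (\<Pi>\<^sub>M j\<in>{..k}. borel)
       (\<lambda>x. \<lambda>j\<in>{..k}. x j / L2_set x {..k})"

definition cap_const :: "nat \<Rightarrow> real \<Rightarrow> real" where
  "cap_const k p = (THE c. c \<ge> 0 \<and> (\<forall>e \<in> unit_sphere k.
     measure (sphere_unif k) {x \<in> space (sphere_unif k). ip k x e \<le> - c / sqrt (real k)} = p))"

definition p_crit :: "real \<Rightarrow> real" where
  "p_crit C = (THE q. 0 < q \<and> q < 1/2 \<and> C = ln q / ln (1 - q))"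

definition alpha :: "real \<Rightarrow> real" where
  "alpha C = max 1000 (20 * sqrt (C * ln (10 / p_crit C)))"

text \<open>A tuple of \<open>r\<close> points is a function \<open>x\<close> on the index set \<open>{1..r}\<close>.\<close>

datatype colour = Red | Blue

definition edge_colour :: "nat \<Rightarrow> real \<Rightarrow> (nat \<Rightarrow> nat \<Rightarrow> real) \<Rightarrow> nat \<Rightarrow> nat \<Rightarrow> colour" where
  "edge_colour k p x i j =
     (if ip k (x i) (x j) \<le> - cap_const k p / sqrt (real k) then Red else Blue)"

definition is_clique :: "colour \<Rightarrow> nat \<Rightarrow> real \<Rightarrow> nat \<Rightarrow> (nat \<Rightarrow> nat \<Rightarrow> real) \<Rightarrow> bool" where
  "is_clique col k p r x \<longleftrightarrow>
     (\<forall>i\<in>{1..r}. \<forall>j\<in>{1..r}. i \<noteq> j \<longrightarrow> edge_colour k p x i j = col)"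

definition span_first :: "nat \<Rightarrow> (nat \<Rightarrow> nat \<Rightarrow> real) \<Rightarrow> nat \<Rightarrow> (nat \<Rightarrow> real) set" where
  "span_first k x i = range (\<lambda>a. \<lambda>j\<in>{..k}. \<Sum>m=1..i. a m * x m j)"

definition orth_proj :: "nat \<Rightarrow> (nat \<Rightarrow> real) set \<Rightarrow> (nat \<Rightarrow> real) \<Rightarrow> (nat \<Rightarrow> real)" where
  "orth_proj k V v = (THE w. w \<in> V \<and> (\<forall>u\<in>V. ip k (\<lambda>j. v j - w j) u = 0))"

definition perfect :: "real \<Rightarrow> nat \<Rightarrow> nat \<Rightarrow> nat \<Rightarrow> (nat \<Rightarrow> nat \<Rightarrow> real) \<Rightarrow> bool" where
  "perfect C l k r x \<longleftrightarrow>
     (\<forall>i\<in>{1..r - 1}. L2_set (orth_proj k (span_first k x i) (x (i + 1))) {..k}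
        \<le> alpha C * sqrt (real l) / sqrt (real k))"

definition sphere_tuples :: "nat \<Rightarrow> nat \<Rightarrow> (nat \<Rightarrow> nat \<Rightarrow> real) measure" where
  "sphere_tuples k r = (\<Pi>\<^sub>M i\<in>{1..r}. sphere_unif k)"

definition P_clique :: "colour \<Rightarrow> nat \<Rightarrow> real \<Rightarrow> nat \<Rightarrow> real" where
  "P_clique col k p r =
     measure (sphere_tuples k r) {x \<in> space (sphere_tuples k r). is_clique col k p r x}"

definition P_clique_per :: "colour \<Rightarrow> real \<Rightarrow> nat \<Rightarrow> nat \<Rightarrow> real \<Rightarrow> nat \<Rightarrow> real" where
  "P_clique_per col C l k p r =
     measure (sphere_tuples k r)
       {x \<in> space (sphere_tuples k r). is_clique col k p r x \<and> perfect C l k r x}"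

end

theory Submission
  imports Defs "HOL-Real_Asymp.Real_Asymp"
begin

text \<open>Split the cliques that are not perfect according to the first vertex \<open>x\<^sub>i\<^sub>+\<^sub>1\<close> whose projection is
  too long. This vertex can be dropped: what remains is a clique on \<open>r - 1\<close> points, and given a
  perfect prefix the long projection has probability at most \<open>exp (- 31 N L)\<close> up to a factor \<open>2\<close>,
  where \<open>N = C l\<close> and \<open>L = ln (10 / p_crit C)\<close>. Conversely a perfect clique on \<open>r - 1\<close> points
  extends to a perfect clique on \<open>r\<close> points with probability at least \<open>exp (- 25 N L) / 2\<close>, so by
  induction on \<open>r\<close> the imperfect cliques are negligible.

  Both estimates use that the Gram matrix of a perfect sequence is close to the identity, and that a
  uniform point of the sphere is a normalised Gaussian vector. The first is a Chernoff bound; the second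
  averages a box over its translates by dual vectors and applies the Cameron--Martin formula.\<close>

section \<open>Projections and Gram matrices\<close>

definition lincomb :: "(nat \<Rightarrow> nat \<Rightarrow> real) \<Rightarrow> nat set \<Rightarrow> (nat \<Rightarrow> real) \<Rightarrow> nat \<Rightarrow> real" where
  "lincomb x J a = (\<lambda>j. \<Sum>m\<in>J. a m * x m j)"

lemma ip_commute: "ip k x y = ip k y x"
  by (simp add: ip_def mult.commute)

lemma ip_add_left: "ip k (\<lambda>j. x j + y j) z = ip k x z + ip k y z"
  by (simp add: ip_def algebra_simps sum.distrib)

lemma ip_diff_left: "ip k (\<lambda>j. x j - y j) z = ip k x z - ip k y z"
  by (simp add: ip_def algebra_simps sum_subtractf)

lemma ip_scale_left: "ip k (\<lambda>j. c * x j) z = c * ip k x z"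
  by (simp add: ip_def algebra_simps sum_distrib_left)

lemma ip_restrict_left: "ip k (\<lambda>j\<in>{..k}. f j) y = ip k f y"
  by (simp add: ip_def)

lemma ip_cong_left: "(\<And>j. j \<le> k \<Longrightarrow> x j = y j) \<Longrightarrow> ip k x z = ip k y z"
  by (simp add: ip_def)

lemma ip_lincomb_left: "ip k (lincomb x J a) v = (\<Sum>m\<in>J. a m * ip k (x m) v)"
  by (simp add: ip_def lincomb_def sum_distrib_left sum_distrib_right mult.assoc) (rule sum.swap)

lemma ip_lincomb_right: "ip k v (lincomb x J a) = (\<Sum>m\<in>J. a m * ip k v (x m))"
  using ip_lincomb_left[of k x J a v] by (simp add: ip_commute)

lemma ip_self: "ip k x x = (L2_set x {..k})\<^sup>2"
  by (simp add: ip_def L2_set_def sum_nonneg power2_eq_square)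

lemma ip_self_nonneg: "0 \<le> ip k x x"
  by (simp add: ip_self)

lemma ip_cauchy_schwarz: "\<bar>ip k x y\<bar> \<le> L2_set x {..k} * L2_set y {..k}"
proof -
  have "\<bar>ip k x y\<bar> \<le> (\<Sum>j\<le>k. \<bar>x j\<bar> * \<bar>y j\<bar>)"
    unfolding ip_def by (rule order_trans[OF sum_abs]) (simp add: abs_mult)
  then show ?thesis using L2_set_mult_ineq[of x y "{..k}"] by linarith
qed

lemma ip_eq_0_of_self: "ip k x x = 0 \<Longrightarrow> ip k x y = 0"
  using ip_cauchy_schwarz[of k x y] by (simp add: ip_self)

text \<open>Gram--Schmidt, one vector per induction step; the hypothesis is applied both to
  \<open>v\<close> and to the new vector \<open>x m\<close>. Linear dependence among the vectors is
  allowed.\<close>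

lemma exists_orthogonal_residual:
  assumes "finite J"
  shows "\<exists>a. \<forall>j\<in>J. ip k (\<lambda>t. v t - lincomb x J a t) (x j) = 0"
  using assms
proof (induction J arbitrary: v rule: finite_induct)
  case (insert m J)
  obtain a where a: "\<forall>j\<in>J. ip k (\<lambda>t. x m t - lincomb x J a t) (x j) = 0"
    using insert.IH by blast
  obtain b where b: "\<forall>j\<in>J. ip k (\<lambda>t. v t - lincomb x J b t) (x j) = 0"
    using insert.IH by blast
  define e where "e = (\<lambda>t. x m t - lincomb x J a t)"
  define u where "u = (\<lambda>t. v t - lincomb x J b t)"
  \<comment> \<open>If \<open>e\<close> has norm zero, the quotient is 0 by convention, which is the
    right value because \<open>ip k u e\<close> vanishes as well.\<close>
  define c where "c = ip k u e / ip k e e"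
  define d where "d = (\<lambda>j. b j - c * a j)(m := c)"
  have d: "(\<lambda>t. v t - lincomb x (insert m J) d t) = (\<lambda>t. u t - c * e t)"
  proof
    fix t
    have "(\<Sum>j\<in>J. d j * x j t) = (\<Sum>j\<in>J. b j * x j t - c * (a j * x j t))"
      using insert.hyps by (intro sum.cong) (auto simp: d_def algebra_simps)
    then show "v t - lincomb x (insert m J) d t = u t - c * e t"
      using insert.hyps
      by (simp add: lincomb_def d_def u_def e_def sum_subtractf sum_distrib_left[symmetric] algebra_simps)
  qed
  have xm: "x m = (\<lambda>t. e t + lincomb x J a t)"
    by (simp add: e_def)
  have ue: "ip k (\<lambda>t. u t - c * e t) e = 0"
  proof -
    have "c * ip k e e = ip k u e"
      using ip_eq_0_of_self[of k e u] by (auto simp: c_def ip_commute[of k e u])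
    then show ?thesis by (simp add: ip_diff_left ip_scale_left)
  qed
  have orth: "ip k (\<lambda>t. u t - c * e t) (x j) = 0" if "j \<in> J" for j
    using a b that by (auto simp: ip_diff_left ip_scale_left u_def[symmetric] e_def[symmetric])
  have "ip k (\<lambda>t. u t - c * e t) (x m) = 0"
    using ue orth by (subst xm) (simp add: ip_commute[of k "\<lambda>t. u t - c * e t"] ip_add_left
      ip_lincomb_left)
  then show ?case
    using orth by (intro exI[of _ d]) (auto simp: d)
qed simp

definition proj_le :: "nat \<Rightarrow> (nat \<Rightarrow> nat \<Rightarrow> real) \<Rightarrow> nat set \<Rightarrow> (nat \<Rightarrow> real) \<Rightarrow> real \<Rightarrow> bool" where
  "proj_le k x J v s \<longleftrightarrow>
     (\<forall>a. \<bar>ip k v (lincomb x J a)\<bar> \<le> s * L2_set (lincomb x J a) {..k})"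

text \<open>By Cauchy--Schwarz, a bound on the projection onto a span can be tested on the span itself;
  the test form avoids the definite description in \<open>orth_proj\<close>.\<close>

lemma norm_orth_proj_le_iff:
  "L2_set (orth_proj k (span_first k x i) v) {..k} \<le> s \<longleftrightarrow> proj_le k x {1..i} v s \<and> 0 \<le> s"
proof -
  let ?V = "span_first k x i"
  obtain a where a: "\<forall>j\<in>{1..i}. ip k (\<lambda>t. v t - lincomb x {1..i} a t) (x j) = 0"
    using exists_orthogonal_residual[of "{1..i}" k v x] by auto
  define w where "w = (\<lambda>j\<in>{..k}. lincomb x {1..i} a j)"
  have V: "?V = range (\<lambda>b. \<lambda>j\<in>{..k}. lincomb x {1..i} b j)"
    by (simp add: span_first_def lincomb_def)
  have wV: "w \<in> ?V" by (auto simp: V w_def)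
  have resid: "ip k (\<lambda>j. v j - w j) (lincomb x {1..i} b) = 0" for b
  proof -
    have "ip k (\<lambda>j. v j - w j) (lincomb x {1..i} b) = ip k (\<lambda>j. v j - lincomb x {1..i} a j) (lincomb x {1..i} b)"
      by (rule ip_cong_left) (simp add: w_def)
    also have "\<dots> = 0" using a by (simp add: ip_lincomb_right)
    finally show ?thesis .
  qed
  have wproj: "w \<in> ?V \<and> (\<forall>u\<in>?V. ip k (\<lambda>j. v j - w j) u = 0)"
    using wV resid by (auto simp: V ip_commute[of k "\<lambda>j. v j - w j"] ip_restrict_left)
  \<comment> \<open>The difference of two candidates is orthogonal to itself, so they agree on
    \<open>{..k}\<close>; outside they agree because both are extensional.\<close>
  have uniq: "w' = w" if w': "w' \<in> ?V \<and> (\<forall>u\<in>?V. ip k (\<lambda>j. v j - w' j) u = 0)" for w'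
  proof -
    have "ip k w w = ip k v w" "ip k w' w = ip k v w" "ip k w w' = ip k v w'" "ip k w' w' = ip k v w'"
      using wproj w' by (auto simp: ip_diff_left)
    then have "ip k (\<lambda>j. w j - w' j) (\<lambda>j. w j - w' j) = 0"
      by (simp add: ip_diff_left ip_commute[of k _ "\<lambda>j. w j - w' j"] ip_commute[of k w' w])
    then have "\<forall>j\<le>k. w j = w' j"
      by (simp add: ip_def sum_nonneg_eq_0_iff)
    moreover have "w \<in> extensional {..k}" "w' \<in> extensional {..k}"
      using wV w' by (auto simp: V)
    ultimately show ?thesis by (auto simp: extensional_def fun_eq_iff) (metis linorder_not_le)
  qed
  have op: "orth_proj k ?V v = w"
    unfolding orth_proj_def using wproj uniq by (rule the_equality)
  have L2w: "L2_set w {..k} = L2_set (lincomb x {1..i} a) {..k}"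
    by (rule L2_set_cong) (auto simp: w_def)
  have vw: "ip k v (lincomb x {1..i} b) = ip k w (lincomb x {1..i} b)" for b
    using resid[of b] by (simp add: ip_diff_left)
  show ?thesis
  proof
    assume le: "L2_set (orth_proj k ?V v) {..k} \<le> s"
    then have le: "L2_set w {..k} \<le> s" by (simp add: op)
    have "\<bar>ip k w (lincomb x {1..i} b)\<bar> \<le> s * L2_set (lincomb x {1..i} b) {..k}" for b
      using ip_cauchy_schwarz[of k w "lincomb x {1..i} b"]
        mult_right_mono[OF le, of "L2_set (lincomb x {1..i} b) {..k}"] by simp
    moreover have "0 \<le> s" using le order_trans[OF L2_set_nonneg] by blast
    ultimately show "proj_le k x {1..i} v s \<and> 0 \<le> s" unfolding proj_le_def vw by blast
  next
    assume *: "proj_le k x {1..i} v s \<and> 0 \<le> s"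
    \<comment> \<open>Testing against the projection itself turns the hypothesis into |w|^2 \<le> s
      |w|.\<close>
    have "ip k w (lincomb x {1..i} a) = ip k w w"
      by (subst (1 2) ip_commute) (rule ip_cong_left, simp add: w_def)
    then have "(L2_set w {..k})\<^sup>2 \<le> s * L2_set w {..k}"
    proof -
      have "ip k w w \<le> s * L2_set (lincomb x {1..i} a) {..k}"
        using * vw[of a] \<open>ip k w _ = ip k w w\<close> unfolding proj_le_def by (metis abs_le_iff)
      then show ?thesis by (simp only: ip_self L2w)
    qed
    then have "L2_set w {..k} \<le> s"
      using * by (cases "L2_set w {..k} = 0") (auto simp: power2_eq_square less_le)
    then show "L2_set (orth_proj k ?V v) {..k} \<le> s" by (simp add: op)
  qed
qed

text \<open>Weighted AM-GM for the cross term of |S + t x|^2, where \<open>q\<close> is the norm of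
  the old combination S and \<open>c\<close> its inner product with the new vector x. The weight
  \<eta> charges part of it to S and the rest to \<open>t\<close>.\<close>

lemma gram_step:
  fixes q c \<delta> \<eta> t :: real
  assumes "0 < \<eta>" "0 \<le> q" "\<bar>c\<bar> \<le> \<delta> * q"
  shows "\<bar>2 * t * c\<bar> \<le> \<eta> * q\<^sup>2 + \<delta>\<^sup>2 / \<eta> * t\<^sup>2"
proof -
  have "\<bar>2 * t * c\<bar> \<le> 2 * \<bar>t\<bar> * (\<delta> * q)"
    using assms by (simp add: abs_mult mult_left_mono)
  also have "\<dots> \<le> \<eta> * q\<^sup>2 + \<delta>\<^sup>2 / \<eta> * t\<^sup>2"
  proof -
    have "0 \<le> (\<eta> * q - \<delta> * \<bar>t\<bar>)\<^sup>2 / \<eta>" using assms by simp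
    also have "\<dots> = \<eta> * q\<^sup>2 + \<delta>\<^sup>2 / \<eta> * t\<^sup>2 - 2 * \<bar>t\<bar> * (\<delta> * q)"
      using assms by (simp add: power2_eq_square field_simps)
    finally show ?thesis by simp
  qed
  finally show ?thesis .
qed

text \<open>Each new vector multiplies the contribution of the older ones by at most 1 \<plusminus>
  \<eta>, while its own error \<delta>^2 / \<eta> is paid only once. Entrywise estimates would be
  too weak: they give row sums of order i \<delta>, whereas only i \<delta>^2 is small. The
  projection bound controls a whole row at once.\<close>

lemma gram_bounds_aux:
  assumes unit: "\<And>m. m \<in> {1..i} \<Longrightarrow> ip k (x m) (x m) = 1"
    and proj: "\<And>m. m \<in> {1..<i} \<Longrightarrow> proj_le k x {1..m} (x (Suc m)) \<delta>"
    and "0 < \<eta>" "\<eta> \<le> 1" "\<delta>\<^sup>2 / \<eta> \<le> 1" and "m \<le> i"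
  shows "(1 - \<eta>) ^ m * (1 - \<delta>\<^sup>2 / \<eta>) * (\<Sum>j\<in>{1..m}. (a j)\<^sup>2)
           \<le> ip k (lincomb x {1..m} a) (lincomb x {1..m} a) \<and>
         ip k (lincomb x {1..m} a) (lincomb x {1..m} a)
           \<le> (1 + \<eta>) ^ m * (1 + \<delta>\<^sup>2 / \<eta>) * (\<Sum>j\<in>{1..m}. (a j)\<^sup>2)"
  using \<open>m \<le> i\<close>
proof (induction m)
  case 0
  then show ?case by (simp add: lincomb_def ip_def)
next
  case (Suc m)
  let ?S = "lincomb x {1..m} a" and ?A = "\<Sum>j\<in>{1..m}. (a j)\<^sup>2" and ?q = "L2_set (lincomb x {1..m} a) {..k}"
  let ?c = "ip k (x (Suc m)) ?S" and ?r = "\<delta>\<^sup>2 / \<eta>" and ?t = "a (Suc m)"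
  have S: "lincomb x {1..Suc m} a = (\<lambda>j. ?S j + ?t * x (Suc m) j)"
    by (simp add: lincomb_def fun_eq_iff)
  have xx: "ip k (x (Suc m)) (x (Suc m)) = 1" using Suc.prems by (intro unit) auto
  have Q: "ip k (lincomb x {1..Suc m} a) (lincomb x {1..Suc m} a) = ?q\<^sup>2 + ?t\<^sup>2 + 2 * ?t * ?c"
    using xx unfolding S ip_add_left ip_scale_left ip_commute[of k _ "\<lambda>j. ?S j + ?t * x (Suc m) j"]
    unfolding ip_self[of k ?S, symmetric] ip_commute[of k ?S "x (Suc m)"]
    by (simp add: algebra_simps power2_eq_square)
  have "\<bar>?c\<bar> \<le> \<delta> * ?q"
  \<comment> \<open>The projection bounds start with the second vector; before the first one the
    combination is empty, hence zero.\<close>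
  proof (cases "m = 0")
    case True then show ?thesis by (simp add: lincomb_def ip_def L2_set_def)
  next
    case False
    then show ?thesis using proj[of m] Suc.prems by (auto simp: proj_le_def)
  qed
  then have c: "\<bar>2 * ?t * ?c\<bar> \<le> \<eta> * ?q\<^sup>2 + ?r * ?t\<^sup>2"
    by (intro gram_step assms) auto
  have IH: "(1 - \<eta>) ^ m * (1 - ?r) * ?A \<le> ?q\<^sup>2" "?q\<^sup>2 \<le> (1 + \<eta>) ^ m * (1 + ?r) * ?A"
    using Suc by (auto simp: ip_self)
  have r0: "0 \<le> ?r" using assms by simp
  have "(1 - \<eta>) ^ Suc m \<le> 1" using assms by (intro power_le_one) auto
  then have "(1 - \<eta>) ^ Suc m * ((1 - ?r) * ?t\<^sup>2) \<le> 1 * ((1 - ?r) * ?t\<^sup>2)"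
    using assms by (intro mult_right_mono) auto
  moreover have "(1 - \<eta>) * ((1 - \<eta>) ^ m * (1 - ?r) * ?A) \<le> (1 - \<eta>) * ?q\<^sup>2"
    using assms IH by (intro mult_left_mono) auto
  ultimately have lo: "(1 - \<eta>) ^ Suc m * (1 - ?r) * (?A + ?t\<^sup>2) \<le> (1 - \<eta>) * ?q\<^sup>2 + (1 - ?r) * ?t\<^sup>2"
    by (simp add: distrib_left mult.assoc)
  have "1 \<le> (1 + \<eta>) ^ Suc m" using assms by (intro one_le_power) auto
  then have "1 * ((1 + ?r) * ?t\<^sup>2) \<le> (1 + \<eta>) ^ Suc m * ((1 + ?r) * ?t\<^sup>2)"
    using r0 by (intro mult_right_mono mult_nonneg_nonneg) auto
  moreover have "(1 + \<eta>) * ?q\<^sup>2 \<le> (1 + \<eta>) * ((1 + \<eta>) ^ m * (1 + ?r) * ?A)"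
    using assms IH by (intro mult_left_mono) auto
  moreover have "(1 + \<eta>) ^ Suc m * (1 + ?r) * (?A + ?t\<^sup>2)
      = (1 + \<eta>) * ((1 + \<eta>) ^ m * (1 + ?r) * ?A) + (1 + \<eta>) ^ Suc m * ((1 + ?r) * ?t\<^sup>2)"
  proof -
    have "e * X * r * (A + t) = e * (X * r * A) + e * X * (r * t)" for e X r A t :: real
      by (simp add: algebra_simps)
    then show ?thesis by (simp only: power_Suc)
  qed
  ultimately have hi: "(1 + \<eta>) * ?q\<^sup>2 + (1 + ?r) * ?t\<^sup>2 \<le> (1 + \<eta>) ^ Suc m * (1 + ?r) * (?A + ?t\<^sup>2)"
    by linarith
  show ?case
    using lo hi c unfolding Q by (auto simp: abs_le_iff algebra_simps)
qed

text \<open>Equivalently, all eigenvalues of the Gram matrix lie in [4/5, 5/4]. Stated through the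
  quadratic form, so that no matrices are needed.\<close>

definition nearly_orthonormal :: "nat \<Rightarrow> (nat \<Rightarrow> nat \<Rightarrow> real) \<Rightarrow> nat set \<Rightarrow> bool" where
  "nearly_orthonormal k x J \<longleftrightarrow> (\<forall>a.
     4/5 * (\<Sum>j\<in>J. (a j)\<^sup>2) \<le> ip k (lincomb x J a) (lincomb x J a) \<and>
     ip k (lincomb x J a) (lincomb x J a) \<le> 5/4 * (\<Sum>j\<in>J. (a j)\<^sup>2))"

lemma nearly_orthonormal_of_proj_le:
  assumes unit: "\<And>m. m \<in> {1..i} \<Longrightarrow> ip k (x m) (x m) = 1"
    and proj: "\<And>m. m \<in> {1..<i} \<Longrightarrow> proj_le k x {1..m} (x (Suc m)) \<delta>"
    and small: "real i * \<delta>\<^sup>2 \<le> 1/100"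
  shows "nearly_orthonormal k x {1..i}"
proof (cases "i = 0")
  case True
  then show ?thesis by (simp add: nearly_orthonormal_def lincomb_def ip_def)
next
  case False
  \<comment> \<open>This balances the two errors: the powers of 1 \<plusminus> \<eta> up to
    \<open>i\<close> stay bounded, and \<delta>^2 / \<eta> = 10 i \<delta>^2 \<le> 1/10.\<close>
  define \<eta> where "\<eta> = 1 / (10 * real i)"
  have \<eta>: "0 < \<eta>" "\<eta> \<le> 1" using False by (auto simp: \<eta>_def)
  have r: "\<delta>\<^sup>2 / \<eta> \<le> 1/10" using small False by (simp add: \<eta>_def algebra_simps)
  have r0: "0 \<le> \<delta>\<^sup>2 / \<eta>" using \<eta> by simp
  have i\<eta>: "real i * \<eta> = 1/10" using False by (simp add: \<eta>_def)
  have hi: "(1 + \<eta>) ^ i \<le> 28/25"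
  proof -
    have "(1 + \<eta>) ^ i \<le> exp \<eta> ^ i" using \<eta> by (intro power_mono exp_ge_add_one_self) auto
    also have "\<dots> = exp (1/10)" by (metis exp_of_nat_mult i\<eta>)
    also have "\<dots> \<le> 1 + 1/10 + (1/10)\<^sup>2" by (rule exp_bound) auto
    also have "\<dots> \<le> (28/25::real)" by (simp add: power2_eq_square)
    finally show ?thesis .
  qed
  have lo: "9/10 \<le> (1 - \<eta>) ^ i"
    using Bernoulli_inequality[of "-\<eta>" i] \<eta> i\<eta> by simp
  show ?thesis
    unfolding nearly_orthonormal_def
  proof
    fix a :: "nat \<Rightarrow> real"
    let ?A = "\<Sum>j\<in>{1..i}. (a j)\<^sup>2" and ?Q = "ip k (lincomb x {1..i} a) (lincomb x {1..i} a)"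
    have A: "0 \<le> ?A" by (simp add: sum_nonneg)
    have B: "(1 - \<eta>) ^ i * (1 - \<delta>\<^sup>2 / \<eta>) * ?A \<le> ?Q" "?Q \<le> (1 + \<eta>) ^ i * (1 + \<delta>\<^sup>2 / \<eta>) * ?A"
      using gram_bounds_aux[OF unit proj \<eta> _ order_refl, where a=a] r by auto
    have "9/10 * (9/10) \<le> (1 - \<eta>) ^ i * (1 - \<delta>\<^sup>2 / \<eta>)"
      using lo r by (intro mult_mono) auto
    from mult_right_mono[OF this A] have 1: "4/5 * ?A \<le> ?Q" using B A by linarith
    have "(1 + \<eta>) ^ i * (1 + \<delta>\<^sup>2 / \<eta>) \<le> 28/25 * (11/10)"
      using hi r r0 by (intro mult_mono) auto
    from mult_right_mono[OF this A] have "?Q \<le> 5/4 * ?A" using B A by linarith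
    with 1 show "4/5 * ?A \<le> ?Q \<and> ?Q \<le> 5/4 * ?A" ..
  qed
qed

lemma sum_power2_eq: "(\<Sum>j\<in>J. (a j)\<^sup>2) = (L2_set a J)\<^sup>2"
  by (simp add: L2_set_def sum_nonneg)

lemma sum_mult_le_L2: "\<bar>\<Sum>j\<in>J. a j * b j\<bar> \<le> L2_set a J * L2_set b J"
proof -
  have "\<bar>\<Sum>j\<in>J. a j * b j\<bar> \<le> (\<Sum>j\<in>J. \<bar>a j\<bar> * \<bar>b j\<bar>)"
    by (rule order_trans[OF sum_abs]) (simp add: abs_mult)
  then show ?thesis using L2_set_mult_ineq[of a b J] by linarith
qed

text \<open>The squared length of the projection is the inverse Gram form of the vector of inner
  products, hence at most 5/4 of its squared norm. A long projection thus becomes a large sum of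
  squares, which suits a Chernoff bound.\<close>

lemma not_proj_le_imp_large:
  assumes no: "nearly_orthonormal k x J" and "\<not> proj_le k x J v s" "0 \<le> s"
  shows "4/5 * s\<^sup>2 < (\<Sum>j\<in>J. (ip k v (x j))\<^sup>2)"
proof -
  obtain a where a: "s * L2_set (lincomb x J a) {..k} < \<bar>ip k v (lincomb x J a)\<bar>"
    using assms by (auto simp: proj_le_def not_le)
  let ?Y = "L2_set (\<lambda>j. ip k v (x j)) J" and ?q = "L2_set (lincomb x J a) {..k}"
  have "\<bar>ip k v (lincomb x J a)\<bar> \<le> L2_set a J * ?Y"
    unfolding ip_lincomb_right by (rule sum_mult_le_L2)
  with a have lt: "s * ?q < L2_set a J * ?Y" by simp
  have "(s * ?q)\<^sup>2 < (L2_set a J * ?Y)\<^sup>2"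
    using lt assms by (intro power_strict_mono) auto
  moreover have "4/5 * (L2_set a J)\<^sup>2 \<le> ?q\<^sup>2"
    using no unfolding nearly_orthonormal_def ip_self sum_power2_eq by blast
  then have "s\<^sup>2 * (4/5 * (L2_set a J)\<^sup>2) \<le> s\<^sup>2 * ?q\<^sup>2" by (intro mult_left_mono) auto
  ultimately have "(L2_set a J)\<^sup>2 * (4/5 * s\<^sup>2) < (L2_set a J)\<^sup>2 * ?Y\<^sup>2"
    by (simp add: power_mult_distrib algebra_simps)
  \<comment> \<open>The strict inequality rules out a vanishing coefficient vector, so the common
    factor cancels.\<close>
  then have "4/5 * s\<^sup>2 < ?Y\<^sup>2"
    using mult_less_cancel_left_pos less_irrefl mult_zero_left zero_less_power2
    by (metis power_zero_numeral)
  then show ?thesis by (simp add: sum_power2_eq)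
qed

text \<open>The residual of \<open>x m\<close> against the other vectors is orthogonal to all of
  them, and its inner product with \<open>x m\<close> is its own squared norm. The lower Gram bound
  makes this positive, so it can be scaled to 1.\<close>

lemma dual_vectors_exist:
  assumes "finite J" and no: "nearly_orthonormal k x J"
  obtains B where "\<And>m j. m \<in> J \<Longrightarrow> j \<in> J \<Longrightarrow> ip k (lincomb x J (B m)) (x j) = (if m = j then 1 else 0)"
proof -
  have "\<exists>b. \<forall>j\<in>J. ip k (lincomb x J b) (x j) = (if m = j then 1 else 0)" if m: "m \<in> J" for m
  proof -
    obtain a where a: "\<forall>j\<in>J - {m}. ip k (\<lambda>t. x m t - lincomb x (J - {m}) a t) (x j) = 0"
      using exists_orthogonal_residual[of "J - {m}" k "x m" x] assms by auto
    define a' where "a' = (\<lambda>j. - a j)(m := 1)"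
    have e: "(\<lambda>t. x m t - lincomb x (J - {m}) a t) = lincomb x J a'"
      using assms m by (auto simp: fun_eq_iff lincomb_def a'_def sum.remove[of J m] sum_negf[symmetric])
    have a0: "\<forall>j\<in>J - {m}. ip k (lincomb x J a') (x j) = 0" using a by (simp add: e)
    have "ip k (lincomb x J a') (lincomb x J a') = (\<Sum>j\<in>J. a' j * ip k (lincomb x J a') (x j))"
      by (rule ip_lincomb_right)
    also have "\<dots> = ip k (lincomb x J a') (x m)"
      using assms m a0 by (simp add: sum.remove[of J m]) (simp add: a'_def)
    finally have ee: "ip k (lincomb x J a') (x m) = ip k (lincomb x J a') (lincomb x J a')" by simp
    \<comment> \<open>The coefficient of \<open>x m\<close> in its own residual is 1, which keeps
      the coefficient vector away from zero.\<close>
    have "(a' m)\<^sup>2 \<le> (\<Sum>j\<in>J. (a' j)\<^sup>2)" using assms m by (intro member_le_sum) auto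
    then have "1 \<le> (\<Sum>j\<in>J. (a' j)\<^sup>2)" by (simp add: a'_def)
    moreover have "4/5 * (\<Sum>j\<in>J. (a' j)\<^sup>2) \<le> ip k (lincomb x J a') (lincomb x J a')"
      using no unfolding nearly_orthonormal_def by blast
    ultimately have pos: "0 < ip k (lincomb x J a') (x m)" using ee by linarith
    define b where "b = (\<lambda>j. a' j / ip k (lincomb x J a') (x m))"
    have b: "ip k (lincomb x J b) v = ip k (lincomb x J a') v / ip k (lincomb x J a') (x m)" for v
      by (simp add: ip_lincomb_left[of k x J b] ip_lincomb_left[of k x J a' v] sum_divide_distrib, simp add: b_def)
    show ?thesis using a0 pos by (intro exI[of _ b]) (auto simp: b)
  qed
  then obtain B where "\<forall>m\<in>J. \<forall>j\<in>J. ip k (lincomb x J (B m)) (x j) = (if m = j then 1 else 0)"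
    by metis
  then show ?thesis using that by blast
qed

section \<open>The Gaussian measure\<close>

lemma product_sigma_finite_lborel: "product_sigma_finite (\<lambda>_::'i. lborel :: real measure)"
  by standard

lemma sets_PiM_lborel [measurable_cong]: "sets (PiM I (\<lambda>_. lborel :: real measure)) = sets (PiM I (\<lambda>_. borel))"
  by (rule sets_PiM_cong) auto

lemma space_PiM_lborel: "space (PiM I (\<lambda>_. lborel :: real measure)) = space (PiM I (\<lambda>_. borel))"
  by (simp add: space_PiM)

text \<open>The standard Gaussian law on real vectors indexed by \<open>I\<close>. The index set
  stays general: it is \<open>{..k}\<close> for points of space and a set of vertices for the
  auxiliary vector in the quadratic tail bound.\<close>

definition gauss :: "nat set \<Rightarrow> (nat \<Rightarrow> real) measure" where
  "gauss I = density (PiM I (\<lambda>_. lborel)) (\<lambda>x. ennreal (\<Prod>j\<in>I. std_normal_density (x j)))"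

lemma sets_gauss [measurable_cong]: "sets (gauss I) = sets (PiM I (\<lambda>_. borel))"
  by (simp add: gauss_def sets_PiM_lborel)

lemma space_gauss: "space (gauss I) = space (PiM I (\<lambda>_. borel))"
  by (simp add: gauss_def space_PiM_lborel)

lemma nn_integral_normal_density:
  "0 < \<sigma> \<Longrightarrow> (\<integral>\<^sup>+t. ennreal (normal_density \<mu> \<sigma> t) \<partial>lborel) = 1"
  by (subst nn_integral_eq_integral) auto

lemma nn_integral_exp_linear_normal:
  "(\<integral>\<^sup>+t. ennreal (exp (v * t) * std_normal_density t) \<partial>lborel) = ennreal (exp (v\<^sup>2 / 2))"
proof -
  have "exp (v * t) * std_normal_density t = exp (v\<^sup>2 / 2) * normal_density v 1 t" for t
    by (simp add: normal_density_def mult_exp_exp power2_eq_square field_simps)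
  then have "(\<integral>\<^sup>+t. ennreal (exp (v * t) * std_normal_density t) \<partial>lborel)
      = (\<integral>\<^sup>+t. ennreal (exp (v\<^sup>2 / 2)) * ennreal (normal_density v 1 t) \<partial>lborel)"
    by (simp add: ennreal_mult')
  then show ?thesis by (simp add: nn_integral_cmult nn_integral_normal_density)
qed

text \<open>The integrand is a multiple of the centred normal density of variance 1 / (1 - 2 t); the
  multiple is its standard deviation.\<close>

lemma nn_integral_exp_square_normal:
  assumes "t < 1/2"
  shows "(\<integral>\<^sup>+u. ennreal (exp (t * u\<^sup>2) * std_normal_density u) \<partial>lborel) = ennreal (1 / sqrt (1 - 2 * t))"
proof -
  define \<sigma> where "\<sigma> = 1 / sqrt (1 - 2 * t)"
  have \<sigma>: "0 < \<sigma>" "\<sigma>\<^sup>2 = 1 / (1 - 2 * t)" using assms by (auto simp: \<sigma>_def power_divide)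
  have "exp (t * u\<^sup>2) * std_normal_density u = \<sigma> * normal_density 0 \<sigma> u" for u
  proof -
    have "\<sigma> * (1 / sqrt (2 * pi * \<sigma>\<^sup>2)) = 1 / sqrt (2 * pi)"
      using \<sigma>(1) by (simp add: real_sqrt_mult)
    moreover have "- u\<^sup>2 / (2 * \<sigma>\<^sup>2) = t * u\<^sup>2 - u\<^sup>2 / 2"
      using assms by (simp add: \<sigma>(2) field_simps)
    ultimately have "\<sigma> * normal_density 0 \<sigma> u = 1 / sqrt (2 * pi) * exp (t * u\<^sup>2 - u\<^sup>2 / 2)"
      unfolding normal_density_def mult.assoc[symmetric] by simp
    then show ?thesis by (simp add: std_normal_density_def mult_exp_exp)
  qed
  then have "(\<integral>\<^sup>+u. ennreal (exp (t * u\<^sup>2) * std_normal_density u) \<partial>lborel)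
      = (\<integral>\<^sup>+u. ennreal \<sigma> * ennreal (normal_density 0 \<sigma> u) \<partial>lborel)"
    using \<sigma> by (simp add: ennreal_mult')
  then show ?thesis using \<sigma>(1) by (simp add: nn_integral_cmult nn_integral_normal_density) (simp add: \<sigma>_def)
qed

lemma nn_integral_PiM_lborel_prod:
  fixes f :: "'i \<Rightarrow> real \<Rightarrow> real"
  assumes "finite I" and [measurable]: "\<And>j. j \<in> I \<Longrightarrow> f j \<in> borel_measurable borel"
    and nonneg: "\<And>j t. 0 \<le> f j t"
  shows "(\<integral>\<^sup>+x. ennreal (\<Prod>j\<in>I. f j (x j)) \<partial>PiM I (\<lambda>_. lborel)) = (\<Prod>j\<in>I. \<integral>\<^sup>+t. ennreal (f j t) \<partial>lborel)"
  using product_sigma_finite.product_nn_integral_prod[OF product_sigma_finite_lborel assms(1), of "\<lambda>j t. ennreal (f j t)"]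
  by (simp add: prod_ennreal nonneg)

lemma nn_integral_gauss:
  assumes [measurable]: "F \<in> borel_measurable (PiM I (\<lambda>_. borel))"
  shows "(\<integral>\<^sup>+x. F x \<partial>gauss I) = (\<integral>\<^sup>+x. ennreal (\<Prod>j\<in>I. std_normal_density (x j)) * F x \<partial>PiM I (\<lambda>_. lborel))"
  unfolding gauss_def by (rule nn_integral_density) measurable

lemma nn_integral_gauss_prod:
  fixes f :: "nat \<Rightarrow> real \<Rightarrow> real"
  assumes "finite I" and [measurable]: "\<And>j. j \<in> I \<Longrightarrow> f j \<in> borel_measurable borel"
    and nonneg: "\<And>j t. 0 \<le> f j t"
  shows "(\<integral>\<^sup>+x. ennreal (\<Prod>j\<in>I. f j (x j)) \<partial>gauss I)
    = (\<Prod>j\<in>I. \<integral>\<^sup>+t. ennreal (f j t * std_normal_density t) \<partial>lborel)"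
proof -
  have "(\<integral>\<^sup>+x. ennreal (\<Prod>j\<in>I. f j (x j)) \<partial>gauss I)
    = (\<integral>\<^sup>+x. ennreal (\<Prod>j\<in>I. f j (x j) * std_normal_density (x j)) \<partial>PiM I (\<lambda>_. lborel))"
    by (subst nn_integral_gauss, measurable)
      (simp add: ennreal_mult''[symmetric] prod_nonneg prod.distrib mult.commute)
  also have "\<dots> = (\<Prod>j\<in>I. \<integral>\<^sup>+t. ennreal (f j t * std_normal_density t) \<partial>lborel)"
    using assms by (intro nn_integral_PiM_lborel_prod) auto
  finally show ?thesis .
qed

lemma prob_space_gauss: "finite I \<Longrightarrow> prob_space (gauss I)"
proof
  assume "finite I"
  then have "(\<integral>\<^sup>+x. ennreal (\<Prod>j\<in>I. 1) \<partial>gauss I) = 1"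
    by (subst nn_integral_gauss_prod) (auto simp: nn_integral_normal_density)
  then show "emeasure (gauss I) (space (gauss I)) = 1" by simp
qed

lemma nn_integral_gauss_exp_linear:
  assumes "finite I"
  shows "(\<integral>\<^sup>+x. ennreal (exp (\<Sum>j\<in>I. v j * x j)) \<partial>gauss I) = ennreal (exp ((\<Sum>j\<in>I. (v j)\<^sup>2) / 2))"
  using assms
  by (simp add: exp_sum nn_integral_gauss_prod[where f="\<lambda>j t. exp (v j * t)"]
      nn_integral_exp_linear_normal prod_ennreal sum_divide_distrib)

lemma nn_integral_gauss_exp_square:
  assumes "finite I" "t < 1/2"
  shows "(\<integral>\<^sup>+x. ennreal (exp (t * (\<Sum>j\<in>I. (x j)\<^sup>2))) \<partial>gauss I) = ennreal ((1 / sqrt (1 - 2 * t)) ^ card I)"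
  using assms
  by (simp add: exp_sum sum_distrib_left nn_integral_gauss_prod[where f="\<lambda>_ u. exp (t * u\<^sup>2)"]
      nn_integral_exp_square_normal ennreal_power)

text \<open>With \<open>t = 1/5\<close> this supplies the factor \<open>sqrt (5 * pi)\<close> per
  vertex in the orthant bound.\<close>

lemma nn_integral_PiM_lborel_exp_square:
  assumes "finite I" "0 < t"
  shows "(\<integral>\<^sup>+x. ennreal (exp (- t * (\<Sum>j\<in>I. (x j)\<^sup>2))) \<partial>PiM I (\<lambda>_. lborel)) = ennreal (sqrt (pi / t) ^ card I)"
proof -
  define \<sigma> where "\<sigma> = 1 / sqrt (2 * t)"
  have \<sigma>: "0 < \<sigma>" "\<sigma>\<^sup>2 = 1 / (2 * t)" using assms by (auto simp: \<sigma>_def power_divide)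
  have *: "exp (- t * u\<^sup>2) = sqrt (pi / t) * normal_density 0 \<sigma> u" for u
  proof -
    have "2 * pi * \<sigma>\<^sup>2 = pi / t" "- u\<^sup>2 / (2 * \<sigma>\<^sup>2) = - t * u\<^sup>2"
      using assms by (auto simp: \<sigma>(2) field_simps)
    moreover have "0 < pi / t" using assms by simp
    ultimately show ?thesis using assms unfolding normal_density_def by simp
  qed
  have "(\<integral>\<^sup>+u. ennreal (exp (- t * u\<^sup>2)) \<partial>lborel) = (\<integral>\<^sup>+u. ennreal (sqrt (pi / t)) * ennreal (normal_density 0 \<sigma> u) \<partial>lborel)"
    unfolding * using assms by (simp add: ennreal_mult')
  also have "\<dots> = ennreal (sqrt (pi / t))"
    using \<sigma> by (simp add: nn_integral_cmult nn_integral_normal_density)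
  finally have 1: "(\<integral>\<^sup>+u. ennreal (exp (- t * u\<^sup>2)) \<partial>lborel) = ennreal (sqrt (pi / t))" .
  have "(\<integral>\<^sup>+x. ennreal (exp (- t * (\<Sum>j\<in>I. (x j)\<^sup>2))) \<partial>PiM I (\<lambda>_. lborel))
    = (\<integral>\<^sup>+x. ennreal (\<Prod>j\<in>I. exp (- t * (x j)\<^sup>2)) \<partial>PiM I (\<lambda>_. lborel))"
    using assms by (simp add: exp_sum sum_distrib_left sum_negf[symmetric])
  also have "\<dots> = (\<Prod>j\<in>I. ennreal (sqrt (pi / t)))"
    using assms by (subst nn_integral_PiM_lborel_prod) (auto simp: 1[simplified])
  finally show ?thesis using assms by (simp add: ennreal_power)
qed

section \<open>Translations and dilations of Lebesgue and Gaussian measure\<close>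

lemma distr_PiM_lborel_translate:
  fixes v :: "'i \<Rightarrow> real"
  assumes "finite I"
  shows "distr (PiM I (\<lambda>_. lborel)) (PiM I (\<lambda>_. lborel)) (\<lambda>x. \<lambda>j\<in>I. x j + v j) = PiM I (\<lambda>_. lborel)"
proof (rule product_sigma_finite.PiM_eqI[OF product_sigma_finite_lborel assms])
  fix A :: "'i \<Rightarrow> real set" assume A: "\<And>i. i \<in> I \<Longrightarrow> A i \<in> sets lborel"
  have m: "(\<lambda>t. t + v i) -` A i \<in> sets borel" if "i \<in> I" for i
    using measurable_sets[of "\<lambda>t. t + v i" borel borel "A i"] A[OF that] by simp
  have "emeasure (distr (PiM I (\<lambda>_. lborel)) (PiM I (\<lambda>_. lborel)) (\<lambda>x. \<lambda>j\<in>I. x j + v j)) (Pi\<^sub>E I A)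
      = emeasure (PiM I (\<lambda>_. lborel)) (Pi\<^sub>E I (\<lambda>i. (\<lambda>t. t + v i) -` A i))"
    using A assms by (subst emeasure_distr)
      (auto intro!: arg_cong[where f="emeasure _"] sets_PiM_I_finite simp: space_PiM PiE_iff)
  also have "\<dots> = (\<Prod>i\<in>I. emeasure lborel ((\<lambda>t. t + v i) -` A i))"
    using m by (intro product_sigma_finite.emeasure_PiM[OF product_sigma_finite_lborel assms]) auto
  also have "\<dots> = (\<Prod>i\<in>I. emeasure lborel (A i))"
  proof (rule prod.cong[OF refl])
    fix i assume i: "i \<in> I"
    have "emeasure (distr lborel borel ((+) (v i))) (A i) = emeasure lborel ((+) (v i) -` A i)"
      using A[OF i] by (subst emeasure_distr) auto
    then show "emeasure lborel ((\<lambda>t. t + v i) -` A i) = emeasure lborel (A i)"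
      by (simp add: lborel_distr_plus vimage_def add.commute)
  qed
  finally show "emeasure (distr (PiM I (\<lambda>_. lborel)) (PiM I (\<lambda>_. lborel)) (\<lambda>x. \<lambda>j\<in>I. x j + v j)) (Pi\<^sub>E I A)
      = (\<Prod>i\<in>I. emeasure lborel (A i))" .
qed simp

lemma distr_PiM_lborel_scale:
  assumes "finite I" and c: "(c::real) > 0"
  shows "density (distr (PiM I (\<lambda>_. lborel)) (PiM I (\<lambda>_. lborel)) (\<lambda>x. \<lambda>j\<in>I. c * x j)) (\<lambda>_. ennreal (c ^ card I)) = PiM I (\<lambda>_. lborel)"
    (is "density ?D _ = _")
proof (rule product_sigma_finite.PiM_eqI[OF product_sigma_finite_lborel assms(1)])
  fix A :: "'a \<Rightarrow> real set" assume A: "\<And>i. i \<in> I \<Longrightarrow> A i \<in> sets lborel"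
  have m: "(\<lambda>t. c * t) -` A i \<in> sets borel" if "i \<in> I" for i
    using measurable_sets[of "\<lambda>t. c * t" borel borel "A i"] A[OF that] by simp
  have "emeasure (density ?D (\<lambda>_. ennreal (c ^ card I))) (Pi\<^sub>E I A) = ennreal (c ^ card I) * emeasure ?D (Pi\<^sub>E I A)"
    using A assms by (intro emeasure_density_const) (auto intro!: sets_PiM_I_finite)
  also have "emeasure ?D (Pi\<^sub>E I A)
      = emeasure (PiM I (\<lambda>_. lborel)) (Pi\<^sub>E I (\<lambda>i. (\<lambda>t. c * t) -` A i))"
    using A assms by (subst emeasure_distr)
      (auto intro!: arg_cong[where f="emeasure _"] sets_PiM_I_finite simp: space_PiM PiE_iff)
  also have "\<dots> = (\<Prod>i\<in>I. emeasure lborel ((\<lambda>t. c * t) -` A i))"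
    using m by (intro product_sigma_finite.emeasure_PiM[OF product_sigma_finite_lborel assms(1)]) auto
  also have "ennreal (c ^ card I) * \<dots> = (\<Prod>i\<in>I. ennreal c * emeasure lborel ((\<lambda>t. c * t) -` A i))"
    using c by (simp add: prod.distrib ennreal_power)
  also have "\<dots> = (\<Prod>i\<in>I. emeasure lborel (A i))"
  proof (rule prod.cong[OF refl])
    fix i assume i: "i \<in> I"
    have "emeasure lborel (A i) = emeasure (density (distr lborel borel ((*) c)) (\<lambda>_. \<bar>c\<bar>)) (A i)"
      using c by (subst lborel_distr_mult'[of c]) auto
    also have "\<dots> = ennreal c * emeasure lborel ((\<lambda>t. c * t) -` A i)"
      using A[OF i] c by (subst emeasure_density_const) (auto simp: emeasure_distr)
    finally show "ennreal c * emeasure lborel ((\<lambda>t. c * t) -` A i) = emeasure lborel (A i)" ..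
  qed
  finally show "emeasure (density ?D (\<lambda>_. ennreal (c ^ card I))) (Pi\<^sub>E I A) = (\<Prod>i\<in>I. emeasure lborel (A i))" .
qed simp

lemma nn_integral_PiM_lborel_translate:
  fixes v :: "'i \<Rightarrow> real"
  assumes "finite I" and [measurable]: "F \<in> borel_measurable (PiM I (\<lambda>_. borel))"
  shows "(\<integral>\<^sup>+x. F (\<lambda>j\<in>I. x j + v j) \<partial>PiM I (\<lambda>_. lborel)) = (\<integral>\<^sup>+x. F x \<partial>PiM I (\<lambda>_. lborel))"
  by (subst (2) distr_PiM_lborel_translate[OF assms(1), of v, symmetric])
    (subst nn_integral_distr, measurable)

lemma nn_integral_PiM_lborel_scale:
  assumes "finite I" and [measurable]: "F \<in> borel_measurable (PiM I (\<lambda>_. borel))" and "(c::real) > 0"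
  shows "ennreal (c ^ card I) * (\<integral>\<^sup>+x. F (\<lambda>j\<in>I. c * x j) \<partial>PiM I (\<lambda>_. lborel)) = (\<integral>\<^sup>+x. F x \<partial>PiM I (\<lambda>_. lborel))"
  apply (subst (2) distr_PiM_lborel_scale[OF assms(1,3), symmetric])
  apply (subst nn_integral_density)
    apply measurable
  apply (subst nn_integral_cmult)
   apply measurable
  apply (subst nn_integral_distr)
    apply measurable
  done

text \<open>The finite-dimensional Cameron--Martin formula: translation invariance of Lebesgue
  measure, together with the explicit ratio of the shifted density to the original one.\<close>

lemma nn_integral_gauss_translate:
  assumes "finite I" and [measurable]: "F \<in> borel_measurable (PiM I (\<lambda>_. borel))"
  shows "(\<integral>\<^sup>+x. F (\<lambda>j\<in>I. x j + v j) \<partial>gauss I)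
    = (\<integral>\<^sup>+x. F x * ennreal (exp ((\<Sum>j\<in>I. v j * x j) - (\<Sum>j\<in>I. (v j)\<^sup>2) / 2)) \<partial>gauss I)"
proof -
  define G where "G = (\<lambda>y. ennreal (\<Prod>j\<in>I. std_normal_density (y j - v j)) * F y)"
  have [measurable]: "G \<in> borel_measurable (PiM I (\<lambda>_. borel))"
    unfolding G_def by measurable
  have shift: "std_normal_density (t - s) = std_normal_density t * exp (s * t - s\<^sup>2 / 2)" for s t :: real
    by (simp add: normal_density_def mult_exp_exp power2_eq_square field_simps)
  have prod: "(\<Prod>j\<in>I. std_normal_density (y j - v j))
      = (\<Prod>j\<in>I. std_normal_density (y j)) * exp ((\<Sum>j\<in>I. v j * y j) - (\<Sum>j\<in>I. (v j)\<^sup>2) / 2)" for y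
    using assms by (simp add: shift prod.distrib exp_sum[symmetric] sum_subtractf sum_divide_distrib)
  have "(\<integral>\<^sup>+x. F (\<lambda>j\<in>I. x j + v j) \<partial>gauss I) = (\<integral>\<^sup>+x. G (\<lambda>j\<in>I. x j + v j) \<partial>PiM I (\<lambda>_. lborel))"
    by (subst nn_integral_gauss) (auto simp: G_def intro!: nn_integral_cong prod.cong)
  also have "\<dots> = (\<integral>\<^sup>+x. G x \<partial>PiM I (\<lambda>_. lborel))"
    using assms by (intro nn_integral_PiM_lborel_translate) auto
  also have "\<dots> = (\<integral>\<^sup>+x. F x * ennreal (exp ((\<Sum>j\<in>I. v j * x j) - (\<Sum>j\<in>I. (v j)\<^sup>2) / 2)) \<partial>gauss I)"
    by (subst nn_integral_gauss)
      (auto simp: G_def prod ennreal_mult' prod_nonneg ac_simps)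
  finally show ?thesis .
qed

section \<open>Uniform points on the sphere\<close>

lemma borel_measurable_L2_set [measurable]:
  "(\<lambda>x. L2_set x I) \<in> borel_measurable (PiM I (\<lambda>_. borel))"
  unfolding L2_set_def by measurable

lemma borel_measurable_ip_left [measurable]:
  "(\<lambda>x. ip k x v) \<in> borel_measurable (PiM {..k} (\<lambda>_. borel))"
  unfolding ip_def by measurable

lemma sets_unit_ball [measurable]: "unit_ball k \<in> sets (PiM {..k} (\<lambda>_. borel))"
proof -
  have "unit_ball k = {x \<in> space (PiM {..k} (\<lambda>_. borel)). L2_set x {..k} \<le> 1}"
    by (auto simp: unit_ball_def space_PiM)
  then show ?thesis by simp
qed

lemma L2_set_scale: "L2_set (\<lambda>j\<in>I. c * x j) I = \<bar>c\<bar> * L2_set x I"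
proof -
  have "L2_set (\<lambda>j\<in>I. c * x j) I = L2_set (\<lambda>j. \<bar>c\<bar> * x j) I"
    by (simp add: L2_set_def power_mult_distrib)
  then show ?thesis by (simp add: L2_set_right_distrib)
qed

lemma prod_std_normal_density:
  "(\<Prod>j\<in>I. std_normal_density (x j)) = (1 / sqrt (2 * pi)) ^ card I * exp (- (L2_set x I)\<^sup>2 / 2)"
proof (cases "finite I")
  case True
  have "(\<Sum>j\<in>I. - (x j)\<^sup>2 / 2) = - (L2_set x I)\<^sup>2 / 2"
    unfolding sum_power2_eq[symmetric] by (simp add: sum_negf sum_divide_distrib)
  then show ?thesis
    unfolding std_normal_density_def prod.distrib prod_constant exp_sum[OF True, symmetric] by simp
qed (simp add: L2_set_def)

text \<open>Layer-cake: the Gaussian density is a mixture over \<open>t\<close> of the uniform densities on the balls of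
  radius \<open>t\<close>, all of which give cones the same relative mass.\<close>

lemma emeasure_gauss_cone:
  assumes C [measurable]: "C \<in> sets (PiM {..k} (\<lambda>_. borel))"
    and cone: "\<And>c x. c > 0 \<Longrightarrow> x \<in> space (PiM {..k} (\<lambda>_. borel)) \<Longrightarrow> (\<lambda>j\<in>{..k}. c * x j) \<in> C \<longleftrightarrow> x \<in> C"
  shows "emeasure (gauss {..k}) C
    = (\<integral>\<^sup>+t. ennreal ((1 / sqrt (2 * pi)) ^ Suc k * (t * exp (- t\<^sup>2 / 2))) * ennreal (t ^ Suc k) * indicator {0<..} t \<partial>lborel)
      * emeasure (PiM {..k} (\<lambda>_. lborel)) (unit_ball k \<inter> C)"
proof -
  let ?L = "PiM {..k} (\<lambda>_. lborel :: real measure)"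
  define K where "K = (1 / sqrt (2 * pi)) ^ Suc k"
  define w where "w = (\<lambda>t::real. K * (t * exp (- t\<^sup>2 / 2)))"
  have K0: "0 \<le> K" by (simp add: K_def)
  have [measurable]: "w \<in> borel_measurable borel" unfolding w_def by measurable
  \<comment> \<open>\<open>w\<close> is the derivative of - K exp (- t^2 / 2), so integrating it
    over all radii t \<ge> |x| returns the Gaussian density at x.\<close>
  have layer: "(\<integral>\<^sup>+t. ennreal (w t) * indicator {a..} t \<partial>lborel) = ennreal (K * exp (- a\<^sup>2 / 2))"
    if "0 \<le> a" for a
  proof -
    have "((\<lambda>t. - K * exp (- t\<^sup>2 / 2)) has_real_derivative w t) (at t)" for t
      unfolding w_def by (auto intro!: derivative_eq_intros simp: power2_eq_square field_simps)
    moreover have "((\<lambda>t::real. exp (- t\<^sup>2 / 2)) \<longlongrightarrow> 0) at_top"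
      by real_asymp
    then have "((\<lambda>t::real. - K * exp (- t\<^sup>2 / 2)) \<longlongrightarrow> - K * 0) at_top"
      by (intro tendsto_mult tendsto_const)
    ultimately have "(\<integral>\<^sup>+t. ennreal (w t) * indicator {a..} t \<partial>lborel) = ennreal (0 - (- K * exp (- a\<^sup>2 / 2)))"
      using that K0 by (intro nn_integral_FTC_atLeast) (auto simp: w_def)
    then show ?thesis by simp
  qed
  define H where "H = (\<lambda>x t. ennreal (w t) * indicator {..t} (L2_set x {..k}) * (indicator C x :: ennreal))"
  interpret product_sigma_finite "\<lambda>_::nat. lborel :: real measure" by (rule product_sigma_finite_lborel)
  have sf: "pair_sigma_finite ?L (lborel :: real measure)"
    by (intro pair_sigma_finite.intro sigma_finite sigma_finite_lborel) auto
  have [measurable]: "(\<lambda>(x, t). H x t) \<in> borel_measurable (?L \<Otimes>\<^sub>M lborel)"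
  proof -
    have [measurable]: "C \<in> sets ?L" using C by (simp add: sets_PiM_lborel)
    have "H = (\<lambda>x t. if L2_set x {..k} \<le> t \<and> x \<in> C then ennreal (w t) else 0)"
      by (auto simp: H_def indicator_def fun_eq_iff)
    then show ?thesis by simp
  qed
  have "emeasure (gauss {..k}) C = (\<integral>\<^sup>+x. indicator C x \<partial>gauss {..k})"
    using C by (subst nn_integral_indicator) (auto simp: sets_gauss)
  also have "\<dots> = (\<integral>\<^sup>+x. ennreal (K * exp (- (L2_set x {..k})\<^sup>2 / 2)) * indicator C x \<partial>?L)"
    by (subst nn_integral_gauss) (auto simp: prod_std_normal_density K_def)
  also have "\<dots> = (\<integral>\<^sup>+x. (\<integral>\<^sup>+t. H x t \<partial>lborel) \<partial>?L)"
  proof (rule nn_integral_cong)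
    fix x
    have "(\<integral>\<^sup>+t. H x t \<partial>lborel) = (\<integral>\<^sup>+t. ennreal (w t) * indicator {L2_set x {..k}..} t * indicator C x \<partial>lborel)"
      by (intro nn_integral_cong) (auto simp: H_def indicator_def)
    also have "\<dots> = (\<integral>\<^sup>+t. ennreal (w t) * indicator {L2_set x {..k}..} t \<partial>lborel) * indicator C x"
      by (rule nn_integral_multc) measurable
    finally show "ennreal (K * exp (- (L2_set x {..k})\<^sup>2 / 2)) * indicator C x = (\<integral>\<^sup>+t. H x t \<partial>lborel)"
      by (simp add: layer)
  qed
  also have "\<dots> = (\<integral>\<^sup>+t. (\<integral>\<^sup>+x. H x t \<partial>?L) \<partial>lborel)"
    by (rule pair_sigma_finite.Fubini'[OF sf, symmetric]) measurable
  also have "\<dots> = (\<integral>\<^sup>+t. ennreal (w t) * ennreal (t ^ Suc k) * indicator {0<..} t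
      * emeasure ?L (unit_ball k \<inter> C) \<partial>lborel)"
  proof (rule nn_integral_cong)
    fix t :: real
    show "(\<integral>\<^sup>+x. H x t \<partial>?L) = ennreal (w t) * ennreal (t ^ Suc k) * indicator {0<..} t * emeasure ?L (unit_ball k \<inter> C)"
    proof (cases "0 < t")
      case True
      define G where "G = (\<lambda>x. indicator {..t} (L2_set x {..k}) * (indicator C x :: ennreal))"
      have [measurable]: "G \<in> borel_measurable (PiM {..k} (\<lambda>_. borel))"
        unfolding G_def by measurable
      have "G (\<lambda>j\<in>{..k}. t * x j) = indicator (unit_ball k \<inter> C) x" if x: "x \<in> space ?L" for x
        using cone[OF True, of x] x True
        by (auto simp: G_def indicator_def L2_set_scale unit_ball_def space_PiM)
      then have "(\<integral>\<^sup>+x. G (\<lambda>j\<in>{..k}. t * x j) \<partial>?L) = (\<integral>\<^sup>+x. indicator (unit_ball k \<inter> C) x \<partial>?L)"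
        by (intro nn_integral_cong) auto
      also have "\<dots> = emeasure ?L (unit_ball k \<inter> C)"
        by (rule nn_integral_indicator) (simp add: sets_PiM_lborel)
      finally have "(\<integral>\<^sup>+x. G x \<partial>?L) = ennreal (t ^ Suc k) * emeasure ?L (unit_ball k \<inter> C)"
        using nn_integral_PiM_lborel_scale[of "{..k}" G t] True by simp
      moreover have "(\<integral>\<^sup>+x. H x t \<partial>?L) = ennreal (w t) * (\<integral>\<^sup>+x. G x \<partial>?L)"
        by (subst nn_integral_cmult[symmetric], measurable) (simp add: H_def G_def mult.assoc)
      ultimately show ?thesis using True by (simp add: mult.assoc)
    next
      case False
      have "H x t = 0" for x
      \<comment> \<open>The weight vanishes at radius 0, and no norm is bounded by a negative
        number.\<close>
      proof (cases "t = 0")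
        case True then show ?thesis by (simp add: H_def w_def)
      next
        case False
        with \<open>\<not> 0 < t\<close> have "\<not> L2_set x {..k} \<le> t" using L2_set_nonneg[of x "{..k}"] by linarith
        then show ?thesis by (simp add: H_def)
      qed
      then show ?thesis using False by simp
    qed
  qed
  also have "\<dots> = (\<integral>\<^sup>+t. ennreal (w t) * ennreal (t ^ Suc k) * indicator {0<..} t \<partial>lborel)
      * emeasure ?L (unit_ball k \<inter> C)"
    by (rule nn_integral_multc) measurable
  finally show ?thesis by (simp add: w_def K_def)
qed

definition normalize_vec :: "nat \<Rightarrow> (nat \<Rightarrow> real) \<Rightarrow> nat \<Rightarrow> real" where
  "normalize_vec k x = (\<lambda>j\<in>{..k}. x j / L2_set x {..k})"

lemma measurable_normalize_vec [measurable]: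
  "normalize_vec k \<in> measurable (PiM {..k} (\<lambda>_. borel)) (PiM {..k} (\<lambda>_. borel))"
  unfolding normalize_vec_def by measurable

text \<open>The preimage of any event under normalisation is a cone, and on cones the Gaussian law
  is proportional to volume inside the unit ball. This trades the cone measure for independent
  coordinates.\<close>

lemma sphere_unif_eq_distr_gauss:
  "sphere_unif k = distr (gauss {..k}) (PiM {..k} (\<lambda>_. borel)) (normalize_vec k)"
proof (rule measure_eqI)
  let ?P = "PiM {..k} (\<lambda>_. borel :: real measure)" and ?L = "PiM {..k} (\<lambda>_. lborel :: real measure)"
  show "sets (sphere_unif k) = sets (distr (gauss {..k}) ?P (normalize_vec k))"
    by (simp add: sphere_unif_def)
  fix A assume "A \<in> sets (sphere_unif k)"
  then have A[measurable]: "A \<in> sets ?P" by (simp add: sphere_unif_def)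
  define C where "C = normalize_vec k -` A \<inter> space ?P"
  have C[measurable]: "C \<in> sets ?P" unfolding C_def by measurable
  have scale: "normalize_vec k (\<lambda>j\<in>{..k}. c * x j) = normalize_vec k x" if "0 < c" for c x
    using that by (auto simp: normalize_vec_def L2_set_scale)
  \<comment> \<open>The constant is never evaluated. Taking the whole space as the cone gives 1 = Z
    vol(ball), which identifies Z and also shows that the ball has positive finite volume.\<close>
  obtain Z where Z: "\<And>C. C \<in> sets ?P \<Longrightarrow>
      (\<And>c x. c > 0 \<Longrightarrow> x \<in> space ?P \<Longrightarrow> (\<lambda>j\<in>{..k}. c * x j) \<in> C \<longleftrightarrow> x \<in> C)
      \<Longrightarrow> emeasure (gauss {..k}) C = Z * emeasure ?L (unit_ball k \<inter> C)"
    using emeasure_gauss_cone[of _ k] by blast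
  interpret prob_space "gauss {..k}" by (rule prob_space_gauss) simp
  have "unit_ball k \<inter> space ?P = unit_ball k" by (auto simp: unit_ball_def space_PiM)
  then have ball: "1 = Z * emeasure ?L (unit_ball k)"
    using emeasure_space_1 Z[of "space ?P"] by (auto simp: space_gauss) (simp add: space_PiM)
  have "emeasure (sphere_unif k) A = emeasure (uniform_measure ?L (unit_ball k)) C"
    unfolding sphere_unif_def normalize_vec_def[symmetric]
    by (subst emeasure_distr) (auto simp: C_def space_PiM_lborel)
  also have "\<dots> = emeasure ?L (unit_ball k \<inter> C) / emeasure ?L (unit_ball k)"
    by (rule emeasure_uniform_measure) (auto simp: sets_PiM_lborel)
  also have "\<dots> = Z * emeasure ?L (unit_ball k \<inter> C)"
  proof -
    have nz: "emeasure ?L (unit_ball k) \<noteq> 0" using ball by auto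
    have nt: "emeasure ?L (unit_ball k) \<noteq> top"
      using ball by (cases "Z = 0") (auto simp: ennreal_mult_top)
    have "Z = Z * emeasure ?L (unit_ball k) / emeasure ?L (unit_ball k)"
      using mult_divide_eq_ennreal[OF nz nt, of Z] by simp
    also have "\<dots> = 1 / emeasure ?L (unit_ball k)"
      using ball by simp
    finally show ?thesis by (simp add: divide_ennreal_def mult.commute)
  qed
  also have "\<dots> = emeasure (gauss {..k}) C"
    by (rule Z[symmetric]) (auto simp: C_def scale space_PiM)
  also have "\<dots> = emeasure (distr (gauss {..k}) ?P (normalize_vec k)) A"
    by (subst emeasure_distr) (auto simp: C_def space_gauss)
  finally show "emeasure (sphere_unif k) A = emeasure (distr (gauss {..k}) ?P (normalize_vec k)) A" .
qed

lemma sets_sphere_unif: "sets (sphere_unif k) = sets (PiM {..k} (\<lambda>_. borel))"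
  by (simp add: sphere_unif_def)

lemma space_sphere_unif: "space (sphere_unif k) = space (PiM {..k} (\<lambda>_. borel))"
  by (simp add: sphere_unif_def)

lemma prob_space_sphere_unif: "prob_space (sphere_unif k)"
  unfolding sphere_unif_eq_distr_gauss
  by (intro prob_space.prob_space_distr prob_space_gauss) measurable

lemma measure_sphere_unif:
  assumes "{x \<in> space (PiM {..k} (\<lambda>_. borel)). P x} \<in> sets (PiM {..k} (\<lambda>_. borel))"
  shows "measure (sphere_unif k) {x \<in> space (sphere_unif k). P x}
    = measure (gauss {..k}) {g \<in> space (gauss {..k}). P (normalize_vec k g)}"
  unfolding space_sphere_unif using assms
  apply (subst sphere_unif_eq_distr_gauss, subst measure_distr[OF _ assms])
   apply (subst measurable_cong_sets[OF sets_gauss refl], rule measurable_normalize_vec)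
  apply (rule arg_cong[where f="measure _"])
  apply (auto simp: space_gauss measurable_space[OF measurable_normalize_vec])
  done

lemma AE_gauss_L2_pos: "AE g in gauss {..k}. 0 < L2_set g {..k}"
proof -
  \<comment> \<open>The indicator of \<open>g 0 = 0\<close> is written as a product over all
    coordinates, so that the product formula applies; its factor at 0 integrates to zero.\<close>
  define f where "f = (\<lambda>j t::real. if j = (0::nat) \<and> t \<noteq> 0 then 0 else 1 :: real)"
  have *: "(\<Prod>j\<in>{..k}. f j (g j)) = (if g 0 = 0 then 1 else 0)" for g
    by (subst prod.remove[of _ 0]) (auto simp: f_def)
  have z: "(\<integral>\<^sup>+t. ennreal (f 0 t * std_normal_density t) \<partial>lborel) = 0"
  proof (subst nn_integral_0_iff_AE)
    have "AE t::real in lborel. t \<noteq> 0" by (rule AE_lborel_singleton)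
    then show "AE t in lborel. ennreal (f 0 t * std_normal_density t) = 0"
      by eventually_elim (simp add: f_def)
  qed (simp add: f_def)
  have "(\<integral>\<^sup>+g. ennreal (if g 0 = 0 then 1 else 0) \<partial>gauss {..k}) = 0"
    unfolding *[symmetric]
    by (subst nn_integral_gauss_prod) (auto simp: f_def[symmetric] z prod.remove[of _ 0], auto simp: f_def)
  then have "AE g in gauss {..k}. ennreal (if g 0 = 0 then 1 else 0) = 0"
    by (subst (asm) nn_integral_0_iff_AE) auto
  then show ?thesis
  proof eventually_elim
    case (elim g)
    then have "g 0 \<noteq> 0" by (auto split: if_splits)
    then have "L2_set g {..k} \<noteq> 0" by (subst L2_set_eq_0_iff) auto
    then show ?case using L2_set_nonneg[of g "{..k}"] by linarith
  qed
qed

lemma ip_normalize_vec: "ip k (normalize_vec k g) v = ip k g v / L2_set g {..k}"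
proof -
  have "ip k (normalize_vec k g) v = ip k (\<lambda>j. 1 / L2_set g {..k} * g j) v"
    by (rule ip_cong_left) (simp add: normalize_vec_def)
  then show ?thesis unfolding ip_scale_left by simp
qed

text \<open>The measure lives on the whole space, and the origin is normalised to itself because
  division by zero gives zero; unit length therefore holds only almost surely.\<close>

lemma AE_sphere_unif_unit: "AE x in sphere_unif k. ip k x x = 1"
  unfolding sphere_unif_eq_distr_gauss
proof (subst AE_distr_iff)
  show "AE g in gauss {..k}. ip k (normalize_vec k g) (normalize_vec k g) = 1"
    using AE_gauss_L2_pos
  proof eventually_elim
    case (elim g)
    have "ip k (normalize_vec k g) (normalize_vec k g) = ip k g g / L2_set g {..k} / L2_set g {..k}"
      by (simp only: ip_normalize_vec ip_commute[of k g "normalize_vec k g"])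
    then show ?case using elim by (simp add: ip_self[of k g] power2_eq_square)
  qed
qed (auto simp: ip_def)

section \<open>Concentration of Gaussian vectors\<close>

lemma exp_markov:
  assumes "prob_space M" and [measurable]: "f \<in> borel_measurable M"
    and "(\<integral>\<^sup>+x. ennreal (exp (f x)) \<partial>M) \<le> ennreal B" "0 \<le> B"
  shows "measure M {x \<in> space M. c \<le> f x} \<le> exp (- c) * B"
proof -
  interpret prob_space M by fact
  have "emeasure M {x \<in> space M. 1 \<le> ennreal (exp (- c)) * ennreal (exp (f x))}
      \<le> ennreal (exp (- c)) * (\<integral>\<^sup>+x. ennreal (exp (f x)) * indicator (space M) x \<partial>M)"
    by (rule nn_integral_Markov_inequality) auto
  also have "(\<integral>\<^sup>+x. ennreal (exp (f x)) * indicator (space M) x \<partial>M) = (\<integral>\<^sup>+x. ennreal (exp (f x)) \<partial>M)"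
    by (intro nn_integral_cong) auto
  also have "ennreal (exp (- c)) * \<dots> \<le> ennreal (exp (- c)) * ennreal B"
    using assms by (intro mult_left_mono) auto
  also have "\<dots> = ennreal (exp (- c) * B)" using assms by (simp add: ennreal_mult')
  also have "{x \<in> space M. 1 \<le> ennreal (exp (- c)) * ennreal (exp (f x))} = {x \<in> space M. c \<le> f x}"
    by (simp add: ennreal_mult'[symmetric] mult_exp_exp)
  finally show ?thesis using assms by (simp add: emeasure_eq_measure)
qed

text \<open>Chernoff with exponent -1: the expectation of exp (- |g|^2) is 3^(- (k + 1) / 2), and 3
  \<ge> exp (27/25) leaves the rate 1/2 - 27/50 = - 1/25 per dimension.\<close>

lemma gauss_lower_tail:
  "measure (gauss {..k}) {g \<in> space (gauss {..k}). (L2_set g {..k})\<^sup>2 \<le> real k / 2} \<le> exp (- real k / 25)"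
proof -
  have e: "exp (27/25) \<le> (3::real)"
  proof -
    have "exp (2/25::real) \<le> 1 + 2/25 + (2/25)\<^sup>2" by (rule exp_bound) auto
    moreover have "exp (27/25::real) = exp 1 * exp (2/25)" by (simp add: mult_exp_exp)
    moreover have "exp 1 * exp (2/25::real) \<le> 272/100 * (1 + 2/25 + (2/25)\<^sup>2)"
      using e_less_272 calculation(1) by (intro mult_mono) auto
    ultimately show ?thesis by (simp add: power2_eq_square)
  qed
  have "measure (gauss {..k}) {g \<in> space (gauss {..k}). - (real k / 2) \<le> - 1 * (\<Sum>j\<in>{..k}. (g j)\<^sup>2)}
      \<le> exp (- (- (real k / 2))) * (1 / sqrt 3) ^ Suc k"
    using nn_integral_gauss_exp_square[of "{..k}" "-1"]
    by (intro exp_markov prob_space_gauss) auto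
  also have "\<dots> \<le> exp (real k / 2) * exp (- 27/50) ^ Suc k"
  proof (intro mult_mono power_mono)
    have "exp (27/50) \<le> sqrt (3::real)" using e by (intro real_le_rsqrt) (simp add: exp_double[symmetric])
    then show "1 / sqrt 3 \<le> exp (- 27/50::real)" by (simp add: exp_minus field_simps)
  qed auto
  also have "\<dots> \<le> exp (- real k / 25)"
    by (simp add: exp_of_nat_mult[symmetric] mult_exp_exp field_simps del: power_Suc)
  finally show ?thesis by (simp add: sum_power2_eq)
qed

text \<open>Chernoff with exponent 1/4: the expectation is 2^((k + 1) / 2), and sqrt 2 \<le> exp
  (3/8) gives the rate 3/8 - 9/16 = - 3/16, weakened to - 1/6. The threshold says |g| \<ge> 3/2 sqrt
  k.\<close>

lemma gauss_upper_tail: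
  "measure (gauss {..k}) {g \<in> space (gauss {..k}). 9/4 * real k \<le> (L2_set g {..k})\<^sup>2} \<le> exp (1 - real k / 6)"
proof -
  have "measure (gauss {..k}) {g \<in> space (gauss {..k}). 9/16 * real k \<le> 1/4 * (\<Sum>j\<in>{..k}. (g j)\<^sup>2)}
      \<le> exp (- (9/16 * real k)) * (1 / sqrt (1/2)) ^ Suc k"
    using nn_integral_gauss_exp_square[of "{..k}" "1/4"]
    by (intro exp_markov prob_space_gauss) auto
  also have "\<dots> \<le> exp (- (9/16 * real k)) * exp (3/8) ^ Suc k"
  proof (intro mult_mono power_mono)
    have "1 + 3/4 + (3/4)\<^sup>2/2 \<le> exp (3/4::real)" by (rule exp_lower_Taylor_quadratic) auto
    then have "2 \<le> exp (3/8::real) ^ 2" by (simp add: power2_eq_square mult_exp_exp)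
    then have "sqrt 2 \<le> exp (3/8::real)" by (intro real_le_lsqrt) auto
    then show "1 / sqrt (1/2) \<le> exp (3/8::real)" by (simp add: real_sqrt_divide)
  qed auto
  also have "\<dots> \<le> exp (1 - real k / 6)"
    by (simp add: exp_of_nat_mult[symmetric] mult_exp_exp field_simps del: power_Suc)
  finally show ?thesis by (simp add: sum_power2_eq)
qed

lemma nn_integral_gauss_exp_ip:
  "(\<integral>\<^sup>+g. ennreal (exp (c * ip k g v)) \<partial>gauss {..k}) = ennreal (exp (c\<^sup>2 * ip k v v / 2))"
  using nn_integral_gauss_exp_linear[of "{..k}" "\<lambda>j. c * v j"]
  by (simp add: ip_def sum_distrib_left mult_ac power2_eq_square)

lemma gauss_linear_tail:
  assumes "ip k e e = 1" "0 < u"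
  shows "measure (gauss {..k}) {g \<in> space (gauss {..k}). ip k g e \<le> - u} \<le> exp (- u\<^sup>2 / 2)"
proof -
  have "measure (gauss {..k}) {g \<in> space (gauss {..k}). u\<^sup>2 \<le> - u * ip k g e} \<le> exp (- u\<^sup>2) * exp (u\<^sup>2 / 2)"
    using nn_integral_gauss_exp_ip[where c="-u" and k=k and v=e] assms
    by (intro exp_markov prob_space_gauss) auto
  also have "{g \<in> space (gauss {..k}). u\<^sup>2 \<le> - u * ip k g e} = {g \<in> space (gauss {..k}). ip k g e \<le> - u}"
  proof -
    have "u\<^sup>2 \<le> - u * t \<longleftrightarrow> t \<le> - u" for t
      using assms by (auto simp: power2_eq_square) (metis minus_mult_right mult_le_cancel_left_pos neg_le_iff_le not_le minus_minus)+
    then show ?thesis by simp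
  qed
  finally show ?thesis by (simp add: mult_exp_exp)
qed

text \<open>The square of a linear form is linearised by a second Gaussian vector \<open>h\<close>; after exchanging
  the integrals, only the quadratic form of the Gram matrix in \<open>h\<close> is left.\<close>

lemma gauss_quadratic_tail:
  assumes no: "nearly_orthonormal k x J" and J: "finite J"
  shows "measure (gauss {..k}) {g \<in> space (gauss {..k}). T \<le> (\<Sum>j\<in>J. (ip k g (x j))\<^sup>2)}
    \<le> exp (- T / 5) * sqrt 2 ^ card J"
proof -
  interpret K: prob_space "gauss {..k}" by (rule prob_space_gauss) simp
  interpret J: prob_space "gauss J" by (rule prob_space_gauss) fact
  interpret pair_sigma_finite "gauss {..k}" "gauss J" ..
  \<comment> \<open>Chosen so that c^2 / 2 = 1/5. The Gram bound 5/4 then leaves the exponent 1/4,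
    below the critical 1/2, at a cost of sqrt 2 per vertex.\<close>
  define c where "c = sqrt (2/5 :: real)"
  have c: "c\<^sup>2 = 2/5" by (simp add: c_def)
  have [measurable]: "(\<lambda>(g, h). ennreal (exp (c * (\<Sum>j\<in>J. h j * ip k g (x j))))) \<in> borel_measurable (gauss {..k} \<Otimes>\<^sub>M gauss J)"
    using J by measurable
  have "(\<integral>\<^sup>+g. ennreal (exp (1/5 * (\<Sum>j\<in>J. (ip k g (x j))\<^sup>2))) \<partial>gauss {..k})
      = (\<integral>\<^sup>+g. (\<integral>\<^sup>+h. ennreal (exp (c * (\<Sum>j\<in>J. h j * ip k g (x j)))) \<partial>gauss J) \<partial>gauss {..k})"
  proof (rule nn_integral_cong)
    fix g
    have "(\<Sum>j\<in>J. (c * ip k g (x j))\<^sup>2) / 2 = 1/5 * (\<Sum>j\<in>J. (ip k g (x j))\<^sup>2)"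
      by (simp add: power_mult_distrib c sum_distrib_left[symmetric] sum_divide_distrib)
    then show "ennreal (exp (1/5 * (\<Sum>j\<in>J. (ip k g (x j))\<^sup>2)))
        = (\<integral>\<^sup>+h. ennreal (exp (c * (\<Sum>j\<in>J. h j * ip k g (x j)))) \<partial>gauss J)"
      using nn_integral_gauss_exp_linear[OF J, of "\<lambda>j. c * ip k g (x j)"]
      by (simp add: sum_distrib_left mult_ac)
  qed
  also have "\<dots> = (\<integral>\<^sup>+h. (\<integral>\<^sup>+g. ennreal (exp (c * (\<Sum>j\<in>J. h j * ip k g (x j)))) \<partial>gauss {..k}) \<partial>gauss J)"
    by (rule Fubini'[symmetric]) measurable
  also have "\<dots> \<le> (\<integral>\<^sup>+h. ennreal (exp (1/4 * (\<Sum>j\<in>J. (h j)\<^sup>2))) \<partial>gauss J)"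
  proof (rule nn_integral_mono)
    fix h
    have "(\<integral>\<^sup>+g. ennreal (exp (c * (\<Sum>j\<in>J. h j * ip k g (x j)))) \<partial>gauss {..k})
        = ennreal (exp (1/5 * ip k (lincomb x J h) (lincomb x J h)))"
      using nn_integral_gauss_exp_ip[where c=c and k=k and v="lincomb x J h"]
      by (simp add: c) (simp add: ip_lincomb_right)
    also have "\<dots> \<le> ennreal (exp (1/4 * (\<Sum>j\<in>J. (h j)\<^sup>2)))"
    proof -
      have "ip k (lincomb x J h) (lincomb x J h) \<le> 5/4 * (\<Sum>j\<in>J. (h j)\<^sup>2)"
        using no unfolding nearly_orthonormal_def by blast
      then show ?thesis by (intro ennreal_leI) simp
    qed
    finally show "(\<integral>\<^sup>+g. ennreal (exp (c * (\<Sum>j\<in>J. h j * ip k g (x j)))) \<partial>gauss {..k})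
        \<le> ennreal (exp (1/4 * (\<Sum>j\<in>J. (h j)\<^sup>2)))" .
  qed
  also have "\<dots> = ennreal ((1 / sqrt (1/2)) ^ card J)"
    using nn_integral_gauss_exp_square[OF J, of "1/4"] by simp
  finally have "(\<integral>\<^sup>+g. ennreal (exp (1/5 * (\<Sum>j\<in>J. (ip k g (x j))\<^sup>2))) \<partial>gauss {..k}) \<le> ennreal (sqrt 2 ^ card J)"
    by (simp add: real_sqrt_divide)
  then have "measure (gauss {..k}) {g \<in> space (gauss {..k}). T / 5 \<le> 1/5 * (\<Sum>j\<in>J. (ip k g (x j))\<^sup>2)}
      \<le> exp (- (T / 5)) * sqrt 2 ^ card J"
    by (intro exp_markov K.prob_space_axioms) auto
  then show ?thesis by simp
qed

text \<open>Averaging the indicator of the box \<open>{g. \<forall>j. ip k g (x j) \<in> {s..s+1}}\<close> over all its translates by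
  combinations of the dual vectors gives \<open>1\<close>, and the Cameron--Martin density of such a translate is
  bounded on the box.\<close>

lemma gauss_orthant_lower:
  assumes no: "nearly_orthonormal k x J" and J: "finite J" and s: "0 \<le> s"
  shows "exp (- (5/4 * real (card J) * (s + 1)\<^sup>2)) * (1 / sqrt (5 * pi)) ^ card J
    \<le> measure (gauss {..k}) {g \<in> space (gauss {..k}). \<forall>j\<in>J. s \<le> ip k g (x j)}"
proof -
  let ?L = "PiM J (\<lambda>_. lborel :: real measure)" and ?P = "PiM {..k} (\<lambda>_. borel :: real measure)"
  interpret K: prob_space "gauss {..k}" by (rule prob_space_gauss) simp
  interpret product_sigma_finite "\<lambda>_::nat. lborel :: real measure" by (rule product_sigma_finite_lborel)
  have sf: "pair_sigma_finite (gauss {..k}) ?L"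
    using J by (intro pair_sigma_finite.intro sigma_finite K.sigma_finite_measure_axioms) auto
  obtain B where B: "\<And>m j. m \<in> J \<Longrightarrow> j \<in> J \<Longrightarrow> ip k (lincomb x J (B m)) (x j) = (if m = j then 1 else 0)"
    using dual_vectors_exist[OF J no] by blast
  \<comment> \<open>\<open>d a\<close> is the combination of the \<open>x j\<close> whose inner
    product with each \<open>x j\<close> is \<open>a j\<close>. Its expansion in dual vectors shows
    that it is linear in \<open>a\<close>; its expansion with coefficients \<open>b a\<close> gives
    access to the Gram bounds.\<close>
  define b where "b = (\<lambda>a j. \<Sum>m\<in>J. a m * B m j)"
  define d where "d = (\<lambda>a. lincomb x J (b a))"
  have d_eq: "d a = lincomb (\<lambda>m. lincomb x J (B m)) J a" for a
    by (rule ext) (simp add: d_def b_def lincomb_def sum_distrib_left sum_distrib_right mult.assoc, rule sum.swap)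
  have dx: "ip k (d a) (x j) = a j" if "j \<in> J" for a j
  proof -
    have "ip k (d a) (x j) = (\<Sum>m\<in>J. a m * (if m = j then 1 else 0))"
      unfolding d_eq ip_lincomb_left[of k "\<lambda>m. lincomb x J (B m)"] using B that by (intro sum.cong) auto
    also have "\<dots> = a j" using J that by (simp add: sum.delta' if_distrib cong: if_cong)
    finally show ?thesis .
  qed
  define B0 where "B0 = {g \<in> space ?P. \<forall>j\<in>J. ip k g (x j) \<in> {s..s+1}}"
  have [measurable]: "B0 \<in> sets ?P" unfolding B0_def using J by measurable
  define M where "M = 5/4 * real (card J) * (s + 1)\<^sup>2"
  \<comment> \<open>The inverse of the Gram matrix has eigenvalues at least 4/5: |a|^2 is the inner
    product of \<open>d a\<close> with the combination of the \<open>x j\<close> with coefficients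
    \<open>a\<close>, to which Cauchy--Schwarz and the upper Gram bound apply.\<close>
  have norm_d: "4/5 * (\<Sum>j\<in>J. (a j)\<^sup>2) \<le> ip k (d a) (d a)" for a
  proof -
    have "(L2_set a J)\<^sup>2 = ip k (d a) (lincomb x J a)"
      unfolding ip_lincomb_right sum_power2_eq[symmetric] by (intro sum.cong) (auto simp: dx power2_eq_square)
    also have "\<dots> \<le> L2_set (d a) {..k} * L2_set (lincomb x J a) {..k}"
      using ip_cauchy_schwarz[of k "d a" "lincomb x J a"] by linarith
    finally have "((L2_set a J)\<^sup>2)\<^sup>2 \<le> (L2_set (d a) {..k} * L2_set (lincomb x J a) {..k})\<^sup>2"
      by (intro power_mono) auto
    also have "\<dots> = ip k (d a) (d a) * ip k (lincomb x J a) (lincomb x J a)"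
      by (simp add: power_mult_distrib ip_self)
    also have "\<dots> \<le> ip k (d a) (d a) * (5/4 * (L2_set a J)\<^sup>2)"
      using no by (intro mult_left_mono ip_self_nonneg) (auto simp: nearly_orthonormal_def sum_power2_eq)
    finally have le: "(L2_set a J)\<^sup>2 * (L2_set a J)\<^sup>2 \<le> (L2_set a J)\<^sup>2 * (5/4 * ip k (d a) (d a))"
      by (simp add: power2_eq_square mult_ac)
    have "(L2_set a J)\<^sup>2 \<le> 5/4 * ip k (d a) (d a)"
    proof (cases "L2_set a J = 0")
      case False
      then show ?thesis using mult_left_le_imp_le[OF le] by simp
    qed (use ip_self_nonneg[of k "d a"] in auto)
    then show ?thesis by (simp add: sum_power2_eq)
  qed
  \<comment> \<open>Half of |d|^2 / 2 absorbs the term 1/5 |b|^2 of the split cross term. The other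
    half is at least 1/5 |a|^2, so the bound is integrable over all translates.\<close>
  have expo: "ip k g (d a) - ip k (d a) (d a) / 2 \<le> M - 1/5 * (\<Sum>j\<in>J. (a j)\<^sup>2)" if "g \<in> B0" for g a
  proof -
    let ?b = "L2_set (b a) J" and ?y = "L2_set (\<lambda>j. ip k g (x j)) J"
    have "?y\<^sup>2 = (\<Sum>j\<in>J. (ip k g (x j))\<^sup>2)" by (simp add: sum_power2_eq)
    also have "\<dots> \<le> (\<Sum>j\<in>J. (s + 1)\<^sup>2)"
      using that s by (intro sum_mono power_mono) (auto simp: B0_def intro: order_trans)
    finally have y: "5/4 * ?y\<^sup>2 \<le> M" by (simp add: M_def)
    have bb: "4/5 * ?b\<^sup>2 \<le> ip k (d a) (d a)"
      using no unfolding nearly_orthonormal_def d_def sum_power2_eq by blast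
    have "ip k g (d a) \<le> ?b * ?y"
      using sum_mult_le_L2[of "b a" "\<lambda>j. ip k g (x j)" J] by (simp add: d_def ip_lincomb_right)
    also have "\<dots> \<le> 1/5 * ?b\<^sup>2 + 5/4 * ?y\<^sup>2"
    proof -
      have "0 \<le> 1/5 * (?b - 5/2 * ?y)\<^sup>2" by simp
      then show ?thesis by (simp add: power2_eq_square algebra_simps)
    qed
    finally show ?thesis using y bb norm_d[of a] by linarith
  qed
  define T where "T = (\<lambda>a g. \<lambda>j\<in>{..k}. g j + d a j)"
  have d_meas [measurable]: "(\<lambda>a. d a j) \<in> borel_measurable (PiM J (\<lambda>_. borel))" for j
    unfolding d_eq lincomb_def by measurable
  have [measurable]: "(\<lambda>(g, a). T a g) \<in> measurable (?P \<Otimes>\<^sub>M PiM J (\<lambda>_. borel)) ?P"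
    unfolding T_def by measurable
  have [measurable]: "(\<lambda>(g, a). indicator B0 (T a g) :: ennreal) \<in> borel_measurable (gauss {..k} \<Otimes>\<^sub>M ?L)"
    by measurable
  have one: "(\<integral>\<^sup>+a. indicator B0 (T a g) \<partial>?L) = 1" if g: "g \<in> space (gauss {..k})" for g
  proof -
    define f where "f = (\<lambda>j t. indicator {s - ip k g (x j)..s + 1 - ip k g (x j)} t :: real)"
    have "indicator B0 (T a g) = ennreal (\<Prod>j\<in>J. f j (a j))" for a
    proof -
      have "ip k (T a g) (x j) = ip k g (x j) + a j" if "j \<in> J" for j
        by (simp add: T_def ip_restrict_left ip_add_left dx[OF that])
      moreover have "T a g \<in> space ?P" by (simp add: T_def space_PiM)
      ultimately have "T a g \<in> B0 \<longleftrightarrow> (\<forall>j\<in>J. f j (a j) = 1)"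
        by (auto simp: B0_def f_def indicator_def algebra_simps split: if_splits)
      moreover have "(\<Prod>j\<in>J. f j (a j)) = (if \<forall>j\<in>J. f j (a j) = 1 then 1 else 0)"
        using J by (auto simp: f_def indicator_def prod_zero_iff split: if_splits)
      ultimately show ?thesis by (simp add: indicator_def)
    qed
    then have "(\<integral>\<^sup>+a. indicator B0 (T a g) \<partial>?L) = (\<integral>\<^sup>+a. ennreal (\<Prod>j\<in>J. f j (a j)) \<partial>?L)"
      by simp
    also have "\<dots> = (\<Prod>j\<in>J. \<integral>\<^sup>+t. ennreal (f j t) \<partial>lborel)"
      by (rule nn_integral_PiM_lborel_prod[OF J]) (auto simp: f_def)
    also have "\<dots> = 1" by (simp add: f_def ennreal_indicator)
    finally show ?thesis .
  qed
  have "1 = (\<integral>\<^sup>+g. (\<integral>\<^sup>+a. indicator B0 (T a g) \<partial>?L) \<partial>gauss {..k})"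
    using K.emeasure_space_1 by (simp add: one cong: nn_integral_cong)
  also have "\<dots> = (\<integral>\<^sup>+a. (\<integral>\<^sup>+g. indicator B0 (T a g) \<partial>gauss {..k}) \<partial>?L)"
    by (rule pair_sigma_finite.Fubini'[OF sf, symmetric]) measurable
  also have "\<dots> \<le> (\<integral>\<^sup>+a. ennreal (exp M * exp (- (1/5) * (\<Sum>j\<in>J. (a j)\<^sup>2))) * emeasure (gauss {..k}) B0 \<partial>?L)"
  proof (rule nn_integral_mono)
    fix a
    have "(\<integral>\<^sup>+g. indicator B0 (T a g) \<partial>gauss {..k})
      = (\<integral>\<^sup>+g. indicator B0 g * ennreal (exp ((\<Sum>j\<le>k. d a j * g j) - (\<Sum>j\<le>k. (d a j)\<^sup>2) / 2)) \<partial>gauss {..k})"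
      unfolding T_def by (rule nn_integral_gauss_translate) auto
    also have "\<dots> \<le> (\<integral>\<^sup>+g. ennreal (exp M * exp (- (1/5) * (\<Sum>j\<in>J. (a j)\<^sup>2))) * indicator B0 g \<partial>gauss {..k})"
    proof (rule nn_integral_mono)
      fix g
      show "indicator B0 g * ennreal (exp ((\<Sum>j\<le>k. d a j * g j) - (\<Sum>j\<le>k. (d a j)\<^sup>2) / 2))
        \<le> ennreal (exp M * exp (- (1/5) * (\<Sum>j\<in>J. (a j)\<^sup>2))) * indicator B0 g"
        using expo[of g a]
        by (cases "g \<in> B0") (auto simp: mult_exp_exp ip_def power2_eq_square mult.commute intro!: ennreal_leI)
    qed
    also have "\<dots> = ennreal (exp M * exp (- (1/5) * (\<Sum>j\<in>J. (a j)\<^sup>2))) * emeasure (gauss {..k}) B0"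
      by (rule nn_integral_cmult_indicator) (simp add: sets_gauss)
    finally show "(\<integral>\<^sup>+g. indicator B0 (T a g) \<partial>gauss {..k})
      \<le> ennreal (exp M * exp (- (1/5) * (\<Sum>j\<in>J. (a j)\<^sup>2))) * emeasure (gauss {..k}) B0" .
  qed
  also have "\<dots> = ennreal (exp M) * (\<integral>\<^sup>+a. ennreal (exp (- (1/5) * (\<Sum>j\<in>J. (a j)\<^sup>2))) \<partial>?L) * emeasure (gauss {..k}) B0"
    by (subst nn_integral_multc, measurable) (subst nn_integral_cmult[symmetric], measurable, simp add: ennreal_mult')
  also have "\<dots> = ennreal (exp M * sqrt (5 * pi) ^ card J * measure (gauss {..k}) B0)"
    using nn_integral_PiM_lborel_exp_square[OF J, of "1/5"]
    by (simp add: K.emeasure_eq_measure ennreal_mult' mult.commute)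
  finally have "1 \<le> exp M * sqrt (5 * pi) ^ card J * measure (gauss {..k}) B0"
    by simp
  then have "exp (- M) * (1 / sqrt (5 * pi)) ^ card J \<le> measure (gauss {..k}) B0"
    by (simp add: exp_minus power_one_over field_simps)
  also have "\<dots> \<le> measure (gauss {..k}) {g \<in> space (gauss {..k}). \<forall>j\<in>J. s \<le> ip k g (x j)}"
    using J by (intro K.finite_measure_mono) (auto simp: B0_def space_gauss)
  finally show ?thesis by (simp add: M_def)
qed

section \<open>Spherical caps\<close>

definition shear1 :: "nat \<Rightarrow> nat \<Rightarrow> (nat \<Rightarrow> real) \<Rightarrow> (nat \<Rightarrow> real) \<Rightarrow> nat \<Rightarrow> real" where
  "shear1 k a u x = (\<lambda>j\<in>{..k}. if j = a then x a + (\<Sum>i\<in>{..k} - {a}. u i * x i) else x j)"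

definition shear2 :: "nat \<Rightarrow> nat \<Rightarrow> (nat \<Rightarrow> real) \<Rightarrow> (nat \<Rightarrow> real) \<Rightarrow> nat \<Rightarrow> real" where
  "shear2 k a v x = (\<lambda>j\<in>{..k}. if j = a then x a else x j + v j * x a)"

lemma measurable_shear1 [measurable]:
  assumes "a \<le> k"
  shows "shear1 k a u \<in> measurable (PiM {..k} (\<lambda>_. borel)) (PiM {..k} (\<lambda>_. borel))"
  unfolding shear1_def using assms by (intro measurable_restrict) auto

lemma measurable_shear2 [measurable]:
  assumes "a \<le> k"
  shows "shear2 k a v \<in> measurable (PiM {..k} (\<lambda>_. borel)) (PiM {..k} (\<lambda>_. borel))"
  unfolding shear2_def using assms by (intro measurable_restrict) auto

text \<open>Coordinate \<open>a\<close> is integrated innermost: once the others are fixed, the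
  shear translates it by a constant.\<close>

lemma nn_integral_shear1:
  assumes a: "a \<le> k" and F [measurable]: "F \<in> borel_measurable (PiM {..k} (\<lambda>_. borel))"
  shows "(\<integral>\<^sup>+x. F (shear1 k a u x) \<partial>PiM {..k} (\<lambda>_. lborel)) = (\<integral>\<^sup>+x. F x \<partial>PiM {..k} (\<lambda>_. lborel))"
proof -
  interpret product_sigma_finite "\<lambda>_::nat. lborel :: real measure" by (rule product_sigma_finite_lborel)
  let ?I = "{..k} - {a}"
  have ins: "{..k} = insert a ?I" using a by auto
  note [measurable] = measurable_shear1[OF a]
  have FL: "F \<in> borel_measurable (PiM (insert a ?I) (\<lambda>_. lborel))"
    unfolding ins[symmetric] by measurable
  have FSL: "(\<lambda>x. F (shear1 k a u x)) \<in> borel_measurable (PiM (insert a ?I) (\<lambda>_. lborel))"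
    unfolding ins[symmetric] by measurable
  have "(\<integral>\<^sup>+x. F (shear1 k a u x) \<partial>PiM {..k} (\<lambda>_. lborel))
      = (\<integral>\<^sup>+x. (\<integral>\<^sup>+y. F (shear1 k a u (x(a := y))) \<partial>lborel) \<partial>PiM ?I (\<lambda>_. lborel))"
    using product_nn_integral_insert[OF _ _ FSL] unfolding ins[symmetric] by simp
  also have "\<dots> = (\<integral>\<^sup>+x. (\<integral>\<^sup>+y. F (x(a := y)) \<partial>lborel) \<partial>PiM ?I (\<lambda>_. lborel))"
  proof (rule nn_integral_cong)
    fix x assume x: "x \<in> space (PiM ?I (\<lambda>_. lborel :: real measure))"
    have m: "(\<lambda>y. F (x(a := y))) \<in> borel_measurable borel"
      using measurable_comp[OF measurable_component_update FL, OF x] by (simp add: comp_def fun_upd_def)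
    have "shear1 k a u (x(a := y)) = x(a := (\<Sum>i\<in>?I. u i * x i) + 1 * y)" for y
      using x a by (auto simp: shear1_def fun_eq_iff space_PiM PiE_iff extensional_def)
    then show "(\<integral>\<^sup>+y. F (shear1 k a u (x(a := y))) \<partial>lborel) = (\<integral>\<^sup>+y. F (x(a := y)) \<partial>lborel)"
      using nn_integral_real_affine[OF m, of 1 "\<Sum>i\<in>?I. u i * x i"] by simp
  qed
  also have "\<dots> = (\<integral>\<^sup>+x. F x \<partial>PiM {..k} (\<lambda>_. lborel))"
    using product_nn_integral_insert[OF _ _ FL] unfolding ins[symmetric] by simp
  finally show ?thesis .
qed

text \<open>Coordinate \<open>a\<close> is integrated outermost: once it is fixed, the shear
  translates the other coordinates by a constant vector.\<close>

lemma nn_integral_shear2: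
  assumes a: "a \<le> k" and F [measurable]: "F \<in> borel_measurable (PiM {..k} (\<lambda>_. borel))"
  shows "(\<integral>\<^sup>+x. F (shear2 k a v x) \<partial>PiM {..k} (\<lambda>_. lborel)) = (\<integral>\<^sup>+x. F x \<partial>PiM {..k} (\<lambda>_. lborel))"
proof -
  interpret product_sigma_finite "\<lambda>_::nat. lborel :: real measure" by (rule product_sigma_finite_lborel)
  let ?I = "{..k} - {a}"
  have ins: "{..k} = insert a ?I" using a by auto
  note [measurable] = measurable_shear2[OF a]
  have FL: "F \<in> borel_measurable (PiM (insert a ?I) (\<lambda>_. lborel))"
    unfolding ins[symmetric] by measurable
  have FSL: "(\<lambda>x. F (shear2 k a v x)) \<in> borel_measurable (PiM (insert a ?I) (\<lambda>_. lborel))"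
    unfolding ins[symmetric] by measurable
  have "(\<integral>\<^sup>+x. F (shear2 k a v x) \<partial>PiM {..k} (\<lambda>_. lborel))
      = (\<integral>\<^sup>+y. (\<integral>\<^sup>+x. F (shear2 k a v (x(a := y))) \<partial>PiM ?I (\<lambda>_. lborel)) \<partial>lborel)"
    using product_nn_integral_insert_rev[OF _ _ FSL] unfolding ins[symmetric] by simp
  also have "\<dots> = (\<integral>\<^sup>+y. (\<integral>\<^sup>+x. F (x(a := y)) \<partial>PiM ?I (\<lambda>_. lborel)) \<partial>lborel)"
  proof (rule nn_integral_cong)
    fix y :: real
    have "(\<lambda>x. x(a := y)) \<in> measurable (PiM ?I (\<lambda>_. borel)) (PiM {..k} (\<lambda>_. borel))"
      using measurable_fun_upd[of "{..k}" ?I a "\<lambda>x. x" "PiM ?I (\<lambda>_. borel)" "\<lambda>_. borel" "\<lambda>_. y"] ins by auto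
    then have [measurable]: "(\<lambda>x. F (x(a := y))) \<in> borel_measurable (PiM ?I (\<lambda>_. borel))"
      by measurable
    have "shear2 k a v (x(a := y)) = (\<lambda>j\<in>?I. x j + v j * y)(a := y)" for x
      using a by (auto simp: shear2_def fun_eq_iff)
    then show "(\<integral>\<^sup>+x. F (shear2 k a v (x(a := y))) \<partial>PiM ?I (\<lambda>_. lborel)) = (\<integral>\<^sup>+x. F (x(a := y)) \<partial>PiM ?I (\<lambda>_. lborel))"
      using nn_integral_PiM_lborel_translate[of ?I "\<lambda>x. F (x(a := y))" "\<lambda>j. v j * y"] by simp
  qed
  also have "\<dots> = (\<integral>\<^sup>+x. F x \<partial>PiM {..k} (\<lambda>_. lborel))"
    using product_nn_integral_insert_rev[OF _ _ FL] unfolding ins[symmetric] by simp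
  finally show ?thesis .
qed

text \<open>A rotation in the plane of \<open>e\<close> and the \<open>a\<close>-th coordinate axis is a product of three shears.
  Shears preserve Lebesgue measure by Fubini, so no determinant is needed.\<close>

definition rot :: "nat \<Rightarrow> nat \<Rightarrow> (nat \<Rightarrow> real) \<Rightarrow> (nat \<Rightarrow> real) \<Rightarrow> nat \<Rightarrow> real" where
  "rot k a e x = shear1 k a (\<lambda>j. e j / (1 + e a)) (shear2 k a (\<lambda>j. - e j) (shear1 k a (\<lambda>j. e j / (1 + e a)) x))"

text \<open>For the rotation angle with cosine c = \<open>e a\<close>, the outer shears have the
  tangent of the half angle as slope, hence the divisor 1 + c and the exclusion of c = -1. The norm
  computation rests on the other coordinates of \<open>e\<close> having squared norm 1 -
  c^2.\<close>

lemma rot_coord_and_norm: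
  assumes a: "a \<le> k" and e: "ip k e e = 1" and ea: "e a \<noteq> - 1"
  shows "rot k a e x a = ip k x e" "L2_set (rot k a e x) {..k} = L2_set x {..k}"
proof -
  let ?I = "{..k} - {a}"
  define c z w s where "c = e a" and "z = (\<Sum>j\<in>?I. e j * x j)" and "w = z / (1 + c)" and "s = x a + w"
  have c: "1 + c \<noteq> 0" using ea by (simp add: c_def add_eq_0_iff)
  have zw: "z = (1 + c) * w" using c by (simp add: w_def)
  have split: "(\<Sum>j\<le>k. f j) = f a + (\<Sum>j\<in>?I. f j)" for f :: "nat \<Rightarrow> real"
    using a by (subst sum.remove[of _ a]) auto
  have ee: "(\<Sum>j\<in>?I. e j * e j) = (1 - c) * (1 + c)"
    using e unfolding ip_def split by (simp add: c_def algebra_simps)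
  have 1: "shear1 k a (\<lambda>j. e j / (1 + e a)) x j = (if j = a then s else x j)" if "j \<le> k" for j
    using that by (simp add: shear1_def s_def w_def z_def sum_divide_distrib c_def)
  have 2: "shear2 k a (\<lambda>j. - e j) (shear1 k a (\<lambda>j. e j / (1 + e a)) x) j = (if j = a then s else x j - e j * s)"
    if "j \<le> k" for j
    using that a by (simp add: shear2_def 1)
  have "(\<Sum>i\<in>?I. e i / (1 + e a) * (x i - e i * s)) = (\<Sum>i\<in>?I. e i * x i / (1 + c) - s / (1 + c) * (e i * e i))"
    by (rule sum.cong) (auto simp: c_def algebra_simps diff_divide_distrib)
  also have "\<dots> = w - s / (1 + c) * ((1 - c) * (1 + c))"
    by (simp only: sum_subtractf w_def z_def sum_divide_distrib sum_distrib_left[symmetric] ee)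
  also have "\<dots> = w - s * (1 - c)" using c by simp
  finally have 3: "(\<Sum>i\<in>?I. e i / (1 + e a) * (x i - e i * s)) = w - s * (1 - c)" .
  have rot: "rot k a e x j = (if j = a then c * x a + z else x j - e j * s)" if "j \<le> k" for j
  proof -
    have "(\<Sum>i\<in>?I. e i / (1 + e a) * shear2 k a (\<lambda>j. - e j) (shear1 k a (\<lambda>j. e j / (1 + e a)) x) i)
        = (\<Sum>i\<in>?I. e i / (1 + e a) * (x i - e i * s))"
      by (rule sum.cong) (auto simp: 2)
    then have sum: "(\<Sum>i\<in>?I. e i / (1 + e a) * shear2 k a (\<lambda>j. - e j) (shear1 k a (\<lambda>j. e j / (1 + e a)) x) i)
        = w - s * (1 - c)" unfolding 3 .
    have "s + (w - s * (1 - c)) = c * x a + z" unfolding zw s_def by (simp add: algebra_simps)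
    then show ?thesis
      unfolding rot_def shear1_def[of k a _ "shear2 _ _ _ _"] sum
      using that a by (simp add: 2)
  qed
  show "rot k a e x a = ip k x e"
    using a unfolding ip_def split by (simp add: rot c_def z_def mult.commute)
  have "(L2_set (rot k a e x) {..k})\<^sup>2 = (c * x a + z)\<^sup>2 + (\<Sum>j\<in>?I. (x j - e j * s)\<^sup>2)"
    unfolding sum_power2_eq[symmetric] split using a by (auto simp: rot intro!: sum.cong)
  also have "(\<Sum>j\<in>?I. (x j - e j * s)\<^sup>2) = (\<Sum>j\<in>?I. (x j)\<^sup>2 - 2 * s * (e j * x j) + s\<^sup>2 * (e j * e j))"
    by (rule sum.cong) (auto simp: power2_eq_square algebra_simps)
  also have "\<dots> = (\<Sum>j\<in>?I. (x j)\<^sup>2) - 2 * s * z + s\<^sup>2 * ((1 - c) * (1 + c))"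
    by (simp add: sum.distrib sum_subtractf sum_distrib_left[symmetric] z_def ee)
  also have "(c * x a + z)\<^sup>2 + \<dots> = (x a)\<^sup>2 + (\<Sum>j\<in>?I. (x j)\<^sup>2)"
    unfolding zw s_def by (simp add: power2_eq_square algebra_simps)
  also have "\<dots> = (L2_set x {..k})\<^sup>2" unfolding sum_power2_eq[symmetric] split ..
  finally show "L2_set (rot k a e x) {..k} = L2_set x {..k}" by simp
qed

lemma measurable_rot [measurable]:
  assumes "a \<le> k"
  shows "rot k a e \<in> measurable (PiM {..k} (\<lambda>_. borel)) (PiM {..k} (\<lambda>_. borel))"
  using measurable_shear1[OF assms] measurable_shear2[OF assms] unfolding rot_def by measurable

lemma nn_integral_gauss_rot:
  assumes a: "a \<le> k" and e: "ip k e e = 1" and ea: "e a \<noteq> - 1"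
    and F [measurable]: "F \<in> borel_measurable (PiM {..k} (\<lambda>_. borel))"
  shows "(\<integral>\<^sup>+x. F (rot k a e x) \<partial>gauss {..k}) = (\<integral>\<^sup>+x. F x \<partial>gauss {..k})"
proof -
  note [measurable] = measurable_rot[OF a] measurable_shear1[OF a] measurable_shear2[OF a]
  define G where "G = (\<lambda>y. ennreal (\<Prod>j\<in>{..k}. std_normal_density (y j)) * F y)"
  have [measurable]: "G \<in> borel_measurable (PiM {..k} (\<lambda>_. borel))"
    unfolding G_def by measurable
  have "(\<integral>\<^sup>+x. F (rot k a e x) \<partial>gauss {..k}) = (\<integral>\<^sup>+x. G (rot k a e x) \<partial>PiM {..k} (\<lambda>_. lborel))"
    by (subst nn_integral_gauss)
      (auto simp: G_def prod_std_normal_density rot_coord_and_norm(2)[OF a e ea])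
  also have "\<dots> = (\<integral>\<^sup>+x. G x \<partial>PiM {..k} (\<lambda>_. lborel))"
  proof -
    let ?u = "\<lambda>j. e j / (1 + e a)" and ?v = "\<lambda>j. - e j"
    have "(\<integral>\<^sup>+x. G (rot k a e x) \<partial>PiM {..k} (\<lambda>_. lborel))
        = (\<integral>\<^sup>+x. G (shear1 k a ?u (shear2 k a ?v x)) \<partial>PiM {..k} (\<lambda>_. lborel))"
      unfolding rot_def by (rule nn_integral_shear1[OF a, of "\<lambda>x. G (shear1 k a ?u (shear2 k a ?v x))"]) measurable
    also have "\<dots> = (\<integral>\<^sup>+x. G (shear1 k a ?u x) \<partial>PiM {..k} (\<lambda>_. lborel))"
      by (rule nn_integral_shear2[OF a, of "\<lambda>x. G (shear1 k a ?u x)"]) measurable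
    also have "\<dots> = (\<integral>\<^sup>+x. G x \<partial>PiM {..k} (\<lambda>_. lborel))"
      by (rule nn_integral_shear1[OF a]) measurable
    finally show ?thesis .
  qed
  also have "\<dots> = (\<integral>\<^sup>+x. F x \<partial>gauss {..k})"
    by (subst nn_integral_gauss) (auto simp: G_def)
  finally show ?thesis .
qed

text \<open>The mass of a spherical cap read off a Gaussian vector, whose length cancels in the
  quotient.\<close>

definition cap_meas :: "nat \<Rightarrow> (nat \<Rightarrow> real) \<Rightarrow> real \<Rightarrow> real" where
  "cap_meas k e t = measure (gauss {..k}) {g \<in> space (gauss {..k}). ip k g e / L2_set g {..k} \<le> t}"

lemma measure_sphere_unif_cap:
  "measure (sphere_unif k) {x \<in> space (sphere_unif k). ip k x e \<le> t} = cap_meas k e t"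
  by (subst measure_sphere_unif) (auto simp: cap_meas_def ip_normalize_vec)

definition axis :: "nat \<Rightarrow> nat \<Rightarrow> nat \<Rightarrow> real" where
  "axis k a = (\<lambda>j\<in>{..k}. if j = a then 1 else 0)"

lemma ip_axis: "a \<le> k \<Longrightarrow> ip k x (axis k a) = x a"
  unfolding ip_def by (subst sum.remove[of _ a]) (auto simp: axis_def)

lemma axis_unit: "a \<le> k \<Longrightarrow> axis k a \<in> unit_sphere k"
proof -
  assume a: "a \<le> k"
  have "(L2_set (axis k a) {..k})\<^sup>2 = 1"
    using ip_axis[OF a, of "axis k a"] a by (simp add: ip_self[symmetric]) (simp add: axis_def)
  then have "L2_set (axis k a) {..k} = 1" by (simp add: power2_eq_1_iff) (smt (verit) L2_set_nonneg)
  then show ?thesis by (simp add: unit_sphere_def) (simp add: axis_def)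
qed

lemma cap_meas_rot:
  assumes a: "a \<le> k" and e: "ip k e e = 1" and ea: "e a \<noteq> - 1"
  shows "cap_meas k e t = cap_meas k (axis k a) t"
proof -
  interpret prob_space "gauss {..k}" by (rule prob_space_gauss) simp
  let ?S = "{g \<in> space (gauss {..k}). g a / L2_set g {..k} \<le> t}"
  let ?S' = "{g \<in> space (gauss {..k}). ip k g e / L2_set g {..k} \<le> t}"
  have [measurable]: "(\<lambda>x. x a) \<in> borel_measurable (PiM {..k} (\<lambda>_. borel))"
    using a by (intro measurable_component_singleton) auto
  have [measurable]: "?S \<in> sets (PiM {..k} (\<lambda>_. borel))" "?S' \<in> sets (PiM {..k} (\<lambda>_. borel))"
    unfolding space_gauss by measurable
  note [measurable] = measurable_rot[OF a]
  have "emeasure (gauss {..k}) ?S' = (\<integral>\<^sup>+x. indicator ?S' x \<partial>gauss {..k})"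
    by (subst nn_integral_indicator) (auto simp: sets_gauss)
  also have "\<dots> = (\<integral>\<^sup>+x. indicator ?S (rot k a e x) \<partial>gauss {..k})"
    by (rule nn_integral_cong)
      (auto simp: indicator_def rot_coord_and_norm[OF a e ea] space_gauss intro: measurable_space[OF measurable_rot[OF a]])
  also have "\<dots> = (\<integral>\<^sup>+x. indicator ?S x \<partial>gauss {..k})"
    by (rule nn_integral_gauss_rot[OF a e ea]) measurable
  also have "\<dots> = emeasure (gauss {..k}) ?S"
    by (subst nn_integral_indicator) (auto simp: sets_gauss)
  finally show ?thesis using a by (simp add: cap_meas_def ip_axis emeasure_eq_measure)
qed

text \<open>The rotation degenerates exactly when \<open>e 0 = - 1\<close>. Then
  \<open>e 1 = 0\<close>, and axis 1, available because k \<ge> 1, serves as an intermediate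
  stop.\<close>

lemma cap_meas_eq_axis:
  assumes "1 \<le> k" and e: "ip k e e = 1"
  shows "cap_meas k e t = cap_meas k (axis k 0) t"
proof (cases "e 0 = - 1")
  case False
  then show ?thesis using e by (intro cap_meas_rot) auto
next
  case True
  have "(\<Sum>j\<in>{..k} - {0}. e j * e j) = 0"
    using e True unfolding ip_def by (subst (asm) sum.remove[of _ 0]) auto
  then have "e 1 = 0" using assms by (subst (asm) sum_nonneg_eq_0_iff) auto
  then have "cap_meas k e t = cap_meas k (axis k 1) t"
    using assms by (intro cap_meas_rot) auto
  also have "\<dots> = cap_meas k (axis k 0) t"
    using assms by (intro cap_meas_rot) (auto simp: ip_axis, auto simp: axis_def)
  finally show ?thesis .
qed

section \<open>The law of a normalised coordinate\<close>

lemma AE_gauss_iff: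
  assumes [measurable]: "Measurable.pred (PiM I (\<lambda>_. borel)) P"
  shows "(AE x in gauss I. P x) \<longleftrightarrow> (AE x in PiM I (\<lambda>_. lborel). P x)"
proof -
  have "0 < (\<Prod>j\<in>I. std_normal_density (x j))" for x :: "nat \<Rightarrow> real"
    by (intro prod_pos) (auto simp: normal_density_pos)
  then show ?thesis unfolding gauss_def by (subst AE_density) auto
qed

text \<open>Tonelli for the indicator of the exceptional set: it is null exactly when almost all of
  its lines parallel to axis \<open>a\<close> are null.\<close>

lemma AE_PiM_lborel_iff_slices:
  fixes a k :: nat
  assumes a: "a \<le> k" and [measurable]: "Measurable.pred (PiM {..k} (\<lambda>_. borel)) P"
  shows "(AE x in PiM {..k} (\<lambda>_. lborel :: real measure). P x) \<longleftrightarrow>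
    (AE x in PiM ({..k} - {a}) (\<lambda>_. lborel). AE y in lborel. P (x(a := y)))"
proof -
  interpret product_sigma_finite "\<lambda>_::nat. lborel :: real measure" by (rule product_sigma_finite_lborel)
  let ?I = "{..k} - {a}"
  have ins: "{..k} = insert a ?I" using a by auto
  define F where "F = (\<lambda>x. indicator {x. \<not> P x} x :: ennreal)"
  have [measurable]: "F \<in> borel_measurable (PiM {..k} (\<lambda>_. borel))"
    unfolding F_def indicator_def by measurable
  have FL: "F \<in> borel_measurable (PiM (insert a ?I) (\<lambda>_. lborel))"
    unfolding ins[symmetric] by measurable
  have m: "(\<lambda>y. F (x(a := y))) \<in> borel_measurable lborel" if x: "x \<in> space (PiM ?I (\<lambda>_. lborel :: real measure))" for x
    using measurable_comp[OF measurable_component_update FL, OF x] by (simp add: comp_def fun_upd_def)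
  have up: "(\<lambda>(x, y). x(a := y)) \<in> measurable (PiM ?I (\<lambda>_. lborel :: real measure) \<Otimes>\<^sub>M lborel) (PiM (insert a ?I) (\<lambda>_. lborel))"
    by (rule measurable_add_dim)
  have "(\<lambda>(x, y). F (x(a := y))) \<in> borel_measurable (PiM ?I (\<lambda>_. lborel) \<Otimes>\<^sub>M lborel)"
    using measurable_comp[OF up FL] by (simp add: comp_def split_beta')
  then have mi: "(\<lambda>x. \<integral>\<^sup>+y. F (x(a := y)) \<partial>lborel) \<in> borel_measurable (PiM ?I (\<lambda>_. lborel))"
    by (rule lborel.borel_measurable_nn_integral)
  have "(AE x in PiM {..k} (\<lambda>_. lborel :: real measure). P x) \<longleftrightarrow> (AE x in PiM {..k} (\<lambda>_. lborel). F x = 0)"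
    by (simp add: F_def indicator_def)
  also have "\<dots> \<longleftrightarrow> (\<integral>\<^sup>+x. F x \<partial>PiM {..k} (\<lambda>_. lborel)) = 0"
    by (subst nn_integral_0_iff_AE) auto
  also have "\<dots> \<longleftrightarrow> (\<integral>\<^sup>+x. (\<integral>\<^sup>+y. F (x(a := y)) \<partial>lborel) \<partial>PiM ?I (\<lambda>_. lborel)) = 0"
    using product_nn_integral_insert[OF _ _ FL] unfolding ins[symmetric] by simp
  also have "\<dots> \<longleftrightarrow> (AE x in PiM ?I (\<lambda>_. lborel). (\<integral>\<^sup>+y. F (x(a := y)) \<partial>lborel) = 0)"
    by (rule nn_integral_0_iff_AE[OF mi])
  also have "\<dots> \<longleftrightarrow> (AE x in PiM ?I (\<lambda>_. lborel). AE y in lborel. F (x(a := y)) = 0)"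
    by (rule AE_cong) (use m in \<open>simp add: nn_integral_0_iff_AE\<close>)
  finally show ?thesis by (simp add: F_def indicator_def)
qed

lemma AE_PiM_lborel_L2_pos:
  fixes k :: nat
  assumes "1 \<le> k"
  shows "AE x in PiM ({..k} - {0}) (\<lambda>_. lborel :: real measure). 0 < L2_set x ({..k} - {0})"
proof -
  have "AE x in PiM {..k} (\<lambda>_. lborel :: real measure). x 1 \<noteq> 0"
    using assms by (subst AE_PiM_lborel_iff_slices[of 1]) (auto intro!: AE_I2 AE_lborel_singleton)
  then have "AE x in PiM ({..k} - {0}) (\<lambda>_. lborel :: real measure). AE y in lborel. (x(0 := y)) 1 \<noteq> (0::real)"
    using assms by (subst (asm) AE_PiM_lborel_iff_slices[of 0]) auto
  then show ?thesis
  proof eventually_elim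
    case (elim x)
    then have "AE y in lborel :: real measure. x 1 \<noteq> 0" by simp
    then have "x 1 \<noteq> 0"
      using eventually_happens'[of "ae_filter lborel" "\<lambda>_. x 1 \<noteq> 0"] by (simp add: ae_filter_eq_bot_iff)
    then have "L2_set x ({..k} - {0}) \<noteq> 0" using assms by (subst L2_set_eq_0_iff) auto
    then show ?case using L2_set_nonneg[of x "{..k} - {0}"] by linarith
  qed
qed

lemma L2_set_upd_power2:
  fixes x :: "nat \<Rightarrow> real"
  shows "(L2_set (x(0 := y)) {..k})\<^sup>2 = y\<^sup>2 + (L2_set x ({..k} - {0}))\<^sup>2"
proof -
  have "(L2_set (x(0 := y)) {..k})\<^sup>2 = y\<^sup>2 + (\<Sum>j\<in>{..k} - {0}. ((x(0 := y)) j)\<^sup>2)"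
    unfolding sum_power2_eq[symmetric] by (subst sum.remove[of _ 0]) auto
  also have "(\<Sum>j\<in>{..k} - {0}. ((x(0 := y)) j)\<^sup>2) = (\<Sum>j\<in>{..k} - {0}. (x j)\<^sup>2)"
    by (rule sum.cong) auto
  finally show ?thesis unfolding sum_power2_eq .
qed

text \<open>On a line parallel to axis 0 at distance \<rho> > 0 from it, the condition on y squares
  to y^2 (1 - t^2) = t^2 \<rho>^2. This has at most two solutions, and none if t^2 = 1.\<close>

lemma axis_ratio_no_atom:
  assumes "1 \<le> k"
  shows "AE g in gauss {..k}. g 0 / L2_set g {..k} \<noteq> t"
proof -
  have "AE x in PiM ({..k} - {0}) (\<lambda>_. lborel). AE y in lborel. (x(0 := y)) 0 / L2_set (x(0 := y)) {..k} \<noteq> t"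
    using AE_PiM_lborel_L2_pos[OF assms]
  proof eventually_elim
    case (elim x)
    let ?\<rho> = "L2_set x ({..k} - {0})"
    define S where "S = {y. y\<^sup>2 * (1 - t\<^sup>2) = t\<^sup>2 * ?\<rho>\<^sup>2}"
    have sub: "y \<in> S" if "(x(0 := y)) 0 / L2_set (x(0 := y)) {..k} = t" for y
    proof -
      have pos: "0 < (L2_set (x(0 := y)) {..k})\<^sup>2"
        unfolding L2_set_upd_power2 using elim by (simp add: add_nonneg_pos)
      then have "y = t * L2_set (x(0 := y)) {..k}" using that by (auto simp: field_simps)
      then have "y\<^sup>2 = t\<^sup>2 * (y\<^sup>2 + ?\<rho>\<^sup>2)" unfolding L2_set_upd_power2[symmetric] by (metis power_mult_distrib)
      then show ?thesis by (simp add: S_def algebra_simps)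
    qed
    have "finite S"
    proof (cases "t\<^sup>2 = 1")
      case True
      then have "S = {}" using elim by (auto simp: S_def)
      then show ?thesis by simp
    next
      case False
      define d where "d = t\<^sup>2 * ?\<rho>\<^sup>2 / (1 - t\<^sup>2)"
      have "S \<subseteq> {sqrt d, - sqrt d}"
      proof
        fix y assume "y \<in> S"
        then have "y\<^sup>2 = d" using False by (simp add: S_def d_def field_simps)
        then have "\<bar>y\<bar> = sqrt d" by (metis real_sqrt_abs)
        then show "y \<in> {sqrt d, - sqrt d}" by auto
      qed
      then show ?thesis by (rule finite_subset) simp
    qed
    then have "AE y in lborel. y \<notin> S"
      by (intro AE_not_in) (simp add: finite_imp_null_set_lborel)
    then show ?case by eventually_elim (use sub in blast)
  qed
  then have "AE x in PiM {..k} (\<lambda>_. lborel). x 0 / L2_set x {..k} \<noteq> t"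
    by (subst AE_PiM_lborel_iff_slices[of 0]) auto
  then show ?thesis by (subst AE_gauss_iff) auto
qed

text \<open>On almost every line parallel to axis 0 the condition contains an open interval of
  positive length. This gives the strict monotonicity of cap measures and so the uniqueness of the
  cap constant.\<close>

lemma axis_ratio_charges:
  assumes k: "1 \<le> k" and s: "0 \<le> s" "s < s'" "s' < 1"
  shows "\<not> (AE g in gauss {..k}. \<not> (- s' < g 0 / L2_set g {..k} \<and> g 0 / L2_set g {..k} \<le> - s))"
proof
  assume "AE g in gauss {..k}. \<not> (- s' < g 0 / L2_set g {..k} \<and> g 0 / L2_set g {..k} \<le> - s)"
  then have "AE x in PiM {..k} (\<lambda>_. lborel). \<not> (- s' < x 0 / L2_set x {..k} \<and> x 0 / L2_set x {..k} \<le> - s)"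
    by (subst (asm) AE_gauss_iff) auto
  then have *: "AE x in PiM ({..k} - {0}) (\<lambda>_. lborel). AE y in lborel.
      \<not> (- s' < (x(0 := y)) 0 / L2_set (x(0 := y)) {..k} \<and> (x(0 := y)) 0 / L2_set (x(0 := y)) {..k} \<le> - s)"
    by (subst (asm) AE_PiM_lborel_iff_slices[of 0]) auto
  \<comment> \<open>The inverse of y / sqrt (y^2 + 1): at distance \<rho> from the axis, the ratio
    is - s exactly at y = - \<tau> s \<rho>.\<close>
  define \<tau> where "\<tau> = (\<lambda>s::real. s / sqrt (1 - s\<^sup>2))"
  have ss: "0 < 1 - s\<^sup>2" "0 < 1 - s'\<^sup>2" using s by (auto simp: power_less_one_iff abs_square_less_1)
  have \<tau>2: "(\<tau> s)\<^sup>2 * (1 - s\<^sup>2) = s\<^sup>2" "(\<tau> s')\<^sup>2 * (1 - s'\<^sup>2) = s'\<^sup>2"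
    using ss by (auto simp: \<tau>_def power_divide)
  have \<tau>0: "0 \<le> \<tau> s" "0 \<le> \<tau> s'" using s ss by (auto simp: \<tau>_def)
  have \<tau>lt: "\<tau> s < \<tau> s'"
  proof -
    have "s\<^sup>2 < s'\<^sup>2" using s by (intro power_strict_mono) auto
    then have "\<tau> s \<le> s / sqrt (1 - s'\<^sup>2)"
      using s ss unfolding \<tau>_def by (intro divide_left_mono mult_pos_pos) auto
    also have "\<dots> < \<tau> s'" using s ss by (auto simp: \<tau>_def divide_strict_right_mono)
    finally show ?thesis .
  qed
  have "AE x in PiM ({..k} - {0}) (\<lambda>_. lborel :: real measure). False"
    using * AE_PiM_lborel_L2_pos[OF k]
  proof eventually_elim
    case (elim x)
    let ?\<rho> = "L2_set x ({..k} - {0})"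
    have imp: "- s' < (x(0 := y)) 0 / L2_set (x(0 := y)) {..k} \<and> (x(0 := y)) 0 / L2_set (x(0 := y)) {..k} \<le> - s"
      if y: "y \<in> {- \<tau> s' * ?\<rho><..< - \<tau> s * ?\<rho>}" for y
    proof -
      let ?n = "L2_set (x(0 := y)) {..k}"
      have n2: "?n\<^sup>2 = y\<^sup>2 + ?\<rho>\<^sup>2" by (rule L2_set_upd_power2)
      then have "0 < ?n\<^sup>2" using elim by (simp add: add_nonneg_pos)
      then have n: "0 < ?n" using L2_set_nonneg[of "x(0 := y)" "{..k}"] by (simp add: less_le)
      have "(\<tau> s * ?\<rho>)\<^sup>2 \<le> (- y)\<^sup>2" using y \<tau>0 elim by (intro power_mono) auto
      then have "(\<tau> s)\<^sup>2 * (1 - s\<^sup>2) * ?\<rho>\<^sup>2 \<le> y\<^sup>2 * (1 - s\<^sup>2)"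
        using mult_right_mono[of "(\<tau> s * ?\<rho>)\<^sup>2" "y\<^sup>2" "1 - s\<^sup>2"] ss by (simp add: power_mult_distrib mult_ac)
      then have "(s * ?n)\<^sup>2 \<le> (- y)\<^sup>2" unfolding \<tau>2 power_mult_distrib n2 by (simp add: algebra_simps)
      moreover have "0 \<le> \<tau> s * ?\<rho>" using \<tau>0 elim by simp
      then have y0: "0 \<le> - y" using y by auto
      ultimately have 1: "s * ?n \<le> - y" by (rule power2_le_imp_le)
      have "(- y)\<^sup>2 < (\<tau> s' * ?\<rho>)\<^sup>2" using y y0 by (intro power_strict_mono) auto
      then have "y\<^sup>2 * (1 - s'\<^sup>2) < (\<tau> s')\<^sup>2 * (1 - s'\<^sup>2) * ?\<rho>\<^sup>2"
        using mult_strict_right_mono[of "y\<^sup>2" "(\<tau> s' * ?\<rho>)\<^sup>2" "1 - s'\<^sup>2"] ss by (simp add: power_mult_distrib mult_ac)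
      then have "(- y)\<^sup>2 < (s' * ?n)\<^sup>2" unfolding \<tau>2 power_mult_distrib n2 by (simp add: algebra_simps)
      then have 2: "- y < s' * ?n" by (rule power_less_imp_less_base) (use s n in auto)
      show ?thesis using 1 2 n by (simp add: field_simps)
    qed
    have "AE y in lborel. y \<notin> {- \<tau> s' * ?\<rho><..< - \<tau> s * ?\<rho>}"
      using elim(1) by eventually_elim (use imp in blast)
    then have "emeasure lborel {- \<tau> s' * ?\<rho><..< - \<tau> s * ?\<rho>} = 0"
      by (subst (asm) AE_iff_null_sets[symmetric]) (auto simp del: emeasure_lborel_Ioo)
    moreover have "\<tau> s * ?\<rho> < \<tau> s' * ?\<rho>" using \<tau>lt elim by simp
    ultimately show False using elim \<tau>lt by auto
  qed
  \<comment> \<open>A cube of measure 1 shows that falsity cannot hold almost everywhere.\<close>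
  then show False
  proof -
    have "emeasure (PiM ({..k} - {0}) (\<lambda>_. lborel :: real measure)) (Pi\<^sub>E ({..k} - {0}) (\<lambda>_. {0..1})) = 1"
      by (subst product_sigma_finite.emeasure_PiM[OF product_sigma_finite_lborel]) auto
    moreover have "emeasure (PiM ({..k} - {0}) (\<lambda>_. lborel :: real measure)) (space (PiM ({..k} - {0}) (\<lambda>_. lborel))) = 0"
      using \<open>AE x in _. False\<close> by (simp add: ae_filter_eq_bot_iff[symmetric] trivial_limit_def)
    ultimately show False
      using emeasure_mono[of "Pi\<^sub>E ({..k} - {0}) (\<lambda>_. {0..1})" "space (PiM ({..k} - {0}) (\<lambda>_. lborel :: real measure))"
        "PiM ({..k} - {0}) (\<lambda>_. lborel :: real measure)"] by (auto simp: space_PiM)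
  qed
qed

lemma cap_meas_mono: "t \<le> t' \<Longrightarrow> cap_meas k e t \<le> cap_meas k e t'"
proof -
  assume "t \<le> t'"
  interpret prob_space "gauss {..k}" by (rule prob_space_gauss) simp
  show ?thesis unfolding cap_meas_def using \<open>t \<le> t'\<close> by (intro finite_measure_mono) auto
qed

text \<open>This is a distribution function, and it is continuous because the law has no
  atoms.\<close>

lemma continuous_cap_meas_axis:
  assumes "1 \<le> k"
  shows "continuous_on UNIV (cap_meas k (axis k 0))"
proof -
  interpret prob_space "gauss {..k}" by (rule prob_space_gauss) simp
  let ?X = "\<lambda>g. g 0 / L2_set g {..k}"
  define \<mu> where "\<mu> = distr (gauss {..k}) borel ?X"
  have X [measurable]: "?X \<in> borel_measurable (gauss {..k})" by measurable
  interpret \<mu>: real_distribution \<mu> unfolding \<mu>_def by (rule real_distribution_distr) measurable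
  have cdf: "cdf \<mu> = cap_meas k (axis k 0)"
    by (rule ext) (auto simp: cdf_def \<mu>_def cap_meas_def measure_distr ip_axis intro!: arg_cong[where f="measure _"])
  have "measure \<mu> {t} = 0" for t
  proof -
    have "measure \<mu> {t} = prob {g \<in> space (gauss {..k}). ?X g = t}"
      by (auto simp: \<mu>_def measure_distr intro!: arg_cong[where f=prob])
    also have "\<dots> = 0"
      using axis_ratio_no_atom[OF assms, of t] by (subst (asm) AE_iff_measurable[OF _ refl]) (auto simp: emeasure_eq_measure)
    finally show ?thesis .
  qed
  then show ?thesis
    unfolding cdf[symmetric] by (intro continuous_at_imp_continuous_on) (simp add: \<mu>.isCont_cdf)
qed

text \<open>Two opposite half-spaces cover everything and have equal mass by rotation
  invariance.\<close>

lemma cap_meas_axis_zero: "1 \<le> k \<Longrightarrow> 1/2 \<le> cap_meas k (axis k 0) 0"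
proof -
  assume k: "1 \<le> k"
  interpret prob_space "gauss {..k}" by (rule prob_space_gauss) simp
  let ?e = "\<lambda>j. - axis k 0 j"
  have ie: "ip k g ?e = - g 0" for g
    using ip_axis[of 0 k g] by (simp add: ip_def sum_negf)
  have "ip k ?e ?e = 1" by (simp add: ie) (simp add: axis_def)
  then have "cap_meas k ?e 0 = cap_meas k (axis k 0) 0" using k by (intro cap_meas_eq_axis)
  moreover have "1 \<le> cap_meas k ?e 0 + cap_meas k (axis k 0) 0"
  proof -
    have "1 = prob ({g \<in> space (gauss {..k}). - g 0 / L2_set g {..k} \<le> 0} \<union> {g \<in> space (gauss {..k}). g 0 / L2_set g {..k} \<le> 0})"
      by (rule prob_space[symmetric, THEN trans]) (auto intro!: arg_cong[where f=prob])
    also have "\<dots> \<le> cap_meas k ?e 0 + cap_meas k (axis k 0) 0"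
      unfolding cap_meas_def ie by (simp add: ip_axis) (rule measure_Un_le; measurable)
    finally show ?thesis .
  qed
  ultimately show ?thesis by simp
qed

text \<open>A normalised coordinate is never below -1, and -1 is not an atom.\<close>

lemma cap_meas_axis_minus_one: "1 \<le> k \<Longrightarrow> s \<ge> 1 \<Longrightarrow> cap_meas k (axis k 0) (- s) = 0"
proof -
  assume k: "1 \<le> k" and s: "1 \<le> s"
  interpret prob_space "gauss {..k}" by (rule prob_space_gauss) simp
  have "AE g in gauss {..k}. \<not> g 0 / L2_set g {..k} \<le> - s"
    using axis_ratio_no_atom[OF k, of "- 1"] AE_gauss_L2_pos[of k]
  proof eventually_elim
    case (elim g)
    have "\<bar>g 0\<bar> \<le> L2_set (\<lambda>j. \<bar>g j\<bar>) {..k}" by (rule member_le_L2_set) auto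
    then have "\<bar>g 0\<bar> \<le> L2_set g {..k}" by (simp add: L2_set_def)
    then have "- 1 \<le> g 0 / L2_set g {..k}" using elim by (simp add: field_simps abs_le_iff)
    then show ?case using elim s by linarith
  qed
  then show ?thesis
    unfolding cap_meas_def by (subst (asm) AE_iff_measurable[OF _ refl]) (auto simp: ip_axis emeasure_eq_measure)
qed

text \<open>Existence by the intermediate value theorem on [-1, 0], where p < 1/2 makes the
  threshold non-positive; uniqueness because the law charges every interval in between. Rotation
  invariance reduces all directions to one axis.\<close>

lemma cap_const_ex1:
  assumes k: "1 \<le> k" and p: "0 < p" "p < 1/2"
  shows "\<exists>!c. c \<ge> 0 \<and> (\<forall>e \<in> unit_sphere k. cap_meas k e (- c / sqrt (real k)) = p)"
proof -
  interpret prob_space "gauss {..k}" by (rule prob_space_gauss) simp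
  let ?f = "cap_meas k (axis k 0)"
  have sk: "0 < sqrt (real k)" using k by simp
  have unit: "ip k e e = 1" if "e \<in> unit_sphere k" for e using that by (simp add: unit_sphere_def ip_self)
  have all: "(\<forall>e \<in> unit_sphere k. cap_meas k e t = p) \<longleftrightarrow> ?f t = p" for t
    using cap_meas_eq_axis[OF k unit] axis_unit[of 0 k] by (metis le0)
  have "?f (- 1) \<le> p" "p \<le> ?f 0"
    using cap_meas_axis_zero[OF k] cap_meas_axis_minus_one[OF k, of 1] p by auto
  moreover have "continuous_on {- 1..0} ?f"
    by (rule continuous_on_subset[OF continuous_cap_meas_axis[OF k]]) simp
  ultimately obtain t where t: "- 1 \<le> t" "t \<le> 0" "?f t = p"
    using IVT'[of ?f "- 1" p 0] by auto
  have inj: False if s: "0 \<le> s" "s < s'" and eq: "?f (- s) = p" "?f (- s') = p" for s s'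
  proof -
    have s1: "s < 1" using cap_meas_axis_minus_one[OF k, of s] eq p by (cases "s < 1") auto
    \<comment> \<open>\<open>s'\<close> may exceed 1, beyond the range where intervals are known to
      be charged; the midpoint towards \<open>min s' 1\<close> lies strictly between
      \<open>s\<close> and 1.\<close>
    define m where "m = (s + min s' 1) / 2"
    have m: "s < m" "m < 1" "m \<le> s'" using s s1 by (auto simp: m_def min_def)
    have em: "?f (- m) = ?f (- s)"
      using cap_meas_mono[of "- s'" "- m" k "axis k 0"] cap_meas_mono[of "- m" "- s" k "axis k 0"] m eq by simp
    let ?X = "\<lambda>g. g 0 / L2_set g {..k}"
    have "prob ({g \<in> space (gauss {..k}). ?X g \<le> - s} - {g \<in> space (gauss {..k}). ?X g \<le> - m}) = ?f (- s) - ?f (- m)"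
      unfolding cap_meas_def by (subst finite_measure_Diff) (use m in \<open>auto simp: ip_axis\<close>)
    also have "{g \<in> space (gauss {..k}). ?X g \<le> - s} - {g \<in> space (gauss {..k}). ?X g \<le> - m}
        = {g \<in> space (gauss {..k}). \<not> \<not> (- m < ?X g \<and> ?X g \<le> - s)}" by auto
    finally have "AE g in gauss {..k}. \<not> (- m < ?X g \<and> ?X g \<le> - s)"
      by (subst AE_iff_measurable[OF _ refl]) (auto simp: em emeasure_eq_measure)
    then show False using axis_ratio_charges[OF k s(1) m(1,2)] by simp
  qed
  show ?thesis
    unfolding all
  proof (rule ex1I[of _ "- t * sqrt (real k)"])
    show "0 \<le> - t * sqrt (real k) \<and> ?f (- (- t * sqrt (real k)) / sqrt (real k)) = p"
      using t sk by (simp add: mult_nonpos_nonneg)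
    fix c assume c: "0 \<le> c \<and> ?f (- c / sqrt (real k)) = p"
    have "c / sqrt (real k) = - t"
    proof (rule linorder_cases)
      assume "c / sqrt (real k) < - t" then show ?thesis using inj[of "c / sqrt (real k)" "- t"] c t by simp
    next
      assume "- t < c / sqrt (real k)" then show ?thesis using inj[of "- t" "c / sqrt (real k)"] c t by simp
    qed
    then show "c = - t * sqrt (real k)" using sk by (simp add: field_simps)
  qed
qed

text \<open>If the constant exceeded \<open>b\<close>, the cap at - b / sqrt k would have mass at
  least \<open>p\<close>. Its points come from Gaussian vectors that are too short or have a
  coordinate at most - b / sqrt 2, and these two events together have mass at most q < p.\<close>

lemma cap_const_bounds:
  assumes k: "1 \<le> k" and p: "0 < q" "q < p" "p < 1/2" and b: "0 < b"
    and small: "exp (- real k / 25) + exp (- b\<^sup>2 / 4) \<le> q"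
  shows "0 \<le> cap_const k p" "cap_const k p \<le> b"
proof -
  interpret prob_space "gauss {..k}" by (rule prob_space_gauss) simp
  let ?c = "cap_const k p"
  have "?c \<ge> 0 \<and> (\<forall>e \<in> unit_sphere k. cap_meas k e (- ?c / sqrt (real k)) = p)"
    unfolding cap_const_def measure_sphere_unif_cap using p by (intro theI'[OF cap_const_ex1[OF k]]) auto
  then have c: "0 \<le> ?c" "cap_meas k (axis k 0) (- ?c / sqrt (real k)) = p" using axis_unit[of 0 k] by auto
  show "0 \<le> ?c" by fact
  show "?c \<le> b"
  proof (rule ccontr)
    assume "\<not> ?c \<le> b"
    then have "- ?c / sqrt (real k) \<le> - b / sqrt (real k)" using k by (simp add: divide_right_mono)
    then have "p \<le> cap_meas k (axis k 0) (- b / sqrt (real k))"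
      using cap_meas_mono[of "- ?c / sqrt (real k)"] c by metis
    also have "\<dots> \<le> prob ({g \<in> space (gauss {..k}). (L2_set g {..k})\<^sup>2 \<le> real k / 2}
        \<union> {g \<in> space (gauss {..k}). ip k g (axis k 0) \<le> - (b / sqrt 2)})"
      unfolding cap_meas_def
    proof (intro finite_measure_mono subsetI)
      fix g assume g: "g \<in> {g \<in> space (gauss {..k}). ip k g (axis k 0) / L2_set g {..k} \<le> - b / sqrt (real k)}"
      show "g \<in> {g \<in> space (gauss {..k}). (L2_set g {..k})\<^sup>2 \<le> real k / 2}
        \<union> {g \<in> space (gauss {..k}). ip k g (axis k 0) \<le> - (b / sqrt 2)}"
      proof (cases "(L2_set g {..k})\<^sup>2 \<le> real k / 2")
        case False
        then have n: "sqrt (real k / 2) \<le> L2_set g {..k}" by (intro real_le_lsqrt) auto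
        have "0 < sqrt (real k / 2)" using k by simp
        then have n0: "0 < L2_set g {..k}" using n by linarith
        have "ip k g (axis k 0) \<le> - b / sqrt (real k) * L2_set g {..k}"
          using g n0 by (simp add: field_simps)
        also have "\<dots> \<le> - b / sqrt (real k) * sqrt (real k / 2)"
          using n b k by (intro mult_left_mono_neg) auto
        also have "\<dots> = - (b / sqrt 2)" using k by (simp add: real_sqrt_divide)
        finally show ?thesis using g by simp
      qed (use g in auto)
    qed measurable
    also have "\<dots> \<le> exp (- real k / 25) + exp (- (b / sqrt 2)\<^sup>2 / 2)"
    proof (intro order_trans[OF measure_Un_le] add_mono)
      have "ip k (axis k 0) (axis k 0) = 1" using axis_unit[of 0 k] by (simp add: unit_sphere_def ip_self)
      then show "prob {g \<in> space (gauss {..k}). ip k g (axis k 0) \<le> - (b / sqrt 2)} \<le> exp (- (b / sqrt 2)\<^sup>2 / 2)"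
        using b by (intro gauss_linear_tail) auto
    qed (use gauss_lower_tail[of k] in \<open>simp_all\<close>)
    also have "exp (- (b / sqrt 2)\<^sup>2 / 2) = exp (- b\<^sup>2 / 4)" by (simp add: power_divide)
    finally show False using small p by simp
  qed
qed

section \<open>Cliques and perfect sequences\<close>

lemma lincomb_cong: "(\<And>m. m \<in> J \<Longrightarrow> x m = x' m) \<Longrightarrow> (\<And>m. m \<in> J \<Longrightarrow> a m = a' m) \<Longrightarrow> lincomb x J a = lincomb x' J a'"
  by (simp add: lincomb_def)

lemma proj_le_cong: "(\<And>m. m \<in> J \<Longrightarrow> x m = x' m) \<Longrightarrow> proj_le k x J v s = proj_le k x' J v s"
  using lincomb_cong[of J x x'] by (simp add: proj_le_def)

text \<open>Both sides of the test are continuous in the coefficients, so rational ones suffice.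
  With extensional coefficient functions the test set is countable, which makes the projection event
  measurable.\<close>

lemma proj_le_rational:
  assumes "finite J"
  shows "proj_le k x J v s \<longleftrightarrow>
    (\<forall>a\<in>J \<rightarrow>\<^sub>E \<rat>. \<bar>ip k v (lincomb x J a)\<bar> \<le> s * L2_set (lincomb x J a) {..k})"
proof
  assume *: "\<forall>a\<in>J \<rightarrow>\<^sub>E \<rat>. \<bar>ip k v (lincomb x J a)\<bar> \<le> s * L2_set (lincomb x J a) {..k}"
  show "proj_le k x J v s"
    unfolding proj_le_def
  proof
    fix a :: "nat \<Rightarrow> real"
    have "\<forall>j n. \<exists>q\<in>\<rat>. a j < q \<and> q < a j + 1 / real (Suc n)"
      by (intro allI Rats_dense_in_real) simp
    then obtain q where q: "\<And>j n. q j n \<in> \<rat>" "\<And>j n. a j < q j n" "\<And>j n. q j n < a j + 1 / real (Suc n)"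
      by metis
    have lim: "(\<lambda>n. q j n) \<longlonglongrightarrow> a j" for j
    proof (rule tendsto_sandwich[of "\<lambda>_. a j" _ _ "\<lambda>n. a j + 1 / real (Suc n)"])
      have "(\<lambda>n. a j + 1 / real (Suc n)) \<longlonglongrightarrow> a j + 0"
        using LIMSEQ_inverse_real_of_nat by (intro tendsto_add) (auto simp: inverse_eq_divide)
      then show "(\<lambda>n. a j + 1 / real (Suc n)) \<longlonglongrightarrow> a j" by simp
    qed (use q in \<open>auto intro!: always_eventually less_imp_le\<close>)
    define c where "c = (\<lambda>n. \<lambda>j\<in>J. q j n)"
    have c: "c n \<in> J \<rightarrow>\<^sub>E \<rat>" for n using q by (auto simp: c_def)
    have lc: "(\<lambda>n. lincomb x J (c n) j) \<longlonglongrightarrow> lincomb x J a j" for j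
      unfolding lincomb_def c_def using lim by (intro tendsto_sum tendsto_mult tendsto_const) auto
    have "(\<lambda>n. \<bar>ip k v (lincomb x J (c n))\<bar>) \<longlonglongrightarrow> \<bar>ip k v (lincomb x J a)\<bar>"
      unfolding ip_def by (intro tendsto_rabs tendsto_sum tendsto_mult tendsto_const lc)
    moreover have "(\<lambda>n. s * L2_set (lincomb x J (c n)) {..k}) \<longlonglongrightarrow> s * L2_set (lincomb x J a) {..k}"
      unfolding L2_set_def by (intro tendsto_mult tendsto_const tendsto_real_sqrt tendsto_sum tendsto_power lc)
    ultimately show "\<bar>ip k v (lincomb x J a)\<bar> \<le> s * L2_set (lincomb x J a) {..k}"
      by (rule LIMSEQ_le) (use * c in blast)
  qed
qed (simp add: proj_le_def)

lemma pred_proj_le: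
  assumes "finite J"
    and X: "\<And>m j. m \<in> J \<Longrightarrow> j \<le> k \<Longrightarrow> (\<lambda>\<omega>. X \<omega> m j) \<in> borel_measurable M"
    and V: "\<And>j. j \<le> k \<Longrightarrow> (\<lambda>\<omega>. V \<omega> j) \<in> borel_measurable M"
  shows "Measurable.pred M (\<lambda>\<omega>. proj_le k (X \<omega>) J (V \<omega>) s)"
proof -
  have lc: "(\<lambda>\<omega>. lincomb (X \<omega>) J a j) \<in> borel_measurable M" if "j \<le> k" for a j
    unfolding lincomb_def using X that by (intro borel_measurable_sum borel_measurable_times) auto
  have "(\<lambda>\<omega>. ip k (V \<omega>) (lincomb (X \<omega>) J a)) \<in> borel_measurable M" for a
    unfolding ip_def using V lc by (intro borel_measurable_sum borel_measurable_times) auto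
  moreover have "(\<lambda>\<omega>. L2_set (lincomb (X \<omega>) J a) {..k}) \<in> borel_measurable M" for a
    unfolding L2_set_def using lc
    by (intro measurable_compose[OF _ borel_measurable_sqrt] borel_measurable_sum borel_measurable_power) auto
  ultimately have [measurable]: "Measurable.pred M (\<lambda>\<omega>. \<bar>ip k (V \<omega>) (lincomb (X \<omega>) J a)\<bar> \<le> s * L2_set (lincomb (X \<omega>) J a) {..k})" for a
    by measurable
  let ?C = "J \<rightarrow>\<^sub>E (\<rat> :: real set)"
  have "countable ?C" using assms(1) by (intro countable_PiE) (auto intro: countable_rat)
  moreover have "?C \<noteq> {}" by (auto simp: PiE_eq_empty_iff)
  ultimately have "range (from_nat_into ?C) = ?C" by (intro range_from_nat_into)
  then have *: "(\<forall>a\<in>?C. P a) \<longleftrightarrow> (\<forall>n. P (from_nat_into ?C n))" for P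
    by (metis rangeI rangeE)
  show ?thesis
    unfolding proj_le_rational[OF assms(1)] * by measurable
qed

lemma borel_measurable_tuple_coord:
  assumes "i \<in> I" "j \<le> k"
  shows "(\<lambda>x. x i j) \<in> borel_measurable (PiM I (\<lambda>_. sphere_unif k))"
proof -
  have "(\<lambda>y. y j) \<in> borel_measurable (sphere_unif k)"
    unfolding measurable_cong_sets[OF sets_sphere_unif refl] using assms by (intro measurable_component_singleton) auto
  moreover have "(\<lambda>x. x i) \<in> measurable (PiM I (\<lambda>_. sphere_unif k)) (sphere_unif k)"
    using assms by (intro measurable_component_singleton)
  ultimately show ?thesis by (rule measurable_compose[rotated])
qed

text \<open>The predicate \<open>Q\<close> on inner products covers both colours, and the index set
  is arbitrary because a vertex in the middle of the sequence will be removed.\<close>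

definition clique_on :: "nat \<Rightarrow> (real \<Rightarrow> bool) \<Rightarrow> nat set \<Rightarrow> (nat \<Rightarrow> nat \<Rightarrow> real) \<Rightarrow> bool" where
  "clique_on k Q J x \<longleftrightarrow> (\<forall>i\<in>J. \<forall>j\<in>J. i \<noteq> j \<longrightarrow> Q (ip k (x i) (x j)))"

definition perfect_upto :: "nat \<Rightarrow> real \<Rightarrow> nat \<Rightarrow> (nat \<Rightarrow> nat \<Rightarrow> real) \<Rightarrow> bool" where
  "perfect_upto k \<delta> r x \<longleftrightarrow> (\<forall>i\<in>{1..<r}. proj_le k x {1..i} (x (Suc i)) \<delta>)"

lemma pred_clique_on:
  assumes [measurable]: "Measurable.pred borel Q" and J: "finite J" "J \<subseteq> I"
  shows "Measurable.pred (PiM I (\<lambda>_. sphere_unif k)) (clique_on k Q J)"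
proof -
  have "(\<lambda>x. ip k (x i) (x j)) \<in> borel_measurable (PiM I (\<lambda>_. sphere_unif k))" if "i \<in> J" "j \<in> J" for i j
    unfolding ip_def using that J by (intro borel_measurable_sum borel_measurable_times borel_measurable_tuple_coord) auto
  then have "Measurable.pred (PiM I (\<lambda>_. sphere_unif k)) (\<lambda>x. Q (ip k (x i) (x j)))" if "i \<in> J" "j \<in> J" for i j
    using that by (intro measurable_compose[OF _ assms(1)])
  then have "Measurable.pred (PiM I (\<lambda>_. sphere_unif k)) (\<lambda>x. i \<noteq> j \<longrightarrow> Q (ip k (x i) (x j)))" if "i \<in> J" "j \<in> J" for i j
    using that by (cases "i = j") simp_all
  then show ?thesis
    unfolding clique_on_def[abs_def] by (intro pred_intros_finite(3)[OF J(1)])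
qed

lemma pred_perfect_upto:
  assumes "{1..r} \<subseteq> I"
  shows "Measurable.pred (PiM I (\<lambda>_. sphere_unif k)) (perfect_upto k \<delta> r)"
proof -
  have "Measurable.pred (PiM I (\<lambda>_. sphere_unif k)) (\<lambda>x. proj_le k x {1..i} (x (Suc i)) \<delta>)"
    if i: "i \<in> {1..<r}" for i
  proof (rule pred_proj_le)
    fix m j :: nat assume "m \<in> {1..i}" "j \<le> k"
    then show "(\<lambda>x. x m j) \<in> borel_measurable (PiM I (\<lambda>_. sphere_unif k))"
      using assms i by (intro borel_measurable_tuple_coord) auto
  next
    fix j :: nat assume "j \<le> k"
    then show "(\<lambda>x. x (Suc i) j) \<in> borel_measurable (PiM I (\<lambda>_. sphere_unif k))"
      using assms i by (intro borel_measurable_tuple_coord) auto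
  qed simp
  then show ?thesis
    unfolding perfect_upto_def[abs_def] by (intro pred_intros_finite(3)) auto
qed

lemma perfect_upto_cong: "(\<And>m. m \<in> {1..r} \<Longrightarrow> x m = x' m) \<Longrightarrow> perfect_upto k \<delta> r x = perfect_upto k \<delta> r x'"
proof -
  assume *: "\<And>m. m \<in> {1..r} \<Longrightarrow> x m = x' m"
  have "proj_le k x {1..i} (x (Suc i)) \<delta> = proj_le k x' {1..i} (x' (Suc i)) \<delta>" if i: "i \<in> {1..<r}" for i
  proof -
    have "x (Suc i) = x' (Suc i)" using i by (intro *) auto
    then show ?thesis using proj_le_cong[of "{1..i}" x x'] * i by auto
  qed
  then show ?thesis by (simp add: perfect_upto_def)
qed

lemma clique_on_cong: "(\<And>m. m \<in> J \<Longrightarrow> x m = x' m) \<Longrightarrow> clique_on k Q J x = clique_on k Q J x'"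
  by (simp add: clique_on_def)

section \<open>Independent points on the sphere\<close>

lemma product_sigma_finite_sphere: "product_sigma_finite (\<lambda>_::nat. sphere_unif k)"
  unfolding product_sigma_finite_def
  by (auto intro!: prob_space_imp_sigma_finite prob_space_sphere_unif)

lemma prob_space_PiM_sphere: "prob_space (PiM I (\<lambda>_. sphere_unif k))"
  by (intro prob_space_PiM prob_space_sphere_unif)

lemma measure_clique_on_card:
  assumes Q: "Measurable.pred borel Q" and fin: "finite J" "finite J'" and card: "card J = card J'"
  shows "measure (PiM J (\<lambda>_. sphere_unif k)) {x \<in> space (PiM J (\<lambda>_. sphere_unif k)). clique_on k Q J x}
    = measure (PiM J' (\<lambda>_. sphere_unif k)) {x \<in> space (PiM J' (\<lambda>_. sphere_unif k)). clique_on k Q J' x}"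
proof -
  obtain f where f: "bij_betw f J' J" using finite_same_card_bij[OF fin(2,1)] card by auto
  let ?M = "PiM J (\<lambda>_. sphere_unif k)" and ?M' = "PiM J' (\<lambda>_. sphere_unif k)"
  let ?g = "\<lambda>\<omega>. \<lambda>n\<in>J'. \<omega> (f n)"
  have D: "distr ?M ?M' ?g = ?M'"
    using distr_PiM_reindex[of J "\<lambda>_. sphere_unif k" f J'] f prob_space_sphere_unif
    by (auto simp: bij_betw_def)
  have g: "?g \<in> measurable ?M ?M'"
    using f by (intro measurable_restrict measurable_component_singleton) (auto simp: bij_betw_def)
  have cl: "clique_on k Q J' (?g \<omega>) = clique_on k Q J \<omega>" for \<omega>
  proof -
    have J: "J = f ` J'" and inj: "inj_on f J'" using f by (auto simp: bij_betw_def)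
    show ?thesis unfolding J clique_on_def using inj by (auto simp: inj_on_def)
  qed
  have "measure ?M' {x \<in> space ?M'. clique_on k Q J' x} = measure (distr ?M ?M' ?g) {x \<in> space ?M'. clique_on k Q J' x}"
    by (simp add: D)
  also have "\<dots> = measure ?M (?g -` {x \<in> space ?M'. clique_on k Q J' x} \<inter> space ?M)"
    using pred_clique_on[OF Q fin(2) order_refl, of k] by (intro measure_distr g) measurable
  also have "?g -` {x \<in> space ?M'. clique_on k Q J' x} \<inter> space ?M = {x \<in> space ?M. clique_on k Q J x}"
    using measurable_space[OF g] by (auto simp: cl)
  finally show ?thesis ..
qed

lemma AE_tuple_unit:
  assumes "finite I"
  shows "AE x in PiM I (\<lambda>_. sphere_unif k). \<forall>m\<in>I. ip k (x m) (x m) = 1"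
  using assms AE_PiM_component[of I "\<lambda>_. sphere_unif k" _ "\<lambda>x. ip k x x = 1"]
  by (subst AE_finite_all) (auto simp: prob_space_sphere_unif AE_sphere_unif_unit)

text \<open>Tonelli with point \<open>i\<close> drawn last, even if its index lies in the
  middle.\<close>

lemma emeasure_PiM_insert_sphere:
  fixes i :: nat
  assumes I: "finite I" "i \<notin> I"
    and P: "Measurable.pred (PiM (insert i I) (\<lambda>_. sphere_unif k)) P"
  shows "emeasure (PiM (insert i I) (\<lambda>_. sphere_unif k)) {x \<in> space (PiM (insert i I) (\<lambda>_. sphere_unif k)). P x}
    = (\<integral>\<^sup>+x. emeasure (sphere_unif k) {y \<in> space (sphere_unif k). P (x(i := y))} \<partial>PiM I (\<lambda>_. sphere_unif k))"
proof -
  let ?M = "PiM (insert i I) (\<lambda>_. sphere_unif k)"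
  let ?F = "\<lambda>x. indicator {x \<in> space ?M. P x} x :: ennreal"
  have F: "?F \<in> borel_measurable ?M" using P by measurable
  have "emeasure ?M {x \<in> space ?M. P x} = (\<integral>\<^sup>+x. ?F x \<partial>?M)"
    using P by (subst nn_integral_indicator, measurable)
  also have "\<dots> = (\<integral>\<^sup>+x. (\<integral>\<^sup>+y. ?F (x(i := y)) \<partial>sphere_unif k) \<partial>PiM I (\<lambda>_. sphere_unif k))"
    by (rule product_sigma_finite.product_nn_integral_insert[OF product_sigma_finite_sphere I F])
  also have "\<dots> = (\<integral>\<^sup>+x. emeasure (sphere_unif k) {y \<in> space (sphere_unif k). P (x(i := y))} \<partial>PiM I (\<lambda>_. sphere_unif k))"
  proof (rule nn_integral_cong)
    fix x assume x: "x \<in> space (PiM I (\<lambda>_. sphere_unif k))"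
    have m: "(\<lambda>y. x(i := y)) \<in> measurable (sphere_unif k) ?M"
      using measurable_component_update[OF x I(2)] .
    have "(\<integral>\<^sup>+y. ?F (x(i := y)) \<partial>sphere_unif k)
        = (\<integral>\<^sup>+y. indicator {y \<in> space (sphere_unif k). P (x(i := y))} y \<partial>sphere_unif k)"
      using measurable_space[OF m] by (intro nn_integral_cong) (auto simp: indicator_def)
    also have "\<dots> = emeasure (sphere_unif k) {y \<in> space (sphere_unif k). P (x(i := y))}"
      using measurable_compose[OF m P] by (intro nn_integral_indicator) measurable
    finally show "(\<integral>\<^sup>+y. ?F (x(i := y)) \<partial>sphere_unif k)
      = emeasure (sphere_unif k) {y \<in> space (sphere_unif k). P (x(i := y))}" .
  qed
  finally show ?thesis .
qed

lemma perfect_upto_Suc: "1 \<le> i \<Longrightarrow> perfect_upto k \<delta> (Suc i) x \<longleftrightarrow> perfect_upto k \<delta> i x \<and> proj_le k x {1..i} (x (Suc i)) \<delta>"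
  by (auto simp: perfect_upto_def less_Suc_eq)

text \<open>The first imperfect vertex \<open>i + 1\<close> is exponentially unlikely given the perfect prefix and is
  then dropped from the clique; a perfect clique of size \<open>r - 1\<close> extends with probability at least
  \<open>p_good\<close>, which is much larger.\<close>

lemma clique_le_perfect_clique:
  assumes Q: "Measurable.pred borel Q"
    and bad: "\<And>i x. 1 \<le> i \<Longrightarrow> i < R \<Longrightarrow> (\<And>m. m \<in> {1..i} \<Longrightarrow> ip k (x m) (x m) = 1) \<Longrightarrow> perfect_upto k \<delta> i x
      \<Longrightarrow> measure (sphere_unif k) {y \<in> space (sphere_unif k). \<not> proj_le k x {1..i} y \<delta>} \<le> p_bad"
    and good: "\<And>i x. 1 \<le> i \<Longrightarrow> i < R \<Longrightarrow> (\<And>m. m \<in> {1..i} \<Longrightarrow> ip k (x m) (x m) = 1) \<Longrightarrow> perfect_upto k \<delta> i x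
      \<Longrightarrow> p_good \<le> measure (sphere_unif k) {y \<in> space (sphere_unif k). (\<forall>j\<in>{1..i}. Q (ip k (x j) y)) \<and> proj_le k x {1..i} y \<delta>}"
    and \<epsilon>: "0 \<le> p_bad" "0 \<le> p_good" "0 \<le> \<eta>" "\<eta> \<le> 1" "2 * real R * p_bad \<le> \<eta> * p_good"
    and r: "1 \<le> r" "r \<le> R"
  defines "M \<equiv> \<lambda>r. PiM {1..r} (\<lambda>_. sphere_unif k)"
  shows "measure (M r) {x \<in> space (M r). clique_on k Q {1..r} x}
    \<le> (1 + \<eta>) * measure (M r) {x \<in> space (M r). clique_on k Q {1..r} x \<and> perfect_upto k \<delta> r x}"
  using r
proof (induction r rule: dec_induct)
  case base
  interpret prob_space "M (Suc 0)" unfolding M_def by (rule prob_space_PiM_sphere)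
  show ?case using \<epsilon>(3) by (simp add: clique_on_def perfect_upto_def prob_space)
next
  case (step i)
  let ?S = "sphere_unif k"
  define Pc where "Pc = (\<lambda>r. measure (M r) {x \<in> space (M r). clique_on k Q {1..r} x})"
  define Pp where "Pp = (\<lambda>r. measure (M r) {x \<in> space (M r). clique_on k Q {1..r} x \<and> perfect_upto k \<delta> r x})"
  interpret S: prob_space ?S by (rule prob_space_sphere_unif)
  interpret M: prob_space "M (Suc i)" unfolding M_def by (rule prob_space_PiM_sphere)
  interpret Mi: prob_space "M i" unfolding M_def by (rule prob_space_PiM_sphere)
  have i: "1 \<le> i" "i < R" "Suc i \<le> R" using step by auto
  have IH: "Pc i \<le> (1 + \<eta>) * Pp i" using step by (simp add: Pc_def Pp_def)
  have mC: "Measurable.pred (PiM I (\<lambda>_. ?S)) (clique_on k Q J)" if "J \<subseteq> I" "finite J" for I J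
    using pred_clique_on[OF Q] that by blast
  have mP: "Measurable.pred (PiM I (\<lambda>_. ?S)) (perfect_upto k \<delta> r)" if "{1..r} \<subseteq> I" for I r
    using pred_perfect_upto that by blast
  note [measurable] = mC[OF order_refl, of "{1..Suc i}"] mC[OF order_refl, of "{1..i}"] mP[OF order_refl, of "Suc i"] mP[OF order_refl, of i]
  have extend: "p_good * Pp i \<le> Pp (Suc i)"
  proof -
    have ins: "{1..Suc i} = insert (Suc i) {1..i}" by auto
    let ?A = "{x \<in> space (M i). clique_on k Q {1..i} x \<and> perfect_upto k \<delta> i x}"
    have A: "?A \<in> sets (M i)" unfolding M_def by measurable
    have "ennreal (p_good * Pp i) = (\<integral>\<^sup>+x. ennreal p_good * indicator ?A x \<partial>M i)"
      using A \<epsilon> by (simp add: nn_integral_cmult_indicator Pp_def Mi.emeasure_eq_measure ennreal_mult')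
    also have "\<dots> \<le> (\<integral>\<^sup>+x. emeasure ?S {y \<in> space ?S. clique_on k Q {1..Suc i} (x(Suc i := y)) \<and> perfect_upto k \<delta> (Suc i) (x(Suc i := y))} \<partial>M i)"
    proof (rule nn_integral_mono_AE)
      have "AE x in M i. \<forall>m\<in>{1..i}. ip k (x m) (x m) = 1"
        unfolding M_def by (rule AE_tuple_unit) simp
      then show "AE x in M i. ennreal p_good * indicator ?A x \<le>
        emeasure ?S {y \<in> space ?S. clique_on k Q {1..Suc i} (x(Suc i := y)) \<and> perfect_upto k \<delta> (Suc i) (x(Suc i := y))}"
      proof eventually_elim
        case (elim x)
        show ?case
        proof (cases "x \<in> ?A")
          case True
          have "{y \<in> space ?S. clique_on k Q {1..Suc i} (x(Suc i := y)) \<and> perfect_upto k \<delta> (Suc i) (x(Suc i := y))}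
            = {y \<in> space ?S. (\<forall>j\<in>{1..i}. Q (ip k (x j) y)) \<and> proj_le k x {1..i} y \<delta>}"
          proof -
            have "clique_on k Q {1..Suc i} (x(Suc i := y)) \<longleftrightarrow> (\<forall>j\<in>{1..i}. Q (ip k (x j) y))" for y
            proof -
              have "clique_on k Q {1..Suc i} (x(Suc i := y)) \<longleftrightarrow>
                clique_on k Q {1..i} x \<and> (\<forall>j\<in>{1..i}. Q (ip k (x j) y) \<and> Q (ip k y (x j)))"
                unfolding ins clique_on_def by auto
              then show ?thesis using True by (auto simp: ip_commute[of k y])
            qed
            moreover have "perfect_upto k \<delta> (Suc i) (x(Suc i := y)) \<longleftrightarrow> proj_le k x {1..i} y \<delta>" for y
              using True perfect_upto_cong[of i "x(Suc i := y)" x] proj_le_cong[of "{1..i}" "x(Suc i := y)" x]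
              unfolding perfect_upto_Suc[OF i(1)] by simp
            ultimately show ?thesis by simp
          qed
          then show ?thesis
            using good[OF i(1,2), of x] elim True by (simp add: S.emeasure_eq_measure)
        qed simp
      qed
    qed
    also have "\<dots> = emeasure (M (Suc i)) {x \<in> space (M (Suc i)). clique_on k Q {1..Suc i} x \<and> perfect_upto k \<delta> (Suc i) x}"
    proof -
      have m: "Measurable.pred (PiM (insert (Suc i) {1..i}) (\<lambda>_. ?S)) (\<lambda>x. clique_on k Q {1..Suc i} x \<and> perfect_upto k \<delta> (Suc i) x)"
        unfolding ins[symmetric] by measurable
      show ?thesis using emeasure_PiM_insert_sphere[OF _ _ m] unfolding M_def ins[symmetric] by simp
    qed
    finally show ?thesis by (simp add: Pp_def M.emeasure_eq_measure)
  qed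
  \<comment> \<open>The edges at vertex \<open>Suc j\<close> and all conditions on projections after
    it are discarded. Given the other points, which form a clique of size \<open>i\<close>, only the
    long projection of this one point remains.\<close>
  define E where "E = (\<lambda>j. {x \<in> space (M (Suc i)). clique_on k Q ({1..Suc i} - {Suc j}) x \<and> perfect_upto k \<delta> j x \<and>
      \<not> proj_le k x {1..j} (x (Suc j)) \<delta>})"
  have mE: "E j \<in> sets (M (Suc i))" and bound: "M.prob (E j) \<le> p_bad * Pc i" if j: "j \<in> {1..i}" for j
  proof -
    let ?J = "{1..Suc i} - {Suc j}"
    have ins: "{1..Suc i} = insert (Suc j) ?J" using j by auto
    have sub: "{1..j} \<subseteq> ?J" using j by auto
    have m1: "Measurable.pred (M (Suc i)) (clique_on k Q ?J)" unfolding M_def by (rule mC) auto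
    have m2: "Measurable.pred (M (Suc i)) (perfect_upto k \<delta> j)" unfolding M_def using j by (intro mP) auto
    have m3: "Measurable.pred (M (Suc i)) (\<lambda>x. proj_le k x {1..j} (x (Suc j)) \<delta>)"
      unfolding M_def using j by (intro pred_proj_le borel_measurable_tuple_coord) auto
    note [measurable] = m1 m2 m3
    have m4: "Measurable.pred (M (Suc i)) (\<lambda>x. clique_on k Q ?J x \<and> perfect_upto k \<delta> j x \<and> \<not> proj_le k x {1..j} (x (Suc j)) \<delta>)"
      by measurable
    show "E j \<in> sets (M (Suc i))" unfolding E_def by measurable
    let ?N = "PiM ?J (\<lambda>_. ?S)"
    interpret N: prob_space ?N by (rule prob_space_PiM_sphere)
    let ?A = "{x \<in> space ?N. clique_on k Q ?J x}"
    have A: "?A \<in> sets ?N" using mC[OF order_refl, of ?J] by measurable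
    have "emeasure (M (Suc i)) (E j)
      = (\<integral>\<^sup>+x. emeasure ?S {y \<in> space ?S. clique_on k Q ?J (x(Suc j := y)) \<and> perfect_upto k \<delta> j (x(Suc j := y)) \<and>
          \<not> proj_le k (x(Suc j := y)) {1..j} ((x(Suc j := y)) (Suc j)) \<delta>} \<partial>?N)"
      unfolding E_def using emeasure_PiM_insert_sphere[OF _ _ m4[unfolded M_def, unfolded arg_cong[OF ins, of "\<lambda>I. PiM I _"]]]
      unfolding M_def ins[symmetric] by simp
    also have "\<dots> \<le> (\<integral>\<^sup>+x. ennreal p_bad * indicator ?A x \<partial>?N)"
    proof (rule nn_integral_mono_AE)
      have "AE x in ?N. \<forall>m\<in>?J. ip k (x m) (x m) = 1" by (rule AE_tuple_unit) simp
      moreover have "AE x in ?N. x \<in> space ?N" by (rule AE_space)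
      ultimately show "AE x in ?N. emeasure ?S {y \<in> space ?S. clique_on k Q ?J (x(Suc j := y)) \<and> perfect_upto k \<delta> j (x(Suc j := y)) \<and>
          \<not> proj_le k (x(Suc j := y)) {1..j} ((x(Suc j := y)) (Suc j)) \<delta>} \<le> ennreal p_bad * indicator ?A x"
      proof eventually_elim
        case (elim x)
        have eq: "clique_on k Q ?J (x(Suc j := y)) = clique_on k Q ?J x"
          "perfect_upto k \<delta> j (x(Suc j := y)) = perfect_upto k \<delta> j x"
          "proj_le k (x(Suc j := y)) {1..j} v \<delta> = proj_le k x {1..j} v \<delta>" for y v
          by (rule clique_on_cong perfect_upto_cong proj_le_cong; auto)+
        show ?case
        proof (cases "clique_on k Q ?J x \<and> perfect_upto k \<delta> j x")
          case True
          have "measure ?S {y \<in> space ?S. \<not> proj_le k x {1..j} y \<delta>} \<le> p_bad"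
            using j i True elim sub by (intro bad) auto
          moreover have "x \<in> ?A" using True elim by simp
          ultimately show ?thesis
            unfolding eq using True by (simp add: S.emeasure_eq_measure ennreal_leI)
        next
          case False
          then show ?thesis unfolding eq by auto
        qed
      qed
    qed
    also have "\<dots> = ennreal (p_bad * N.prob ?A)"
      using \<epsilon> unfolding nn_integral_cmult_indicator[OF A] N.emeasure_eq_measure by (simp add: ennreal_mult')
    also have "N.prob ?A = Pc i"
      unfolding Pc_def M_def using j by (intro measure_clique_on_card[OF Q]) auto
    finally show "M.prob (E j) \<le> p_bad * Pc i"
      using \<epsilon> by (simp add: M.emeasure_eq_measure Pc_def)
  qed
  have mG: "{x \<in> space (M (Suc i)). clique_on k Q {1..Suc i} x \<and> perfect_upto k \<delta> (Suc i) x} \<in> sets (M (Suc i))"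
    unfolding M_def by measurable
  have "Pc (Suc i) \<le> M.prob ({x \<in> space (M (Suc i)). clique_on k Q {1..Suc i} x \<and> perfect_upto k \<delta> (Suc i) x} \<union> (\<Union>j\<in>{1..i}. E j))"
    unfolding Pc_def
  proof (rule M.finite_measure_mono)
    show "{x \<in> space (M (Suc i)). clique_on k Q {1..Suc i} x}
      \<subseteq> {x \<in> space (M (Suc i)). clique_on k Q {1..Suc i} x \<and> perfect_upto k \<delta> (Suc i) x} \<union> (\<Union>j\<in>{1..i}. E j)"
    proof
      fix x assume x: "x \<in> {x \<in> space (M (Suc i)). clique_on k Q {1..Suc i} x}"
      show "x \<in> {x \<in> space (M (Suc i)). clique_on k Q {1..Suc i} x \<and> perfect_upto k \<delta> (Suc i) x} \<union> (\<Union>j\<in>{1..i}. E j)"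
      proof (cases "perfect_upto k \<delta> (Suc i) x")
        case False
        define j where "j = (LEAST j. 1 \<le> j \<and> j < Suc i \<and> \<not> proj_le k x {1..j} (x (Suc j)) \<delta>)"
        have ex: "\<exists>j. 1 \<le> j \<and> j < Suc i \<and> \<not> proj_le k x {1..j} (x (Suc j)) \<delta>"
          using False by (auto simp: perfect_upto_def)
        have j: "1 \<le> j" "j < Suc i" "\<not> proj_le k x {1..j} (x (Suc j)) \<delta>"
          using LeastI_ex[OF ex] by (auto simp: j_def)
        have "perfect_upto k \<delta> j x"
          unfolding perfect_upto_def
        proof
          fix m assume m: "m \<in> {1..<j}"
          then have "\<not> (1 \<le> m \<and> m < Suc i \<and> \<not> proj_le k x {1..m} (x (Suc m)) \<delta>)"
            unfolding j_def by (intro not_less_Least) simp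
          then show "proj_le k x {1..m} (x (Suc m)) \<delta>" using m j by auto
        qed
        moreover have "clique_on k Q ({1..Suc i} - {Suc j}) x" using x by (auto simp: clique_on_def)
        ultimately have "x \<in> E j" using j x by (auto simp: E_def)
        then show ?thesis using j by auto
      qed (use x in auto)
    qed
    show "{x \<in> space (M (Suc i)). clique_on k Q {1..Suc i} x \<and> perfect_upto k \<delta> (Suc i) x} \<union> (\<Union>j\<in>{1..i}. E j) \<in> sets (M (Suc i))"
      using mE by (intro sets.Un sets.finite_UN mG) auto
  qed
  also have "\<dots> \<le> Pp (Suc i) + M.prob (\<Union>j\<in>{1..i}. E j)"
    unfolding Pp_def using mE by (intro measure_Un_le sets.finite_UN mG) auto
  also have "M.prob (\<Union>j\<in>{1..i}. E j) \<le> (\<Sum>j\<in>{1..i}. M.prob (E j))"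
    using mE by (intro measure_UNION_le) auto
  also have "\<dots> \<le> (\<Sum>j\<in>{1..i}. p_bad * Pc i)" by (rule sum_mono) (rule bound)
  also have "\<dots> = real i * p_bad * Pc i" by simp
  \<comment> \<open>The induction hypothesis enters only as \<open>Pc i \<le> 2 * Pp i\<close>,
    since \<eta> \<le> 1. This is the 2 in the assumption on \<open>p_bad\<close>, and it keeps the
    error from accumulating with the size of the clique.\<close>
  also have "\<dots> \<le> real R * p_bad * (2 * Pp i)"
  proof (rule mult_mono)
    have "(1 + \<eta>) * Pp i \<le> 2 * Pp i" using \<epsilon> by (intro mult_right_mono) (auto simp: Pp_def)
    then show "Pc i \<le> 2 * Pp i" using IH by simp
  qed (use i \<epsilon> in \<open>auto simp: Pc_def intro!: mult_right_mono\<close>)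
  also have "\<dots> = (2 * real R * p_bad) * Pp i" by simp
  also have "\<dots> \<le> (\<eta> * p_good) * Pp i" using \<epsilon> by (intro mult_right_mono) (auto simp: Pp_def)
  also have "\<dots> \<le> \<eta> * Pp (Suc i)" using extend \<epsilon> by (simp add: mult.assoc mult_left_mono)
  finally show ?case by (simp add: Pc_def Pp_def algebra_simps)
qed

section \<open>Choice of constants\<close>

lemma pred_proj_le_sphere:
  assumes "finite J"
  shows "Measurable.pred (sphere_unif k) (\<lambda>y. proj_le k x J y s)"
  unfolding measurable_cong_sets[OF sets_sphere_unif refl] using assms
  by (intro pred_proj_le) auto

lemma borel_measurable_ip_sphere: "(\<lambda>y. ip k y v) \<in> borel_measurable (sphere_unif k)"
  unfolding measurable_cong_sets[OF sets_sphere_unif refl] by measurable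

lemma sets_gauss_Collect:
  "Measurable.pred (PiM I (\<lambda>_. borel)) P \<Longrightarrow> {g \<in> space (gauss I). P g} \<in> sets (gauss I)"
  unfolding space_gauss sets_gauss by measurable

text \<open>A factor 4/5 from the Gram bound, 1/2 from |g|^2 > k / 2 and 1/5 from the quadratic tail
  multiply to 2/25; the first term accounts for short Gaussian vectors.\<close>

lemma sphere_not_proj_le_upper:
  assumes no: "nearly_orthonormal k x J" and J: "finite J" and \<delta>: "0 \<le> \<delta>"
  shows "measure (sphere_unif k) {y \<in> space (sphere_unif k). \<not> proj_le k x J y \<delta>}
    \<le> exp (- real k / 25) + exp (- (2/25 * \<delta>\<^sup>2 * real k)) * sqrt 2 ^ card J"
proof -
  interpret prob_space "gauss {..k}" by (rule prob_space_gauss) simp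
  let ?G = "gauss {..k}"
  let ?T = "2/5 * \<delta>\<^sup>2 * real k"
  let ?B = "{g \<in> space ?G. (L2_set g {..k})\<^sup>2 \<le> real k / 2}" and ?A = "{g \<in> space ?G. ?T \<le> (\<Sum>j\<in>J. (ip k g (x j))\<^sup>2)}"
  have mP: "Measurable.pred (PiM {..k} (\<lambda>_. borel)) (\<lambda>y. \<not> proj_le k x J y \<delta>)"
    using pred_proj_le_sphere[OF J, of k x \<delta>] unfolding measurable_cong_sets[OF sets_sphere_unif refl] by measurable
  have B: "?B \<in> events" by (rule sets_gauss_Collect) measurable
  have A: "?A \<in> events" by (rule sets_gauss_Collect) measurable
  have "measure (sphere_unif k) {y \<in> space (sphere_unif k). \<not> proj_le k x J y \<delta>}
    = prob {g \<in> space ?G. \<not> proj_le k x J (normalize_vec k g) \<delta>}"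
    by (rule measure_sphere_unif) (use mP in measurable)
  also have "\<dots> \<le> prob (?B \<union> ?A)"
  proof (intro finite_measure_mono subsetI)
    fix g assume g: "g \<in> {g \<in> space ?G. \<not> proj_le k x J (normalize_vec k g) \<delta>}"
    show "g \<in> ?B \<union> ?A"
    proof (cases "(L2_set g {..k})\<^sup>2 \<le> real k / 2")
      case False
      let ?n = "L2_set g {..k}"
      have n: "0 < ?n\<^sup>2" using False by (smt (verit) of_nat_0_le_iff divide_nonneg_nonneg)
      have "4/5 * \<delta>\<^sup>2 < (\<Sum>j\<in>J. (ip k (normalize_vec k g) (x j))\<^sup>2)"
        using g by (intro not_proj_le_imp_large[OF no _ \<delta>]) auto
      also have "\<dots> = (\<Sum>j\<in>J. (ip k g (x j))\<^sup>2) / ?n\<^sup>2"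
        by (simp add: ip_normalize_vec power_divide sum_divide_distrib)
      finally have "4/5 * \<delta>\<^sup>2 * ?n\<^sup>2 < (\<Sum>j\<in>J. (ip k g (x j))\<^sup>2)" using n by (simp add: pos_less_divide_eq)
      moreover have "4/5 * \<delta>\<^sup>2 * (real k / 2) \<le> 4/5 * \<delta>\<^sup>2 * ?n\<^sup>2" using False by (intro mult_left_mono) auto
      ultimately have "4/5 * \<delta>\<^sup>2 * (real k / 2) \<le> (\<Sum>j\<in>J. (ip k g (x j))\<^sup>2)" by linarith
      moreover have "4/5 * \<delta>\<^sup>2 * (real k / 2) = ?T" by simp
      ultimately have "?T \<le> (\<Sum>j\<in>J. (ip k g (x j))\<^sup>2)" by linarith
      then show ?thesis using g by blast
    qed (use g in simp)
  qed (use A B in auto)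
  also have "\<dots> \<le> prob ?B + prob ?A" using A B by (intro measure_Un_le)
  also have "\<dots> \<le> exp (- real k / 25) + exp (- ?T / 5) * sqrt 2 ^ card J"
    by (intro add_mono gauss_lower_tail gauss_quadratic_tail no J)
  also have "- ?T / 5 = - (2/25 * \<delta>\<^sup>2 * real k)" by simp
  finally show ?thesis .
qed

text \<open>Outside the upper tail |g| is at most 3/2 sqrt k, so Gaussian inner products of 3/2 b
  survive normalisation as b / sqrt k.\<close>

lemma sphere_orthant_lower:
  assumes no: "nearly_orthonormal k x J" and J: "finite J" and b: "0 < b" and k: "1 \<le> k"
  shows "exp (- (5/4 * real (card J) * (3/2 * b + 1)\<^sup>2)) * (1 / sqrt (5 * pi)) ^ card J - exp (1 - real k / 6)
    \<le> measure (sphere_unif k) {y \<in> space (sphere_unif k). \<forall>j\<in>J. b / sqrt (real k) \<le> ip k y (x j)}"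
proof -
  interpret prob_space "gauss {..k}" by (rule prob_space_gauss) simp
  let ?G = "gauss {..k}"
  let ?B = "{g \<in> space ?G. 9/4 * real k \<le> (L2_set g {..k})\<^sup>2}"
  let ?A = "{g \<in> space ?G. \<forall>j\<in>J. 3/2 * b \<le> ip k g (x j)}"
  let ?W = "{g \<in> space ?G. \<forall>j\<in>J. b / sqrt (real k) \<le> ip k (normalize_vec k g) (x j)}"
  have B: "?B \<in> events" by (rule sets_gauss_Collect) measurable
  have mW: "Measurable.pred (PiM {..k} (\<lambda>_. borel)) (\<lambda>y. \<forall>j\<in>J. b / sqrt (real k) \<le> ip k y (x j))"
    using J by (intro pred_intros_finite(3)) measurable
  have W: "?W \<in> events"
    by (intro sets_gauss_Collect measurable_compose[OF measurable_normalize_vec mW])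
  have "?A \<subseteq> ?B \<union> ?W"
  proof
    fix g assume g: "g \<in> ?A"
    show "g \<in> ?B \<union> ?W"
    proof (cases "9/4 * real k \<le> (L2_set g {..k})\<^sup>2")
      case False
      let ?n = "L2_set g {..k}"
      have "b / sqrt (real k) \<le> ip k (normalize_vec k g) (x j)" if j: "j \<in> J" for j
      proof -
        have gj: "3/2 * b \<le> ip k g (x j)" using g j by simp
        then have "?n \<noteq> 0" using ip_eq_0_of_self[of k g "x j"] b by (auto simp: ip_self)
        then have n: "0 < ?n" using L2_set_nonneg[of g "{..k}"] by linarith
        have "?n\<^sup>2 \<le> (3/2 * sqrt (real k))\<^sup>2" using False by (simp add: power_mult_distrib power_divide)
        then have "?n \<le> 3/2 * sqrt (real k)" by (rule power2_le_imp_le) simp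
        then have "b / sqrt (real k) * ?n \<le> b / sqrt (real k) * (3/2 * sqrt (real k))"
          using b by (intro mult_left_mono) auto
        also have "\<dots> = 3/2 * b" using k by simp
        finally have "b / sqrt (real k) * ?n \<le> ip k g (x j)" using gj by linarith
        then show ?thesis unfolding ip_normalize_vec pos_le_divide_eq[OF n] .
      qed
      then show ?thesis using g by simp
    qed (use g in simp)
  qed
  then have "prob ?A \<le> prob ?B + prob ?W"
    using B W by (intro order_trans[OF finite_measure_mono measure_Un_le]) auto
  moreover have "prob ?B \<le> exp (1 - real k / 6)" by (rule gauss_upper_tail)
  moreover have "exp (- (5/4 * real (card J) * (3/2 * b + 1)\<^sup>2)) * (1 / sqrt (5 * pi)) ^ card J \<le> prob ?A"
    using b by (intro gauss_orthant_lower no J) simp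
  moreover have "measure (sphere_unif k) {y \<in> space (sphere_unif k). \<forall>j\<in>J. b / sqrt (real k) \<le> ip k y (x j)} = prob ?W"
    by (rule measure_sphere_unif) (use mW in measurable)
  ultimately show ?thesis by linarith
qed

text \<open>The vectors \<open>z\<close> are the \<open>x j\<close> for blue and their negatives for
  red, so that one orthant bound serves both colours.\<close>

lemma sphere_good_lower:
  assumes imp: "\<And>y j. j \<in> J \<Longrightarrow> \<beta> \<le> ip k y (z j) \<Longrightarrow> Q (ip k (x j) y)"
    and Q: "Measurable.pred borel Q" and J: "finite J"
  shows "measure (sphere_unif k) {y \<in> space (sphere_unif k). \<forall>j\<in>J. \<beta> \<le> ip k y (z j)}
      - measure (sphere_unif k) {y \<in> space (sphere_unif k). \<not> proj_le k x J y \<delta>}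
    \<le> measure (sphere_unif k) {y \<in> space (sphere_unif k). (\<forall>j\<in>J. Q (ip k (x j) y)) \<and> proj_le k x J y \<delta>}"
proof -
  interpret prob_space "sphere_unif k" by (rule prob_space_sphere_unif)
  let ?S = "sphere_unif k"
  have mP: "Measurable.pred ?S (\<lambda>y. proj_le k x J y \<delta>)" by (rule pred_proj_le_sphere[OF J])
  have "Measurable.pred ?S (\<lambda>y. Q (ip k (x j) y))" for j
    using measurable_compose[OF borel_measurable_ip_sphere Q, of k "x j"] by (simp add: ip_commute[of k "x j"])
  then have mQ: "Measurable.pred ?S (\<lambda>y. \<forall>j\<in>J. Q (ip k (x j) y))"
    by (intro pred_intros_finite(3) J)
  note [measurable] = mP mQ
  have 1: "{y \<in> space ?S. \<not> proj_le k x J y \<delta>} \<in> events" by measurable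
  have 2: "{y \<in> space ?S. (\<forall>j\<in>J. Q (ip k (x j) y)) \<and> proj_le k x J y \<delta>} \<in> events" by measurable
  have "prob {y \<in> space ?S. \<forall>j\<in>J. \<beta> \<le> ip k y (z j)} \<le>
    prob ({y \<in> space ?S. (\<forall>j\<in>J. Q (ip k (x j) y)) \<and> proj_le k x J y \<delta>} \<union> {y \<in> space ?S. \<not> proj_le k x J y \<delta>})"
    using 1 2 imp by (intro finite_measure_mono) auto
  also have "\<dots> \<le> prob {y \<in> space ?S. (\<forall>j\<in>J. Q (ip k (x j) y)) \<and> proj_le k x J y \<delta>} + prob {y \<in> space ?S. \<not> proj_le k x J y \<delta>}"
    using 1 2 by (intro measure_Un_le)
  finally show ?thesis by linarith
qed

lemma nearly_orthonormal_uminus: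
  assumes "nearly_orthonormal k x J"
  shows "nearly_orthonormal k (\<lambda>m j. - x m j) J"
proof -
  have "lincomb (\<lambda>m j. - x m j) J a = lincomb x J (\<lambda>j. - a j)" for a
    by (simp add: lincomb_def)
  moreover have "(\<Sum>j\<in>J. (a j)\<^sup>2) = (\<Sum>j\<in>J. (- a j)\<^sup>2)" for a :: "nat \<Rightarrow> real" by simp
  ultimately show ?thesis using assms unfolding nearly_orthonormal_def by metis
qed

text \<open>The defining equation says that \<open>h\<close> vanishes, and \<open>h\<close> is
  strictly increasing. Its value (C - 1) ln 2 at 1/2 is positive because C > 1, so the zero lies
  below 1/2.\<close>

lemma p_crit_bounds:
  assumes C: "1 < C"
  shows "0 < p_crit C" "p_crit C < 1/2"
proof -
  define h where "h = (\<lambda>q. ln q - C * ln (1 - q))"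
  have iff: "C = ln q / ln (1 - q) \<longleftrightarrow> h q = 0" if "0 < q" "q < 1/2" for q :: real
  proof -
    have "ln (1 - q) < 0" using that by simp
    then show ?thesis by (auto simp: h_def field_simps)
  qed
  have mono: "h q < h q'" if "0 < q" "q < q'" "q' < 1" for q q'
  proof -
    have "ln q < ln q'" "ln (1 - q') < ln (1 - q)" using that by simp_all
    then have "C * ln (1 - q') < C * ln (1 - q)" using C by simp
    with \<open>ln q < ln q'\<close> show ?thesis by (simp add: h_def)
  qed
  \<comment> \<open>Then ln q0 = - 2 C, while ln (1 - q0) \<ge> - 2 because q0 \<le> 1/2; so
    \<open>h\<close> is non-positive here.\<close>
  define q0 where "q0 = exp (- 2 * C)"
  have q0: "0 < q0" "q0 \<le> 1/2"
  proof -
    have "2 \<le> exp (2 * C)" using exp_ge_add_one_self[of "2 * C"] C by linarith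
    then show "q0 \<le> 1/2" by (simp add: q0_def exp_minus field_simps)
  qed (simp add: q0_def)
  have h0: "h q0 \<le> 0"
  proof -
    have "- q0 - 2 * q0\<^sup>2 \<le> ln (1 - q0)" using q0 by (intro ln_one_minus_pos_lower_bound) auto
    moreover have "q0\<^sup>2 \<le> (1/2)\<^sup>2" using q0 by (intro power_mono) auto
    ultimately have "- 2 \<le> ln (1 - q0)" using q0 by (simp add: power2_eq_square)
    then have "C * (- 2) \<le> C * ln (1 - q0)" using C by (intro mult_left_mono) auto
    then show ?thesis by (simp add: h_def q0_def)
  qed
  have h1: "0 < h (1/2)"
  proof -
    have "h (1/2) = (C - 1) * ln 2" by (simp add: h_def ln_div algebra_simps)
    then show ?thesis using C by simp
  qed
  have "continuous_on {q0..1/2} h"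
    unfolding h_def using q0 by (intro continuous_intros) auto
  then obtain q where q: "q0 \<le> q" "q \<le> 1/2" "h q = 0"
    using IVT'[of h q0 0 "1/2"] h0 h1 q0 by auto
  then have "q \<noteq> 1/2" using h1 by (metis less_irrefl)
  then have q': "0 < q" "q < 1/2" using q q0 by linarith+
  have "p_crit C = q"
    unfolding p_crit_def
  proof (rule the_equality)
    show "0 < q \<and> q < 1/2 \<and> C = ln q / ln (1 - q)" using q' q iff by auto
    fix q1 assume *: "0 < q1 \<and> q1 < 1/2 \<and> C = ln q1 / ln (1 - q1)"
    then have "h q1 = 0" using iff by auto
    then show "q1 = q"
      using mono[of q1 q] mono[of q q1] * q' q by (cases q1 q rule: linorder_cases) auto
  qed
  then show "0 < p_crit C" "p_crit C < 1/2" using q' by auto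
qed

text \<open>With b^2 \<le> 4 L the square is at most 18 L + 2, and sqrt (5 pi) \<le> exp 2 adds 2
  per vertex. The total 45/2 L + 9/2 is at most 25 L because L \<ge> 2.\<close>

lemma orthant_exponent:
  assumes L: "2 \<le> L" and b: "0 \<le> b" "b\<^sup>2 \<le> 4 * L" and i: "real i \<le> N"
  shows "exp (- (25 * N * L)) \<le> exp (- (5/4 * real i * (3/2 * b + 1)\<^sup>2)) * (1 / sqrt (5 * pi)) ^ i"
proof -
  have "(3/2 * b + 1)\<^sup>2 \<le> 9/2 * b\<^sup>2 + 2"
  proof -
    have "0 \<le> (3/2 * b - 1)\<^sup>2" by simp
    then show ?thesis by (simp add: power2_eq_square algebra_simps)
  qed
  also have "\<dots> \<le> 18 * L + 2" using b by simp
  finally have s: "5/4 * (3/2 * b + 1)\<^sup>2 + 2 \<le> 25 * L" using L by linarith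
  have "sqrt (5 * pi) \<le> 5" using pi_less_4 by (intro real_le_lsqrt) auto
  also have "5 \<le> exp (2::real)" using exp_lower_Taylor_quadratic[of "2::real"] by simp
  finally have "exp (- 2) \<le> 1 / sqrt (5 * pi)" by (simp add: exp_minus field_simps)
  then have "exp (- 2) ^ i \<le> (1 / sqrt (5 * pi)) ^ i" by (intro power_mono) auto
  then have "exp (- (5/4 * real i * (3/2 * b + 1)\<^sup>2)) * exp (- 2) ^ i
      \<le> exp (- (5/4 * real i * (3/2 * b + 1)\<^sup>2)) * (1 / sqrt (5 * pi)) ^ i"
    by (intro mult_left_mono) auto
  moreover have "exp (- (5/4 * real i * (3/2 * b + 1)\<^sup>2)) * exp (- 2) ^ i
      = exp (- (real i * (5/4 * (3/2 * b + 1)\<^sup>2 + 2)))"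
    by (simp add: exp_of_nat_mult[symmetric] mult_exp_exp algebra_simps)
  moreover have "real i * (5/4 * (3/2 * b + 1)\<^sup>2 + 2) \<le> N * (25 * L)"
    using i s by (intro mult_mono) auto
  then have "exp (- (25 * N * L)) \<le> exp (- (real i * (5/4 * (3/2 * b + 1)\<^sup>2 + 2)))" by simp
  ultimately show ?thesis by linarith
qed

text \<open>The gap 31 - 25 leaves exp (6 N L), which must beat 8 r 2^N \<le> exp (9 N); L \<ge> 2
  suffices.\<close>

lemma final_exponent:
  assumes L: "2 \<le> L" and N: "2 \<le> N" and r: "real r \<le> N"
  shows "2 * real r * (2 * exp (- (31 * N * L))) \<le> 2 powr (- N) * (exp (- (25 * N * L)) / 2)"
proof -
  have N0: "0 \<le> N * L" using L N by simp
  have "8 * real r \<le> exp (8 * N)" using exp_ge_add_one_self[of "8 * N"] r by linarith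
  moreover have "2 powr N \<le> exp N"
  proof -
    have "ln 2 \<le> (1::real)" using ln_le_minus_one[of "2::real"] by simp
    then have "N * ln 2 \<le> N * 1" using N by (intro mult_left_mono) auto
    then show ?thesis by (simp add: powr_def)
  qed
  ultimately have "8 * real r * 2 powr N \<le> exp (8 * N) * exp N" by (intro mult_mono) auto
  also have "\<dots> = exp (9 * N)" by (simp add: mult_exp_exp)
  also have "\<dots> \<le> exp (6 * (N * L))" using mult_left_mono[OF L, of N] N by simp
  finally have "8 * real r * 2 powr N * exp (- (31 * N * L)) \<le> exp (6 * (N * L)) * exp (- (31 * N * L))"
    by (rule mult_right_mono) simp
  also have "\<dots> = exp (- (25 * N * L))" by (simp add: mult_exp_exp)
  finally show ?thesis by (simp add: powr_minus field_simps)
qed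

text \<open>The first condition on \<open>D\<close> gives i \<delta>^2 \<le> 1/100, so perfect
  prefixes are nearly orthonormal. The second makes the dimension so large that atypical lengths of
  Gaussian vectors cost at most exp (- 31 N L).\<close>

lemma clique_le_perfect_clique_sphere:
  fixes C l D :: real
  assumes C: "1 < C" and l: "2 \<le> l" and k: "real k = D\<^sup>2 * l\<^sup>2"
    and D: "100 * (alpha C)\<^sup>2 * C \<le> D\<^sup>2" "775 * C * ln (10 / p_crit C) \<le> D\<^sup>2 * l"
    and p: "p_crit C < p" "p < 1/2" and r: "1 \<le> r" "real r \<le> C * l"
    and Q: "Q = (\<lambda>u. u \<le> - cap_const k p / sqrt (real k)) \<or> Q = (\<lambda>u. \<not> u \<le> - cap_const k p / sqrt (real k))"
  defines "\<delta> \<equiv> alpha C * sqrt l / sqrt (real k)"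
  defines "M \<equiv> PiM {1..r} (\<lambda>_. sphere_unif k)"
  shows "measure M {x \<in> space M. clique_on k Q {1..r} x}
    \<le> (1 + 2 powr (- (C * l))) * measure M {x \<in> space M. clique_on k Q {1..r} x \<and> perfect_upto k \<delta> r x}"
proof -
  \<comment> \<open>\<open>b\<close> is chosen so that exp (- b^2 / 4) = q / 2. The other tail in
    the bound for the cap constant is at most q / 10, so \<open>b\<close> dominates that
    constant.\<close>
  define q L N b where "q = p_crit C" and "L = ln (10 / q)" and "N = C * l" and "b = 2 * sqrt (ln (2 / q))"
  have q: "0 < q" "q < 1/2" using p_crit_bounds[OF C] by (auto simp: q_def)
  have L2: "2 \<le> L"
  proof -
    have "exp 2 = exp 1 * exp (1::real)" by (simp add: mult_exp_exp)
    also have "\<dots> \<le> 3 * 3" using e_less_272 by (intro mult_mono) auto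
    also have "\<dots> \<le> 10 / q" using q by (simp add: field_simps)
    finally show ?thesis unfolding L_def using q by (simp add: ln_ge_iff)
  qed
  have expL: "exp (- L) = q / 10" using q by (simp add: L_def exp_minus)
  have N: "2 \<le> N" "N \<ge> l" using l mult_right_mono[of 1 C l] C unfolding N_def by linarith+
  have NL: "4 \<le> N * L" "N * 2 \<le> N * L" "L \<le> N * L"
    using mult_mono[of 2 N 2 L] mult_left_mono[OF L2, of N] mult_right_mono[of 1 N L] N L2 by auto
  have ln2q: "0 < ln (2 / q)" "ln (2 / q) \<le> L" using q unfolding L_def by (auto intro!: divide_right_mono)
  have b: "0 < b" "b\<^sup>2 = 4 * ln (2 / q)" "b\<^sup>2 \<le> 4 * L" using ln2q by (auto simp: b_def power_mult_distrib)
  \<comment> \<open>775 = 25 * 31, where 25 is the denominator of the rate in the lower tail of the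
    Gaussian norm.\<close>
  have k25: "31 * (N * L) \<le> real k / 25"
  proof -
    have "775 * C * L * l \<le> D\<^sup>2 * l * l" using D(2) l by (intro mult_right_mono) (auto simp: L_def q_def)
    then show ?thesis by (simp add: k N_def power2_eq_square mult_ac)
  qed
  then have k1: "1 \<le> k" and kpos: "0 < real k" using NL by (auto simp: Suc_le_eq)
  \<comment> \<open>This uses the second entry of the maximum in \<open>alpha\<close>; its factor 20
    squares to 400.\<close>
  have a400: "400 * (C * L) \<le> (alpha C)\<^sup>2"
  proof -
    have "20 * sqrt (C * L) \<le> alpha C" by (simp add: alpha_def L_def q_def)
    then have "(20 * sqrt (C * L))\<^sup>2 \<le> (alpha C)\<^sup>2" using C L2 by (intro power_mono) auto
    then show ?thesis using C L2 by (simp add: power_mult_distrib)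
  qed
  have a0: "0 \<le> alpha C" by (simp add: alpha_def)
  have \<delta>0: "0 \<le> \<delta>" using a0 l by (simp add: \<delta>_def)
  have \<delta>k: "\<delta>\<^sup>2 * real k = (alpha C)\<^sup>2 * l" using kpos l by (simp add: \<delta>_def power_mult_distrib power_divide)
  have \<delta>k': "400 * (N * L) \<le> \<delta>\<^sup>2 * real k"
    using mult_right_mono[OF a400, of l] l unfolding \<delta>k by (simp add: N_def mult_ac)
  have small: "real i * \<delta>\<^sup>2 \<le> 1/100" if "real i \<le> N" for i
  proof -
    have "real i * \<delta>\<^sup>2 * real k \<le> N * ((alpha C)\<^sup>2 * l)"
      unfolding \<delta>k[symmetric] mult.assoc using that by (intro mult_right_mono) auto
    also have "\<dots> = (100 * (alpha C)\<^sup>2 * C) * l\<^sup>2 / 100" by (simp add: N_def power2_eq_square)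
    also have "\<dots> \<le> D\<^sup>2 * l\<^sup>2 / 100" using D(1) by (intro divide_right_mono mult_right_mono) auto
    finally have "real i * \<delta>\<^sup>2 * real k \<le> 1/100 * real k" by (simp add: k)
    then show ?thesis using kpos by simp
  qed
  have exp_k25: "exp (- real k / 25) \<le> exp (- (31 * N * L))" using k25 by simp
  have cap: "0 \<le> cap_const k p" "cap_const k p \<le> b"
  proof -
    have "exp (- b\<^sup>2 / 4) = q / 2" using q by (simp add: b exp_minus)
    moreover have "exp (- real k / 25) \<le> exp (- L)" using k25 NL by simp
    ultimately have "exp (- real k / 25) + exp (- b\<^sup>2 / 4) \<le> q" using expL q by simp
    then show "0 \<le> cap_const k p" "cap_const k p \<le> b"
      using cap_const_bounds[OF k1 q(1) _ p(2) b(1)] p by (auto simp: q_def)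
  qed
  have mQ: "Measurable.pred borel Q" using Q by auto
  let ?S = "sphere_unif k"
  define p_bad p_good where "p_bad = 2 * exp (- (31 * N * L))" and "p_good = exp (- (25 * N * L)) / 2"
  have no: "nearly_orthonormal k x {1..i}"
    if "i < r" "\<And>m. m \<in> {1..i} \<Longrightarrow> ip k (x m) (x m) = 1" "perfect_upto k \<delta> i x" for i x
    using that small[of i] r by (intro nearly_orthonormal_of_proj_le) (auto simp: perfect_upto_def N_def)
  have bad: "measure ?S {y \<in> space ?S. \<not> proj_le k x {1..i} y \<delta>} \<le> p_bad"
    if "i < r" and nox: "nearly_orthonormal k x {1..i}" for i x
  proof -
    have iN: "real i \<le> N" using that r by (simp add: N_def)
    have "sqrt 2 ^ i \<le> exp 1 ^ i"
    proof (rule power_mono)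
      have "sqrt 2 \<le> (2::real)" by (rule real_le_lsqrt) auto
      then show "sqrt 2 \<le> exp (1::real)" using exp_ge_add_one_self[of "1::real"] by simp
    qed simp
    also have "\<dots> = exp (real i)" by (simp add: exp_of_nat_mult[symmetric])
    also have "\<dots> \<le> exp (N * L)"
    proof -
      have "real i \<le> N * L" using iN NL(2) N by linarith
      then show ?thesis by simp
    qed
    finally have s2: "sqrt 2 ^ i \<le> exp (N * L)" .
    \<comment> \<open>32 = 400 * 2/25; one of these units is spent on the factor sqrt 2 per
      vertex.\<close>
    have "32 * (N * L) \<le> 2/25 * \<delta>\<^sup>2 * real k" using \<delta>k' by linarith
    then have "exp (- (2/25 * \<delta>\<^sup>2 * real k)) \<le> exp (- (32 * (N * L)))" by simp
    then have "exp (- (2/25 * \<delta>\<^sup>2 * real k)) * sqrt 2 ^ i \<le> exp (- (32 * (N * L))) * exp (N * L)"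
      using s2 by (intro mult_mono) auto
    also have "\<dots> = exp (- (31 * N * L))" by (simp add: mult_exp_exp)
    finally have "exp (- (2/25 * \<delta>\<^sup>2 * real k)) * sqrt 2 ^ i \<le> exp (- (31 * N * L))" .
    then show ?thesis
      using sphere_not_proj_le_upper[OF nox finite_atLeastAtMost \<delta>0] exp_k25
      unfolding p_bad_def card_atLeastAtMost diff_Suc_1 by linarith
  qed
  have good: "p_good \<le> measure ?S {y \<in> space ?S. (\<forall>j\<in>{1..i}. Q (ip k (x j) y)) \<and> proj_le k x {1..i} y \<delta>}"
    if ir: "1 \<le> i" "i < r" and nox: "nearly_orthonormal k x {1..i}" for i x
  proof -
    have iN: "real i \<le> N" using that r by (simp add: N_def)
    have e1: "exp (1 - real k / 6) \<le> exp (- (31 * N * L))" using k25 NL by simp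
    \<comment> \<open>The upper norm tail and \<open>p_bad\<close> together are at most three times
      exp (- 31 N L), and this has to fit into half of exp (- 25 N L).\<close>
    have "6 \<le> exp (6 * (N * L))" using exp_ge_add_one_self[of "6 * (N * L)"] NL(1) by linarith
    then have "6 * exp (- (31 * N * L)) \<le> exp (6 * (N * L)) * exp (- (31 * N * L))"
      by (intro mult_right_mono) auto
    also have "\<dots> = exp (- (25 * N * L))" by (simp add: mult_exp_exp)
    finally have e3: "exp (- (31 * N * L)) + p_bad \<le> exp (- (25 * N * L)) / 2" by (simp add: p_bad_def)
    have main: "p_good \<le> measure ?S {y \<in> space ?S. (\<forall>j\<in>{1..i}. Q (ip k (x j) y)) \<and> proj_le k x {1..i} y \<delta>}"
      if noz: "nearly_orthonormal k z {1..i}" and imp: "\<And>y j. b / sqrt (real k) \<le> ip k y (z j) \<Longrightarrow> Q (ip k (x j) y)" for z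
    proof -
      have "exp (- (25 * N * L)) - exp (1 - real k / 6) \<le> measure ?S {y \<in> space ?S. \<forall>j\<in>{1..i}. b / sqrt (real k) \<le> ip k y (z j)}"
        using sphere_orthant_lower[OF noz _ b(1) k1] orthant_exponent[OF L2 less_imp_le[OF b(1)] b(3) iN] by simp
      moreover have "measure ?S {y \<in> space ?S. \<forall>j\<in>{1..i}. b / sqrt (real k) \<le> ip k y (z j)}
          - measure ?S {y \<in> space ?S. \<not> proj_le k x {1..i} y \<delta>}
        \<le> measure ?S {y \<in> space ?S. (\<forall>j\<in>{1..i}. Q (ip k (x j) y)) \<and> proj_le k x {1..i} y \<delta>}"
        by (rule sphere_good_lower) (use imp mQ in auto)
      ultimately show ?thesis
        using bad[OF ir(2) nox] e1 e3 unfolding p_good_def by linarith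
    qed
    \<comment> \<open>Inner products of at most - b / sqrt k are red because \<open>b\<close>
      dominates the cap constant; positive ones are blue because that constant is
      non-negative.\<close>
    have t: "cap_const k p / sqrt (real k) \<le> b / sqrt (real k)" "0 < b / sqrt (real k)" "0 \<le> cap_const k p / sqrt (real k)"
      using cap b kpos by (auto simp: divide_right_mono)
    from Q show ?thesis
    proof
      assume Q: "Q = (\<lambda>u. u \<le> - cap_const k p / sqrt (real k))"
      have "ip k y (\<lambda>n. - x j n) = - ip k (x j) y" for y j by (simp add: ip_def sum_negf mult.commute)
      then show ?thesis
        using t by (intro main[of "\<lambda>m n. - x m n"] nearly_orthonormal_uminus nox) (simp add: Q)
    next
      assume Q: "Q = (\<lambda>u. \<not> u \<le> - cap_const k p / sqrt (real k))"
      show ?thesis using t by (intro main[of x] nox) (simp add: Q ip_commute[of k "x _"])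
    qed
  qed
  have "2 powr (- N) \<le> 1" using powr_mono[of "- N" 0 "2::real"] N by simp
  moreover have "2 * real r * p_bad \<le> 2 powr (- N) * p_good"
    unfolding p_bad_def p_good_def using r by (intro final_exponent L2 N(1)) (simp add: N_def)
  moreover have "0 \<le> p_bad" "0 \<le> p_good" by (simp_all add: p_bad_def p_good_def)
  ultimately show ?thesis
    unfolding M_def N_def[symmetric] using bad good no r(1)
    by (intro clique_le_perfect_clique[where R=r and p_bad=p_bad and p_good=p_good] mQ) simp_all
qed

lemma is_clique_iff_clique_on:
  "is_clique Red k p r x \<longleftrightarrow> clique_on k (\<lambda>u. u \<le> - cap_const k p / sqrt (real k)) {1..r} x"
  "is_clique Blue k p r x \<longleftrightarrow> clique_on k (\<lambda>u. \<not> u \<le> - cap_const k p / sqrt (real k)) {1..r} x"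
  by (auto simp: is_clique_def clique_on_def edge_colour_def)

lemma perfect_iff_perfect_upto:
  "perfect C l k r x \<longleftrightarrow> perfect_upto k (alpha C * sqrt (real l) / sqrt (real k)) r x"
proof -
  have "{1..r - 1} = {1..<r}" by auto
  moreover have "0 \<le> alpha C * sqrt (real l) / sqrt (real k)" by (simp add: alpha_def)
  ultimately show ?thesis by (simp add: perfect_def perfect_upto_def norm_orth_proj_le_iff)
qed

theorem theorem7p1:
  fixes C :: real
  assumes "C > 1"
  shows "\<exists>D0::real. \<forall>D\<ge>D0. \<exists>l0::nat. \<forall>l\<ge>l0. \<forall>k::nat. real k = D\<^sup>2 * (real l)\<^sup>2 \<longrightarrow>
    (\<forall>p::real. p_crit C < p \<and> p < 1/2 \<longrightarrow>
      (\<forall>r::nat. 2 \<le> r \<and> real r \<le> C * real l \<longrightarrow>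
         P_clique Red k p r \<le> (1 + 2 powr (- (C * real l))) * P_clique_per Red C l k p r \<and>
         P_clique Blue k p r \<le> (1 + 2 powr (- (C * real l))) * P_clique_per Blue C l k p r))"
proof (intro exI allI impI)
  \<comment> \<open>This fixes the witness for \<open>D0\<close>. Its main term squares to the
    required 100 alpha^2 C, and the added 1 makes \<open>D\<close> positive.\<close>
  fix D :: real assume D: "10 * alpha C * sqrt C + 1 \<le> D"
  have a: "0 \<le> 10 * alpha C * sqrt C" using assms by (simp add: alpha_def)
  have "(10 * alpha C * sqrt C)\<^sup>2 \<le> D\<^sup>2" using D a by (intro power_mono) auto
  then have D1: "100 * (alpha C)\<^sup>2 * C \<le> D\<^sup>2" using assms by (simp add: power_mult_distrib)
  have D0: "0 < D\<^sup>2" using D a by simp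
  \<comment> \<open>The threshold depends on \<open>D\<close>: it is where D^2 l reaches the 775 C
    ln (10 / p_crit C) that controls the norm tails.\<close>
  let ?l0 = "max 2 (nat \<lceil>775 * C * ln (10 / p_crit C) / D\<^sup>2\<rceil>)"
  fix l k :: nat and p :: real and r :: nat
  assume l: "?l0 \<le> l" and k: "real k = D\<^sup>2 * (real l)\<^sup>2" and p: "p_crit C < p \<and> p < 1/2"
    and r: "2 \<le> r \<and> real r \<le> C * real l"
  have "775 * C * ln (10 / p_crit C) / D\<^sup>2 \<le> real l" using l by linarith
  then have D2: "775 * C * ln (10 / p_crit C) \<le> D\<^sup>2 * real l" using D0 by (simp add: pos_divide_le_eq mult.commute)
  have l2: "2 \<le> real l" using l by simp
  note main = clique_le_perfect_clique_sphere[OF assms l2 k D1 D2 conjunct1[OF p] conjunct2[OF p] _ conjunct2[OF r]]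
  show "P_clique Red k p r \<le> (1 + 2 powr (- (C * real l))) * P_clique_per Red C l k p r \<and>
    P_clique Blue k p r \<le> (1 + 2 powr (- (C * real l))) * P_clique_per Blue C l k p r"
    unfolding P_clique_def P_clique_per_def sphere_tuples_def is_clique_iff_clique_on perfect_iff_perfect_upto
    using r by (intro conjI main) auto
qed

end
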